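(* Let $X=\mathbb R^d$ and let $m$ be a measure on $X\times\mathbb R_+$ of the form $dm(x,s)=\frac{l(x,s)}{s}\,dx\,ds$ with $l(x,s)>0$ for all $(x,s)\in X\times\mathbb R_+$, and assume that $m(\Lambda\times\mathbb R_+)<\infty$ for all $\Lambda\in\mathcal B_0(X)$. Then $\mu_m$ is quasi-invariant with respect to the action of $\operatorname{Diff}_0(X)$ and for each $\varphi\in\operatorname{Diff}_0(X)$ we have $$\frac{d\mu_m^\varphi}{d\mu_m}(\eta)=\prod_{x\in\tau(\eta)}\frac{l(\varphi^{-1}(x),s_x)}{l(x,s_x)}J_\varphi(x).$$
   Context: $\mathbb R_+=(0,\infty)$; $l:X\times\mathbb R_+\to\mathbb R_+$ is measurable; $dx$ is Lebesgue measure. $\mathcal B_0(X)$ is the collection of Borel subsets of $X$ with compact closure. $\mathbb M(X)$ is the set of Radon measures on $X$ (finite on compact sets) with the vague topology and its Borel $\sigma$-algebra. $\mathbb K(X)\subset\mathbb M(X)$ is the set of discrete Radon measures $\eta=\sum_i s_i\delta_{x_i}$ with $s_i>0$, the $x_i\in X$ distinct and at most countably many (the zero measure included), with the trace $\sigma$-algebra. For $\eta\in\mathbb K(X)$, $\tau(\eta)=\{x_i\}$ is its set of atoms and $s_x:=\eta(\{x\})$ for $x\in\tau(\eta)$. $\mu_m$ denotes the unique probability measure on $\mathbb K(X)$ with Fourier transform $\int_{\mathbb K(X)}e^{i\int f\,d\eta}\,d\mu_m(\eta)=\exp\left[\int_X\int_{\mathbb R_+}(e^{isf(x)}-1)\,dm(x,s)\right]$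 for all continuous compactly supported $f:X\to\mathbb R$; it exists whenever $m(\{x\}\times\mathbb R_+)=0$ for all $x$ and $\int_{A\times\mathbb R_+}\min\{s,1\}\,dm<\infty$ for all $A\in\mathcal B_0(X)$. $\operatorname{Diff}_0(X)$ is the group (under composition) of $C^\infty$ diffeomorphisms of $X$ that equal the identity outside a compact set. It acts on $\mathbb K(X)$ by pushforward: $\varphi^*\eta=\sum_i s_i\delta_{\varphi(x_i)}$ for $\eta=\sum_i s_i\delta_{x_i}$. $\mu_m^\varphi$ is the pushforward of $\mu_m$ under $\eta\mapsto\varphi^*\eta$; $\mu_m$ is quasi-invariant with respect to $\operatorname{Diff}_0(X)$ if $\mu_m^\varphi$ is equivalent to $\mu_m$ for each $\varphi$. $J_\varphi(x)$ is the density at $x$ of the pushforward of Lebesgue measure under $\varphi$ with respect to Lebesgue measure, i.e. $J_\varphi(x)=|\det D(\varphi^{-1})(x)|$. *)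

theory Defs
  imports "HOL-Probability.Probability"
begin

definition compactly_supported_continuous :: "('a::euclidean_space \<Rightarrow> real) \<Rightarrow> bool" where
  "compactly_supported_continuous f \<longleftrightarrow> continuous_on UNIV f \<and> compact (closure {x. f x \<noteq> 0})"

definition radon_measures :: "'a::euclidean_space measure set" where
  "radon_measures = {\<eta>. sets \<eta> = sets borel \<and> (\<forall>K. compact K \<longrightarrow> emeasure \<eta> K < \<infinity>)}"

text \<open>The coarsest topology on the Radon measures for which \<open>\<eta> \<mapsto> \<integral>f d\<eta>\<close> is continuous for every
  continuous compactly supported \<open>f\<close>.\<close>

definition vague_topology :: "'a::euclidean_space measure topology" where
  "vague_topology = topology_generated_by
     {{\<eta> \<in> radon_measures. (\<integral>x. f x \<partial>\<eta>) \<in> U} | f U. compactly_supported_continuous f \<and> open U}"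

definition radon_space :: "'a::euclidean_space measure measure" where
  "radon_space = sigma radon_measures {U. openin vague_topology U}"

text \<open>The measures \<open>\<Sum>\<^sub>i s\<^sub>i \<delta>(x\<^sub>i)\<close>; indexing by the set \<open>A\<close> of positions makes the \<open>x\<^sub>i\<close> distinct.\<close>

definition discrete_radon_measures :: "'a::euclidean_space measure set" where
  "discrete_radon_measures = {\<eta> \<in> radon_measures. \<exists>A s. countable A \<and> (\<forall>x\<in>A. 0 < s x) \<and>
     (\<forall>B\<in>sets borel. emeasure \<eta> B = (\<Sum>\<^sub>\<infinity>x\<in>A. ennreal (s x) * indicator B x))}"

definition discrete_radon_space :: "'a::euclidean_space measure measure" where
  "discrete_radon_space = restrict_space radon_space discrete_radon_measures"

definition atoms :: "'a::euclidean_space measure \<Rightarrow> 'a set" where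
  "atoms \<eta> = {x. 0 < emeasure \<eta> {x}}"

definition intensity :: "('a::euclidean_space \<Rightarrow> real \<Rightarrow> real) \<Rightarrow> ('a \<times> real) measure" where
  "intensity l = density (lborel \<Otimes>\<^sub>M restrict_space lborel {0<..}) (\<lambda>(x, s). ennreal (l x s / s))"

text \<open>The description is proper if \<open>m\<close> has no mass on the fibres \<open>{x} \<times> (0, \<infinity>)\<close> and \<open>min s 1\<close> is
  \<open>m\<close>-integrable over \<open>A \<times> (0, \<infinity>)\<close> for every bounded Borel set \<open>A\<close>.\<close>

definition random_measure_law :: "('a::euclidean_space \<times> real) measure \<Rightarrow> 'a measure measure" where
  "random_measure_law m = (THE \<mu>. prob_space \<mu> \<and> sets \<mu> = sets discrete_radon_space \<and>
     (\<forall>f. compactly_supported_continuous f \<longrightarrow>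
        (\<integral>\<eta>. exp (\<i> * complex_of_real (\<integral>x. f x \<partial>\<eta>)) \<partial>\<mu>) =
        exp (\<integral>(x, s). exp (\<i> * complex_of_real (s * f x)) - 1 \<partial>m)))"

text \<open>In finite dimension the derivative of \<open>f\<close>, as a map into the linear maps, is \<open>k\<close> times continuously
  differentiable iff all the directional derivatives of \<open>f\<close> are.\<close>

primrec Ck :: "nat \<Rightarrow> ('a::euclidean_space \<Rightarrow> 'b::euclidean_space) \<Rightarrow> bool" where
  "Ck 0 f \<longleftrightarrow> continuous_on UNIV f"
| "Ck (Suc k) f \<longleftrightarrow> (\<forall>x. f differentiable (at x)) \<and> (\<forall>v. Ck k (\<lambda>x. frechet_derivative f (at x) v))"

definition smooth :: "('a::euclidean_space \<Rightarrow> 'b::euclidean_space) \<Rightarrow> bool" where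
  "smooth f \<longleftrightarrow> (\<forall>k. Ck k f)"

definition Diff0 :: "('a::euclidean_space \<Rightarrow> 'a) set" where
  "Diff0 = {\<phi>. bij \<phi> \<and> smooth \<phi> \<and> smooth (inv \<phi>) \<and> (\<exists>K. compact K \<and> (\<forall>x. x \<notin> K \<longrightarrow> \<phi> x = x))}"

definition pushforward_law ::
    "('a::euclidean_space \<Rightarrow> 'a) \<Rightarrow> 'a measure measure \<Rightarrow> 'a measure measure" where
  "pushforward_law \<phi> \<mu> = distr \<mu> discrete_radon_space (\<lambda>\<eta>. distr \<eta> borel \<phi>)"

definition quasi_invariant :: "'a::euclidean_space measure measure \<Rightarrow> bool" where
  "quasi_invariant \<mu> \<longleftrightarrow> (\<forall>\<phi>\<in>Diff0. absolutely_continuous \<mu> (pushforward_law \<phi> \<mu>) \<and>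
     absolutely_continuous (pushforward_law \<phi> \<mu>) \<mu>)"

definition jacobian_density :: "(real ^ 'n \<Rightarrow> real ^ 'n) \<Rightarrow> real ^ 'n \<Rightarrow> real" where
  "jacobian_density \<phi> x = \<bar>det (matrix (frechet_derivative (inv \<phi>) (at x)))\<bar>"

text \<open>Convergence of the product over a possibly infinite index set along the finite subsets, in
  analogy with \<^const>\<open>has_sum\<close>; if all but finitely many factors are 1, this is the finite product of
  the others.\<close>

definition has_unordered_prod ::
    "('i \<Rightarrow> 'b::{comm_monoid_mult, topological_space}) \<Rightarrow> 'i set \<Rightarrow> 'b \<Rightarrow> bool" where
  "has_unordered_prod f A p \<longleftrightarrow> ((\<lambda>F. \<Prod>x\<in>F. f x) \<longlongrightarrow> p) (finite_subsets_at_top A)"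

end

theory Submission
  imports Defs
begin

text \<open>The law \<open>\<mu>\<close> is that of \<open>\<eta> = \<Sum> s \<delta>\<^sub>x\<close>, where \<open>(x, s)\<close> runs through the points of a Poisson process with intensity
  \<open>m\<close>. A diffeomorphism \<open>\<phi>\<close> moves each point \<open>(x, s)\<close> to \<open>(\<phi> x, s)\<close> and so turns that process into the
  Poisson process whose intensity is the image of \<open>m\<close>. By the change of variables formula this image is
  \<open>\<rho> m\<close> with \<open>\<rho>(x, s) = l(\<phi>\<^sup>-\<^sup>1 x, s) / l(x, s) * J(x)\<close>. Outside the compact set \<open>K\<close> on which \<open>\<phi>\<close> acts,
  \<open>\<rho> = 1\<close>. Over \<open>K\<close> both intensities have the same finite mass, because \<open>\<phi>\<close> maps \<open>K\<close> onto itself. Hence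
  there are only finitely many points over \<open>K\<close>, and the density of one Poisson law with respect to
  the other, which in general is \<open>exp (m(K) - (\<rho> m)(K))\<close> times the product of \<open>\<rho>\<close> over these points, is just
  that product: this is the functional \<open>mark_product \<rho> K\<close>.
  
  The density is verified on Fourier transforms. For a function \<open>h\<close> that equals 1 outside a bounded set
  of positions, the expectation of the product of \<open>h\<close> over all points is \<open>exp (\<integral>(h - 1) dm)\<close>
  (\<open>clouds_prod_expectation\<close>). For \<open>h = exp(i s f(x))\<close> this is the Fourier transform that defines the law;
  for \<open>h = \<rho> exp(i s f(x))\<close> it is the Fourier transform of the law weighted with \<open>mark_product \<rho> K\<close>
  (\<open>law_weighted_fourier\<close>). Since \<open>\<integral>(\<rho> - 1) dm = 0\<close>, the latter exponent is
  \<open>\<integral>\<rho> (exp(i s f(x)) - 1) dm = \<integral>(exp(i s f(\<phi> x)) - 1) dm\<close>, which belongs to the pushforward of the law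
  (\<open>pushforward_law_density\<close>).
  
  This argument rests on four facts. A law on the discrete Radon measures is determined by its Fourier
  transform (\<open>discrete_law_eqI\<close>); this needs that the Borel sets of the vague topology are generated by
  the evaluations \<open>\<eta> \<mapsto> \<integral>f d\<eta>\<close> (\<open>sets_radon_space\<close>), and a uniqueness theorem for characteristic
  functions of families of random variables (\<open>prob_eq_if_char_eq\<close>), and it also shows that the
  description of \<open>\<mu>\<close> is proper. The process exists (\<open>clouds\<close>, \<open>random_measure\<close>). A product over the atoms
  of \<open>\<eta>\<close> in a bounded set is a measurable functional of \<open>\<eta>\<close> (\<open>mark_product_measurable\<close>). Lebesgue
  measure transforms under \<open>\<phi>\<close> with the density \<open>J\<close> (\<open>distr_density_jacobian\<close>).\<close>

section \<open>Radon measures and continuous functions of compact support\<close>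

lemma csc_bounded_support:
  assumes "compactly_supported_continuous f"
  obtains n where "\<And>x. real n \<le> norm x \<Longrightarrow> f x = 0"
proof -
  from assms have "bounded (closure {x. f x \<noteq> 0})"
    unfolding compactly_supported_continuous_def by (blast intro: compact_imp_bounded)
  then obtain B where B: "\<And>x. x \<in> closure {x. f x \<noteq> 0} \<Longrightarrow> norm x \<le> B"
    unfolding bounded_iff by blast
  obtain n where n: "B < real n" using reals_Archimedean2[of B] by auto
  have "f x = 0" if "real (Suc n) \<le> norm x" for x
  proof (rule ccontr)
    assume "f x \<noteq> 0"
    then have "x \<in> closure {x. f x \<noteq> 0}" by (intro closure_subset[THEN subsetD]) simp
    from B[OF this] have "norm x \<le> B" .
    with n that show False by simp
  qed
  then show thesis by (rule that)
qed

lemma csc_intro: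
  assumes "continuous_on UNIV f" "\<And>x. r \<le> norm x \<Longrightarrow> f x = 0"
  shows "compactly_supported_continuous f"
proof -
  have "{x. f x \<noteq> 0} \<subseteq> cball 0 r" using assms(2) by force
  then have "bounded {x. f x \<noteq> 0}" using bounded_cball bounded_subset by blast
  then show ?thesis using assms(1)
    by (simp add: compactly_supported_continuous_def)
qed

lemma csc_borel_measurable:
  "compactly_supported_continuous f \<Longrightarrow> f \<in> borel_measurable borel"
  unfolding compactly_supported_continuous_def by (blast intro: borel_measurable_continuous_onI)

lemma csc_bounded:
  assumes "compactly_supported_continuous f"
  obtains M where "\<And>x. norm (f x) \<le> M"
proof -
  obtain n where n: "\<And>x. real n \<le> norm x \<Longrightarrow> f x = 0"
    using csc_bounded_support[OF assms] by metis
  have "compact (f ` cball 0 (real n))"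
    using assms by (intro compact_continuous_image)
      (auto simp: compactly_supported_continuous_def intro: continuous_on_subset)
  then obtain M where M: "\<And>y. y \<in> f ` cball 0 (real n) \<Longrightarrow> norm y \<le> M"
    using compact_imp_bounded bounded_iff by metis
  have "norm (f x) \<le> max M 0" for x
  proof (cases "norm x \<le> real n")
    case True
    then have "norm (f x) \<le> M" by (intro M imageI) simp
    then show ?thesis by simp
  qed (use n[of x] in simp)
  then show thesis by (rule that)
qed

lemma radon_sets: "\<eta> \<in> radon_measures \<Longrightarrow> sets \<eta> = sets borel"
  by (simp add: radon_measures_def)

lemma radon_space_UNIV: "\<eta> \<in> radon_measures \<Longrightarrow> space \<eta> = UNIV"
  using sets_eq_imp_space_eq[OF radon_sets] by simp

lemma radon_finite:
  assumes "\<eta> \<in> radon_measures" "bounded B"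
  shows "emeasure \<eta> B < \<infinity>"
proof -
  have "emeasure \<eta> B \<le> emeasure \<eta> (closure B)"
    using assms by (intro emeasure_mono) (auto simp: radon_sets closure_subset)
  also have "\<dots> < \<infinity>" using assms by (auto simp: radon_measures_def)
  finally show ?thesis .
qed

lemma radon_finite_subset:
  assumes "\<eta> \<in> radon_measures" "bounded B"
  shows "emeasure \<eta> B \<noteq> \<infinity>"
  using radon_finite[OF assms] by simp

lemma integrable_csc:
  assumes "\<eta> \<in> radon_measures" "compactly_supported_continuous f"
  shows "integrable \<eta> f"
proof -
  obtain n where n: "\<And>x. real n \<le> norm x \<Longrightarrow> f x = 0"
    using csc_bounded_support[OF assms(2)] by metis
  obtain M where M: "\<And>x. norm (f x) \<le> M" using csc_bounded[OF assms(2)] by metis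
  have "f \<in> borel_measurable \<eta>"
    using csc_borel_measurable[OF assms(2)] measurable_cong_sets[OF radon_sets[OF assms(1)] refl] by blast
  then show ?thesis
    using radon_finite[OF assms(1), of "ball 0 (real n)"] n M
    by (intro integrableI_bounded_set[where A="ball 0 (real n)" and B=M])
      (auto simp: radon_sets[OF assms(1)])
qed

section \<open>Approximation of points by a grid\<close>

text \<open>Rounding down to the dyadic grid of mesh \<open>2\<^sup>-\<^sup>k\<close>. The fibres of this map are half-open cubes; they cut a
  bounded set into finitely many Borel pieces that become uniformly small, so they separate any
  finite set of points once \<open>k\<close> is large.\<close>

definition grid_point :: "nat \<Rightarrow> 'a::euclidean_space \<Rightarrow> 'a" where
  "grid_point k x = (\<Sum>b\<in>Basis. (real_of_int \<lfloor>2^k * (x \<bullet> b)\<rfloor> / 2^k) *\<^sub>R b)"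

lemma borel_measurable_grid_point [measurable]: "grid_point k \<in> borel_measurable borel"
  unfolding grid_point_def by measurable

lemma dist_grid_point: "dist (grid_point k x) (x::'a::euclidean_space) \<le> real DIM('a) / 2^k"
proof -
  have "dist (grid_point k x) x = norm (grid_point k x - (\<Sum>b\<in>Basis. (x \<bullet> b) *\<^sub>R b))"
    by (simp add: dist_norm euclidean_representation)
  also have "\<dots> = norm (\<Sum>b\<in>Basis. (real_of_int \<lfloor>2^k * (x \<bullet> b)\<rfloor> / 2^k - x \<bullet> b) *\<^sub>R b)"
    by (simp add: grid_point_def sum_subtractf scaleR_diff_left)
  also have "\<dots> \<le> (\<Sum>b\<in>(Basis::'a set). 1 / 2^k)"
  proof (rule sum_norm_le)
    fix b :: 'a assume b: "b \<in> Basis"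
    have "\<bar>real_of_int \<lfloor>2^k * (x \<bullet> b)\<rfloor> - 2^k * (x \<bullet> b)\<bar> \<le> 1" by linarith
    then have "\<bar>real_of_int \<lfloor>2^k * (x \<bullet> b)\<rfloor> - 2^k * (x \<bullet> b)\<bar> / 2^k \<le> 1 / 2^k"
      by (rule divide_right_mono) simp
    also have "\<bar>real_of_int \<lfloor>2^k * (x \<bullet> b)\<rfloor> - 2^k * (x \<bullet> b)\<bar> / 2^k
      = \<bar>(real_of_int \<lfloor>2^k * (x \<bullet> b)\<rfloor> - 2^k * (x \<bullet> b)) / 2^k\<bar>" by simp
    also have "(real_of_int \<lfloor>2^k * (x \<bullet> b)\<rfloor> - 2^k * (x \<bullet> b)) / 2^k
       = real_of_int \<lfloor>2^k * (x \<bullet> b)\<rfloor> / 2^k - x \<bullet> b" by (simp add: field_simps)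
    finally show "norm ((real_of_int \<lfloor>2^k * (x \<bullet> b)\<rfloor> / 2^k - x \<bullet> b) *\<^sub>R b) \<le> 1 / 2^k"
      using b by simp
  qed
  finally show ?thesis by simp
qed

lemma finite_grid_image:
  assumes "bounded S"
  shows "finite (grid_point k ` S)"
proof -
  obtain B where B: "\<And>x. x \<in> S \<Longrightarrow> norm x \<le> B" using assms bounded_iff by blast
  let ?I = "{\<lfloor>- (2^k * B)\<rfloor>..\<lfloor>2^k * B\<rfloor>}"
  let ?G = "(\<lambda>c. \<Sum>b\<in>Basis. (real_of_int (c b) / 2^k) *\<^sub>R b) ` (PiE Basis (\<lambda>_. ?I))"
  have "grid_point k ` S \<subseteq> ?G"
  proof clarify
    fix x assume x: "x \<in> S"
    let ?c = "\<lambda>b\<in>Basis. \<lfloor>2^k * (x \<bullet> b)\<rfloor>"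
    have "?c \<in> PiE Basis (\<lambda>_. ?I)"
    proof (rule restrict_PiE_iff[THEN iffD2], intro ballI)
      fix b :: 'a assume "b \<in> Basis"
      then have "\<bar>x \<bullet> b\<bar> \<le> B" using Basis_le_norm[of b x] B[OF x] by linarith
      then have "2^k * (x \<bullet> b) \<le> 2^k * B" "2^k * (- B) \<le> 2^k * (x \<bullet> b)"
        by (intro mult_left_mono; simp; linarith)+
      then show "\<lfloor>2^k * (x \<bullet> b)\<rfloor> \<in> ?I" by (simp add: floor_mono)
    qed
    moreover have "grid_point k x = (\<Sum>b\<in>Basis. (real_of_int (?c b) / 2^k) *\<^sub>R b)"
      by (simp add: grid_point_def)
    ultimately show "grid_point k x \<in> ?G" by blast
  qed
  then show ?thesis by (rule finite_subset) (intro finite_imageI finite_PiE; simp)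
qed

lemma grid_point_fine:
  assumes "0 < (e::real)"
  shows "eventually (\<lambda>k. \<forall>x::'a::euclidean_space. dist (grid_point k x) x < e) sequentially"
proof -
  have "(\<lambda>k. real DIM('a) / 2^k) \<longlonglongrightarrow> 0"
    using LIMSEQ_divide_realpow_zero[of 2 "real DIM('a)"] by simp
  then have "eventually (\<lambda>k. real DIM('a) / 2^k < e) sequentially"
    using assms by (rule order_tendstoD)
  then show ?thesis
    by eventually_elim (use dist_grid_point le_less_trans in blast)
qed

lemma bounded_grid_cell: "bounded (grid_point k -` {z::'a::euclidean_space})"
  unfolding bounded_def by (rule exI[of _ z], rule exI[of _ "real DIM('a) / 2^k"]) (auto intro: dist_grid_point)

lemma grid_cell_borel [measurable]: "grid_point k -` {z} \<in> sets borel"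
  using measurable_sets[OF borel_measurable_grid_point, of "{z}" k] by simp

section \<open>The Borel sets of the vague topology\<close>

text \<open>Countably many bounded Borel sets whose masses carry all the information of the vague topology: the
  cells resolve the integral of a continuous function, the balls bound the mass on which the error
  of this resolution is felt.\<close>

definition grid_sets :: "'a::euclidean_space set set" where
  "grid_sets = range (\<lambda>n::nat. ball 0 (real n)) \<union> (\<Union>k. (\<lambda>z. grid_point k -` {z}) ` range (grid_point k))"

lemma countable_grid_sets: "countable (grid_sets :: 'a::euclidean_space set set)"
proof -
  have "countable (range (grid_point k :: 'a \<Rightarrow> 'a))" for k
  proof -
    have "(\<Union>n::nat. ball (0::'a) (real n)) = UNIV"
    proof (intro equalityI subsetI UNIV_I)
      fix x :: 'a
      obtain n :: nat where "norm x < real n" using reals_Archimedean2 ..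
      then show "x \<in> (\<Union>n::nat. ball (0::'a) (real n))" by auto
    qed
    then have "range (grid_point k :: 'a \<Rightarrow> 'a) = (\<Union>n::nat. grid_point k ` ball 0 (real n))"
      by (metis image_UN)
    also have "countable \<dots>"
      using countable_finite[OF finite_grid_image[OF bounded_ball]] by (intro countable_UN) auto
    finally show ?thesis .
  qed
  then show ?thesis unfolding grid_sets_def by auto
qed

lemma grid_sets_nonempty: "grid_sets \<noteq> {}" by (auto simp: grid_sets_def)

lemma grid_sets_borel: "C \<in> grid_sets \<Longrightarrow> C \<in> sets borel"
  by (auto simp: grid_sets_def grid_cell_borel)

definition grid_masses :: "'a::euclidean_space measure \<Rightarrow> nat \<Rightarrow> real" where
  "grid_masses \<eta> j = measure \<eta> (from_nat_into grid_sets j)"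

text \<open>The error is bounded by a multiple of the indicator of one fixed ball, so its integral is small
  uniformly over all measures with bounded mass on that ball.\<close>
lemma csc_grid_approx:
  fixes f :: "'a::euclidean_space \<Rightarrow> real"
  assumes f: "compactly_supported_continuous f"
  obtains m :: nat where
    "\<And>\<delta>. 0 < \<delta> \<Longrightarrow> eventually (\<lambda>k. \<forall>x. \<bar>f (grid_point k x) - f x\<bar> \<le> \<delta> * indicator (ball 0 (real m)) x) sequentially"
    "eventually (\<lambda>k. \<forall>x. x \<notin> ball 0 (real m) \<longrightarrow> f (grid_point k x) = 0) sequentially"
proof -
  obtain n where n: "\<And>x. real n \<le> norm x \<Longrightarrow> f x = 0"
    using csc_bounded_support[OF f] by metis
  let ?m = "n + 1"
  have zero: "f (grid_point k x) = 0" if "\<forall>x::'a. dist (grid_point k x) x < 1" "x \<notin> ball 0 (real ?m)" for k x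
  proof -
    have "norm x \<le> norm (grid_point k x) + dist (grid_point k x) x"
      using norm_triangle_sub[of x "grid_point k x"] by (simp add: dist_norm norm_minus_commute)
    with that(1)[rule_format, of x] that(2) show ?thesis by (intro n) auto
  qed
  show thesis
  proof (rule that[of ?m])
    show "eventually (\<lambda>k. \<forall>x. x \<notin> ball 0 (real ?m) \<longrightarrow> f (grid_point k x) = 0) sequentially"
      using grid_point_fine[of 1] by (rule eventually_mono) (use zero in auto)
    fix \<delta> :: real assume \<delta>: "0 < \<delta>"
    have "uniformly_continuous_on (cball 0 (real ?m + 1)) f"
      using f by (intro compact_uniformly_continuous)
        (auto simp: compactly_supported_continuous_def intro: continuous_on_subset)
    then obtain d where d: "0 < d"
      "\<And>x y. x \<in> cball 0 (real ?m + 1) \<Longrightarrow> y \<in> cball 0 (real ?m + 1) \<Longrightarrow> dist y x < d \<Longrightarrow> dist (f y) (f x) < \<delta>"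
      using \<delta> unfolding uniformly_continuous_on_def by metis
    have "eventually (\<lambda>k. \<forall>x::'a. dist (grid_point k x) x < min d 1) sequentially"
      using d(1) by (intro grid_point_fine) auto
    then show "eventually (\<lambda>k. \<forall>x. \<bar>f (grid_point k x) - f x\<bar> \<le> \<delta> * indicator (ball 0 (real ?m)) x) sequentially"
    proof (rule eventually_mono, intro allI)
      fix k and x :: 'a assume *: "\<forall>x::'a. dist (grid_point k x) x < min d 1"
      show "\<bar>f (grid_point k x) - f x\<bar> \<le> \<delta> * indicator (ball 0 (real ?m)) x"
      proof (cases "x \<in> ball 0 (real ?m)")
        case True
        have "norm (grid_point k x) \<le> norm x + dist (grid_point k x) x"
          using norm_triangle_sub[of "grid_point k x" x] by (simp add: dist_norm)
        then have "grid_point k x \<in> cball 0 (real ?m + 1)" using True *[rule_format, of x] by auto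
        then have "dist (f (grid_point k x)) (f x) < \<delta>"
          using True *[rule_format, of x] by (intro d(2)) auto
        then show ?thesis using True by (auto simp: dist_real_def)
      next
        case False
        then show ?thesis using zero[of k x] n[of x] * by auto
      qed
    qed
  qed
qed

text \<open>A vague neighbourhood of \<open>\<eta>0\<close> contains one that is described by finitely many grid masses. The integral
  of \<open>f\<close> differs from a finite linear combination \<open>S\<close> of cell masses by at most \<open>\<delta>\<close> times the mass of a
  ball, and requiring that mass to be less than \<open>M\<close> keeps this error below \<open>\<epsilon> / 4\<close>.\<close>
lemma vague_subbasis_grid:
  fixes f :: "'a::euclidean_space \<Rightarrow> real"
  assumes f: "compactly_supported_continuous f" and U: "open U"
    and \<eta>0: "\<eta>0 \<in> radon_measures" "(\<integral>x. f x \<partial>\<eta>0) \<in> U"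
  shows "\<exists>V. open V \<and> grid_masses \<eta>0 \<in> V \<and>
    (\<forall>\<eta>\<in>radon_measures. grid_masses \<eta> \<in> V \<longrightarrow> (\<integral>x. f x \<partial>\<eta>) \<in> U)"
proof -
  obtain \<epsilon> where \<epsilon>: "0 < \<epsilon>" "ball (\<integral>x. f x \<partial>\<eta>0) \<epsilon> \<subseteq> U" using U \<eta>0(2) open_contains_ball by blast
  obtain m where m:
    "\<And>\<delta>. 0 < \<delta> \<Longrightarrow> eventually (\<lambda>k. \<forall>x. \<bar>f (grid_point k x) - f x\<bar> \<le> \<delta> * indicator (ball 0 (real m)) x) sequentially"
    "eventually (\<lambda>k. \<forall>x. x \<notin> ball 0 (real m) \<longrightarrow> f (grid_point k x) = 0) sequentially"
    using csc_grid_approx[OF f] by blast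
  define B where "B = ball (0::'a) (real m)"
  define M where "M = measure \<eta>0 B + 1"
  have M: "M > 0" unfolding M_def by (simp add: add_nonneg_pos)
  define \<delta> where "\<delta> = \<epsilon> / (4 * M)"
  have \<delta>: "0 < \<delta>" "\<delta> * M = \<epsilon> / 4" using \<epsilon> M by (auto simp: \<delta>_def)
  have "eventually (\<lambda>k. (\<forall>x. \<bar>f (grid_point k x) - f x\<bar> \<le> \<delta> * indicator B x) \<and>
      (\<forall>x. x \<notin> B \<longrightarrow> f (grid_point k x) = 0)) sequentially"
    using m(1)[OF \<delta>(1)] m(2) unfolding B_def by (rule eventually_conj)
  then obtain k where k: "\<And>x. \<bar>f (grid_point k x) - f x\<bar> \<le> \<delta> * indicator B x"
      "\<And>x. x \<notin> B \<Longrightarrow> f (grid_point k x) = 0"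
    using eventually_happens' sequentially_bot by blast
  define Z where "Z = grid_point k ` B"
  have finZ: "finite Z" unfolding Z_def B_def by (intro finite_grid_image) auto
  define j where "j = (\<lambda>z::'a. to_nat_on grid_sets (grid_point k -` {z}))"
  have j: "from_nat_into grid_sets (j z) = grid_point k -` {z}" if "z \<in> Z" for z
    unfolding j_def
  proof (rule from_nat_into_to_nat_on[OF countable_grid_sets])
    obtain x where "z = grid_point k x" using \<open>z \<in> Z\<close> unfolding Z_def by blast
    then show "grid_point k -` {z} \<in> grid_sets" unfolding grid_sets_def by blast
  qed
  define jb where "jb = to_nat_on grid_sets B"
  have jb: "from_nat_into grid_sets jb = B"
    unfolding jb_def by (intro from_nat_into_to_nat_on countable_grid_sets) (auto simp: grid_sets_def B_def)
  define S where "S v = (\<Sum>z\<in>Z. f z * v (j z))" for v :: "nat \<Rightarrow> real"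
  have approx: "\<bar>(\<integral>x. f x \<partial>\<eta>) - S (grid_masses \<eta>)\<bar> \<le> \<delta> * grid_masses \<eta> jb"
    if \<eta>: "\<eta> \<in> radon_measures" for \<eta>
  proof -
    have rep: "f (grid_point k x) = (\<Sum>z\<in>Z. f z * indicator (grid_point k -` {z}) x)" for x
    proof -
      have "(\<Sum>z\<in>Z. f z * indicator (grid_point k -` {z}) x) = (\<Sum>z\<in>Z. if grid_point k x = z then f z else 0)"
        by (intro sum.cong) (auto simp: indicator_def)
      also have "\<dots> = (if grid_point k x \<in> Z then f (grid_point k x) else 0)"
        using finZ by (simp add: sum.delta')
      also have "\<dots> = f (grid_point k x)" using k(2)[of x] by (auto simp: Z_def)
      finally show ?thesis by simp
    qed
    have fin: "integrable \<eta> (indicator (grid_point k -` {z}) :: 'a \<Rightarrow> real)" for z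
      using radon_finite[OF \<eta> bounded_grid_cell]
      by (intro integrable_real_indicator) (auto simp: radon_sets[OF \<eta>])
    have finB: "integrable \<eta> (indicator B :: 'a \<Rightarrow> real)"
      using radon_finite[OF \<eta>, of B] by (intro integrable_real_indicator) (auto simp: radon_sets[OF \<eta>] B_def)
    have int: "integrable \<eta> (\<lambda>x. f (grid_point k x))"
      unfolding rep using fin by (intro Bochner_Integration.integrable_sum integrable_mult_right) auto
    have "(\<integral>x. f (grid_point k x) \<partial>\<eta>) = (\<Sum>z\<in>Z. f z * measure \<eta> (grid_point k -` {z}))"
      unfolding rep using fin by (subst Bochner_Integration.integral_sum)
        (auto simp: radon_space_UNIV[OF \<eta>] intro!: integrable_mult_right)
    also have "\<dots> = S (grid_masses \<eta>)"
      unfolding S_def grid_masses_def by (intro sum.cong refl) (simp add: j)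
    finally have "\<bar>(\<integral>x. f x \<partial>\<eta>) - S (grid_masses \<eta>)\<bar> = \<bar>\<integral>x. f x - f (grid_point k x) \<partial>\<eta>\<bar>"
      using int integrable_csc[OF \<eta> f] by simp
    also have "\<dots> \<le> (\<integral>x. \<bar>f x - f (grid_point k x)\<bar> \<partial>\<eta>)" by (rule integral_abs_bound)
    also have "\<dots> \<le> (\<integral>x. \<delta> * indicator B x \<partial>\<eta>)"
      using int integrable_csc[OF \<eta> f] finB k(1)
      by (intro integral_mono integrable_abs Bochner_Integration.integrable_diff integrable_mult_right)
        (auto simp: abs_minus_commute)
    also have "\<dots> = \<delta> * grid_masses \<eta> jb"
      by (simp add: grid_masses_def jb radon_space_UNIV[OF \<eta>])
    finally show ?thesis .
  qed
  define V where "V = {v. v jb < M} \<inter> {v. \<bar>S v - S (grid_masses \<eta>0)\<bar> < \<epsilon> / 4}"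
  have [continuous_intros]: "continuous_on UNIV (\<lambda>v::nat \<Rightarrow> real. v i)" for i
    by (rule continuous_on_product_coordinates)
  have "open V" unfolding V_def S_def
    by (intro open_Int open_Collect_less continuous_intros)
  moreover have "grid_masses \<eta>0 \<in> V"
    using \<epsilon>(1) unfolding V_def M_def by (simp add: grid_masses_def[of _ jb] jb)
  moreover have "(\<integral>x. f x \<partial>\<eta>) \<in> U" if "\<eta> \<in> radon_measures" "grid_masses \<eta> \<in> V" for \<eta>
  proof -
    have "\<delta> * grid_masses \<eta> jb \<le> \<epsilon> / 4" "\<delta> * grid_masses \<eta>0 jb \<le> \<epsilon> / 4"
      using that(2) \<open>grid_masses \<eta>0 \<in> V\<close> \<delta>(1) unfolding \<delta>(2)[symmetric] V_def
      by (auto intro!: mult_left_mono)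
    moreover have "\<bar>S (grid_masses \<eta>) - S (grid_masses \<eta>0)\<bar> < \<epsilon> / 4" using that(2) unfolding V_def by blast
    ultimately have "\<bar>(\<integral>x. f x \<partial>\<eta>) - (\<integral>x. f x \<partial>\<eta>0)\<bar> < \<epsilon>"
      using approx[OF that(1)] approx[OF \<eta>0(1)] \<epsilon>(1) by linarith
    then show ?thesis using \<epsilon>(2) by (auto simp: dist_real_def abs_minus_commute)
  qed
  ultimately show ?thesis by blast
qed

text \<open>The right-hand sets form a topology, so it is enough to treat the subbasis. The gain is that
  \<open>nat \<Rightarrow> real\<close> is second countable: the arbitrary unions that build vaguely open sets become open, hence
  Borel, conditions on one random sequence. The sets \<open>{\<eta>. grid_masses \<eta> \<in> V}\<close> need not be vaguely open.\<close>
lemma vague_open_grid: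
  fixes W :: "'a::euclidean_space measure set"
  assumes "openin vague_topology W"
  shows "\<exists>V. open V \<and> W = {\<eta>\<in>radon_measures. grid_masses \<eta> \<in> V}"
proof -
  from assms have "generate_topology_on {{\<eta> \<in> radon_measures. (\<integral>x. f x \<partial>\<eta>) \<in> U} | (f::'a \<Rightarrow> real) U.
      compactly_supported_continuous f \<and> open U} W"
    unfolding vague_topology_def openin_topology_generated_by_iff .
  then show ?thesis
  proof induction
    case Empty
    then show ?case by (intro exI[of _ "{}"]) auto
  next
    case (Int a b)
    then obtain Va Vb where "open Va" "a = {\<eta>\<in>radon_measures. grid_masses \<eta> \<in> Va}"
      "open Vb" "b = {\<eta>\<in>radon_measures. grid_masses \<eta> \<in> Vb}" by blast
    then show ?case by (intro exI[of _ "Va \<inter> Vb"]) auto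
  next
    case (UN K)
    then have "\<forall>k\<in>K. \<exists>V. open V \<and> k = {\<eta>\<in>radon_measures. grid_masses \<eta> \<in> V}" by simp
    from bchoice[OF this] obtain V
      where V: "\<forall>k\<in>K. open (V k) \<and> k = {\<eta>\<in>radon_measures. grid_masses \<eta> \<in> V k}" ..
    have "\<Union>K = (\<Union>k\<in>K. {\<eta>\<in>radon_measures. grid_masses \<eta> \<in> V k})" using V by auto
    also have "\<dots> = {\<eta>\<in>radon_measures. grid_masses \<eta> \<in> (\<Union>k\<in>K. V k)}" by blast
    finally have "\<Union>K = {\<eta>\<in>radon_measures. grid_masses \<eta> \<in> (\<Union>k\<in>K. V k)}" .
    moreover have "open (\<Union>k\<in>K. V k)" using V by (intro open_UN) blast
    ultimately show ?case by (intro exI conjI)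
  next
    case (Basis s)
    then obtain f U where s: "s = {\<eta> \<in> radon_measures. (\<integral>x. f x \<partial>\<eta>) \<in> U}"
      and f: "compactly_supported_continuous f" "open U" by blast
    let ?VV = "{V. open V \<and> (\<forall>\<eta>\<in>radon_measures. grid_masses \<eta> \<in> V \<longrightarrow> (\<integral>x. f x \<partial>\<eta>) \<in> U)}"
    have "s = {\<eta>\<in>radon_measures. grid_masses \<eta> \<in> \<Union>?VV}"
    proof (rule set_eqI, rule iffI)
      fix \<eta> assume "\<eta> \<in> s"
      then have "\<eta> \<in> radon_measures" "(\<integral>x. f x \<partial>\<eta>) \<in> U" by (auto simp: s)
      from vague_subbasis_grid[OF f this] this show "\<eta> \<in> {\<eta>\<in>radon_measures. grid_masses \<eta> \<in> \<Union>?VV}" by blast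
    qed (auto simp: s)
    moreover have "open (\<Union>?VV)" by (intro open_Union) auto
    ultimately show ?case by blast
  qed
qed

definition evaluation_space :: "'a::euclidean_space measure measure" where
  "evaluation_space = sigma radon_measures {{\<eta> \<in> radon_measures. (\<integral>x. f x \<partial>\<eta>) \<in> U} | f U.
     compactly_supported_continuous f \<and> open U}"

lemma space_evaluation_space: "space evaluation_space = radon_measures"
  unfolding evaluation_space_def by (rule space_measure_of) auto

lemma sets_evaluation_space: "sets evaluation_space = sigma_sets radon_measures {{\<eta> \<in> radon_measures. (\<integral>x. f x \<partial>\<eta>) \<in> U} | f U.
     compactly_supported_continuous f \<and> open U}"
  unfolding evaluation_space_def by (rule sets_measure_of) auto

lemma evaluation_measurable:
  assumes "compactly_supported_continuous f"
  shows "(\<lambda>\<eta>. \<integral>x. f x \<partial>\<eta>) \<in> borel_measurable evaluation_space"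
proof (rule borel_measurableI)
  fix U :: "real set" assume "open U"
  with assms show "(\<lambda>\<eta>. \<integral>x. f x \<partial>\<eta>) -` U \<inter> space evaluation_space \<in> sets evaluation_space"
    unfolding sets_evaluation_space space_evaluation_space
    by (intro sigma_sets.Basic) auto
qed

text \<open>The indicator of a compact set is the decreasing limit of tent functions, which are continuous and
  of compact support.\<close>
lemma emeasure_compact_evaluation:
  fixes K :: "'a::euclidean_space set"
  assumes K: "compact K"
  shows "(\<lambda>\<eta>. emeasure \<eta> K) \<in> borel_measurable evaluation_space"
proof (cases "K = {}")
  case False
  define f where "f k x = max 0 (1 - real (Suc k) * infdist x K)" for k x
  obtain r where r: "\<And>x. x \<in> K \<Longrightarrow> norm x \<le> r" using K compact_imp_bounded bounded_iff by metis
  have f: "compactly_supported_continuous (f k)" for k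
  proof (rule csc_intro[of _ "r + 1"])
    show "continuous_on UNIV (f k)" unfolding f_def by (intro continuous_intros)
    fix x :: 'a assume x: "r + 1 \<le> norm x"
    have "1 \<le> infdist x K"
    proof (subst infdist_notempty[OF False], rule cINF_greatest[OF False])
      fix a assume "a \<in> K"
      have "norm x \<le> norm a + dist x a" using norm_triangle_sub[of x a] by (simp add: dist_norm)
      then show "1 \<le> dist x a" using x r[OF \<open>a \<in> K\<close>] by linarith
    qed
    then have "1 * 1 \<le> real (Suc k) * infdist x K" by (intro mult_mono) auto
    then show "f k x = 0" by (simp add: f_def)
  qed
  have lim: "(\<lambda>k. f k x) \<longlonglongrightarrow> indicator K x" for x :: 'a
  proof (cases "x \<in> K")
    case True then show ?thesis by (simp add: f_def)
  next
    case F: False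
    have "infdist x K \<noteq> 0" using F False in_closed_iff_infdist_zero[OF compact_imp_closed[OF K]] by blast
    then have "0 < infdist x K" using infdist_nonneg[of x K] by linarith
    obtain N :: nat where "1 / infdist x K \<le> real N" using real_arch_simple by blast
    then have "eventually (\<lambda>k. 1 / infdist x K \<le> real (Suc k)) sequentially"
      by (intro eventually_sequentiallyI[of N]) simp
    then have "eventually (\<lambda>k. f k x = 0) sequentially"
      by eventually_elim (use \<open>0 < infdist x K\<close> in \<open>simp add: f_def field_simps\<close>)
    then show ?thesis using F by (intro tendsto_eventually) simp
  qed
  have lim_int: "(\<lambda>k. \<integral>x. f k x \<partial>\<eta>) \<longlonglongrightarrow> measure \<eta> K" if \<eta>: "\<eta> \<in> radon_measures" for \<eta>
  proof -
    have "(\<lambda>k. \<integral>x. f k x \<partial>\<eta>) \<longlonglongrightarrow> (\<integral>x. indicator K x \<partial>\<eta>)"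
    proof (rule integral_dominated_convergence[where w="f 0"])
      show "integrable \<eta> (f 0)" by (rule integrable_csc[OF \<eta> f])
      show "f k \<in> borel_measurable \<eta>" for k using integrable_csc[OF \<eta> f] by blast
      show "(indicat_real K) \<in> borel_measurable \<eta>" 
        using K radon_sets[OF \<eta>] by (intro borel_measurable_indicator) (simp add: borel_compact)
      show "AE x in \<eta>. (\<lambda>k. f k x) \<longlonglongrightarrow> indicator K x" using lim by simp
      show "AE x in \<eta>. norm (f k x) \<le> f 0 x" for k
      proof (rule AE_I2)
        fix x :: 'a have "1 * infdist x K \<le> real (Suc k) * infdist x K" by (rule mult_right_mono) (auto intro: infdist_nonneg)
        then show "norm (f k x) \<le> f 0 x" unfolding f_def by auto
      qed
    qed
    then show ?thesis by (simp add: radon_space_UNIV[OF \<eta>])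
  qed
  have "(\<lambda>\<eta>. measure \<eta> K) \<in> borel_measurable evaluation_space"
    by (rule borel_measurable_LIMSEQ_real[OF lim_int evaluation_measurable[OF f]])
      (simp add: space_evaluation_space)
  then have "(\<lambda>\<eta>. ennreal (measure \<eta> K)) \<in> borel_measurable evaluation_space" by measurable
  then show ?thesis
    by (rule measurable_cong[THEN iffD1, rotated])
      (use radon_finite[OF _ compact_imp_bounded[OF K]] in \<open>auto simp: space_evaluation_space emeasure_eq_ennreal_measure less_top\<close>)
qed simp

text \<open>A Dynkin argument starting from the closed sets. It is carried out inside a fixed ball because
  complements require finite mass.\<close>
lemma emeasure_evaluation:
  fixes B :: "'a::euclidean_space set"
  assumes B: "B \<in> sets borel"
  shows "(\<lambda>\<eta>. emeasure \<eta> B) \<in> borel_measurable evaluation_space"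
proof -
  have bnd: "(\<lambda>\<eta>. emeasure \<eta> (B \<inter> cball 0 (real n))) \<in> borel_measurable evaluation_space" for n
  proof -
    have B': "B \<in> sigma_sets UNIV (Collect closed)" using B borel_eq_closed[where 'a='a] by (metis sets_measure_of Pow_UNIV top_greatest)
    have "Int_stable (Collect closed :: 'a set set)" "Collect closed \<subseteq> Pow (UNIV :: 'a set)"
      by (auto simp: Int_stable_def)
    from this B' show ?thesis
    proof (induction rule: sigma_sets_induct_disjoint)
      case (basic A)
      then show ?case by (intro emeasure_compact_evaluation) (auto simp: Int_commute intro: compact_Int_closed)
    next
      case empty then show ?case by simp
    next
      case (compl A)
      have A: "A \<in> sets borel" using compl(1) borel_eq_closed[where 'a='a] by (metis sets_measure_of Pow_UNIV top_greatest)
      have "(\<lambda>\<eta>. emeasure \<eta> (cball 0 (real n)) - emeasure \<eta> (A \<inter> cball 0 (real n))) \<in> borel_measurable evaluation_space"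
        using compl emeasure_compact_evaluation[of "cball 0 (real n)"] by measurable
      then show ?case
      proof (rule measurable_cong[THEN iffD1, rotated])
        fix \<eta> :: "'a measure" assume "\<eta> \<in> space evaluation_space"
        then have \<eta>: "\<eta> \<in> radon_measures" by (simp add: space_evaluation_space)
        have "(UNIV - A) \<inter> cball 0 (real n) = cball 0 (real n) - A \<inter> cball 0 (real n)" by auto
        then show "emeasure \<eta> (cball 0 (real n)) - emeasure \<eta> (A \<inter> cball 0 (real n)) = emeasure \<eta> ((UNIV - A) \<inter> cball 0 (real n))"
          using A radon_finite[OF \<eta>, of "A \<inter> cball 0 (real n)"]
          by (auto simp: radon_sets[OF \<eta>] bounded_Int intro!: emeasure_Diff[symmetric])
      qed
    next
      case (union A)
      have A: "A i \<in> sets borel" for i using union(2) borel_eq_closed[where 'a='a] by (metis sets_measure_of Pow_UNIV top_greatest rangeI subsetD)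
      have "(\<lambda>\<eta>. \<Sum>i. emeasure \<eta> (A i \<inter> cball 0 (real n))) \<in> borel_measurable evaluation_space"
        using union by measurable
      then show ?case
      proof (rule measurable_cong[THEN iffD1, rotated])
        fix \<eta> :: "'a measure" assume "\<eta> \<in> space evaluation_space"
        then have \<eta>: "\<eta> \<in> radon_measures" by (simp add: space_evaluation_space)
        have "(\<Sum>i. emeasure \<eta> (A i \<inter> cball 0 (real n))) = emeasure \<eta> (\<Union>i. A i \<inter> cball 0 (real n))"
          using A union(1) by (intro suminf_emeasure) (auto simp: radon_sets[OF \<eta>] disjoint_family_on_def)
        also have "(\<Union>i. A i \<inter> cball 0 (real n)) = \<Union> (range A) \<inter> cball 0 (real n)" by auto
        finally show "(\<Sum>i. emeasure \<eta> (A i \<inter> cball 0 (real n))) = emeasure \<eta> (\<Union> (range A) \<inter> cball 0 (real n))" .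
      qed
    qed
  qed
  have "(\<lambda>\<eta>. SUP n. emeasure \<eta> (B \<inter> cball 0 (real n))) \<in> borel_measurable evaluation_space"
    using bnd by measurable
  then show ?thesis
  proof (rule measurable_cong[THEN iffD1, rotated])
    fix \<eta> :: "'a measure" assume "\<eta> \<in> space evaluation_space"
    then have \<eta>: "\<eta> \<in> radon_measures" by (simp add: space_evaluation_space)
    have "(SUP n. emeasure \<eta> (B \<inter> cball 0 (real n))) = emeasure \<eta> (\<Union>n. B \<inter> cball 0 (real n))"
      using B by (intro SUP_emeasure_incseq) (auto simp: radon_sets[OF \<eta>] incseq_def)
    also have "(\<Union>n. B \<inter> cball 0 (real n)) = B" by (auto simp: real_arch_simple)
    finally show "(SUP n. emeasure \<eta> (B \<inter> cball 0 (real n))) = emeasure \<eta> B" .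
  qed
qed

text \<open>One inclusion is clear as evaluations are continuous. For the other, a vaguely open set is a Borel
  condition on the grid masses, and masses of Borel sets are measurable with respect to the evaluations.\<close>
lemma sets_radon_space: "sets (radon_space :: 'a::euclidean_space measure measure) = sets evaluation_space"
proof -
  have top: "U \<subseteq> radon_measures" if "openin vague_topology U" for U :: "'a measure set"
    using vague_open_grid[OF that] by auto
  have rs: "sets (radon_space :: 'a measure measure) = sigma_sets radon_measures {U. openin vague_topology U}"
    unfolding radon_space_def using top by (intro sets_measure_of) auto
  have "grid_masses \<in> borel_measurable (evaluation_space :: 'a measure measure)"
  proof (subst measurable_cong_sets[OF refl sets_PiM_equal_borel[symmetric]], rule measurable_PiM_single')
    show "(\<lambda>\<eta>. grid_masses \<eta> i) \<in> borel_measurable evaluation_space" for i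
      unfolding grid_masses_def measure_def
      using emeasure_evaluation[OF grid_sets_borel[OF from_nat_into[OF grid_sets_nonempty]], of i] by measurable
  qed auto
  then have "U \<in> sets evaluation_space" if U: "openin vague_topology U" for U :: "'a measure set"
  proof -
    obtain V where V: "open V" "U = {\<eta>\<in>radon_measures. grid_masses \<eta> \<in> V}" using vague_open_grid[OF U] by blast
    have "grid_masses -` V \<inter> space evaluation_space \<in> sets (evaluation_space :: 'a measure measure)"
      by (rule measurable_sets[OF \<open>grid_masses \<in> _\<close>]) (use V(1) in auto)
    then show ?thesis unfolding V(2) space_evaluation_space by (simp add: vimage_def Int_def conj_commute)
  qed
  then have "sets radon_space \<subseteq> sets (evaluation_space :: 'a measure measure)"
    unfolding rs using sets.sigma_sets_subset[of "{U. openin vague_topology U}" evaluation_space]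
    by (auto simp: space_evaluation_space)
  moreover have "sets (evaluation_space :: 'a measure measure) \<subseteq> sets radon_space"
    unfolding rs sets_evaluation_space
    by (rule sigma_sets_mono') (auto simp: vague_topology_def intro!: topology_generated_by_Basis)
  ultimately show ?thesis by blast
qed

lemma space_radon_space: "space radon_space = radon_measures"
  using sets_eq_imp_space_eq[OF sets_radon_space] by (simp add: space_evaluation_space)

lemma space_discrete_radon_space: "space discrete_radon_space = discrete_radon_measures"
  by (auto simp: discrete_radon_space_def space_restrict_space space_radon_space discrete_radon_measures_def)

lemma discrete_imp_radon: "\<eta> \<in> discrete_radon_measures \<Longrightarrow> \<eta> \<in> radon_measures"
  by (simp add: discrete_radon_measures_def)

lemma integral_measurable_discrete [measurable]:
  assumes "compactly_supported_continuous f"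
  shows "(\<lambda>\<eta>. \<integral>x. f x \<partial>\<eta>) \<in> borel_measurable discrete_radon_space"
  unfolding discrete_radon_space_def
  by (intro measurable_restrict_space1) (use evaluation_measurable[OF assms] measurable_cong_sets[OF sets_radon_space refl] in blast)

lemma emeasure_measurable_discrete [measurable]:
  assumes "B \<in> sets borel"
  shows "(\<lambda>\<eta>. emeasure \<eta> B) \<in> borel_measurable discrete_radon_space"
  unfolding discrete_radon_space_def
  by (intro measurable_restrict_space1) (use emeasure_evaluation[OF assms] measurable_cong_sets[OF sets_radon_space refl] in blast)

lemma measure_measurable_discrete [measurable]:
  assumes "B \<in> sets borel"
  shows "(\<lambda>\<eta>. measure \<eta> B) \<in> borel_measurable discrete_radon_space"
  unfolding measure_def using assms by measurable

text \<open>A map into the discrete Radon measures may thus be tested on integrals of continuous functions.\<close>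
lemma measurable_discrete_radon_spaceI:
  fixes F :: "'b \<Rightarrow> 'a::euclidean_space measure"
  assumes "\<And>\<omega>. \<omega> \<in> space N \<Longrightarrow> F \<omega> \<in> discrete_radon_measures"
    and "\<And>f. compactly_supported_continuous f \<Longrightarrow> (\<lambda>\<omega>. \<integral>x. f x \<partial>F \<omega>) \<in> borel_measurable N"
  shows "F \<in> measurable N discrete_radon_space"
  unfolding discrete_radon_space_def
proof (rule measurable_restrict_space2)
  show "F \<in> space N \<rightarrow> discrete_radon_measures" using assms(1) by auto
  have "F \<in> measurable N evaluation_space"
    unfolding evaluation_space_def
  proof (rule measurable_measure_of)
    show "F \<in> space N \<rightarrow> radon_measures" using assms(1) discrete_imp_radon by auto
    fix y :: "'a measure set" assume "y \<in> {{\<eta> \<in> radon_measures. (\<integral>x. f x \<partial>\<eta>) \<in> U} | f U. compactly_supported_continuous f \<and> open U}"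
    then obtain f U where y: "y = {\<eta> \<in> radon_measures. (\<integral>x. f x \<partial>\<eta>) \<in> U}" "compactly_supported_continuous f" "open U"
      by blast
    have "(\<lambda>\<omega>. \<integral>x. f x \<partial>F \<omega>) -` U \<inter> space N \<in> sets N"
      by (rule measurable_sets[OF assms(2)[OF y(2)]]) (use y(3) in auto)
    also have "(\<lambda>\<omega>. \<integral>x. f x \<partial>F \<omega>) -` U \<inter> space N = F -` y \<inter> space N"
      using assms(1) discrete_imp_radon by (auto simp: y(1))
    finally show "F -` y \<inter> space N \<in> sets N" .
  qed auto
  then show "F \<in> measurable N radon_space" using measurable_cong_sets[OF refl sets_radon_space] by blast
qed

section \<open>Laws determined by characteristic functions\<close>

text \<open>Dividing by the total \<open>\<phi>\<close>-mass, which is the same on both sides by \<open>t = 0\<close>, reduces this to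
  the uniqueness theorem for characteristic functions of probability measures on the line.\<close>

lemma indicator_law_from_trig_moments:
  fixes M N :: "'w measure" and X \<phi> :: "'w \<Rightarrow> real"
  assumes M: "finite_measure M" and N: "finite_measure N" and sets: "sets M = sets N"
    and X [measurable]: "X \<in> borel_measurable M"
    and \<phi> [measurable]: "\<phi> \<in> borel_measurable M" and \<phi>_bound: "\<And>w. 0 \<le> \<phi> w" "\<And>w. \<phi> w \<le> C"
    and cos_eq: "\<And>t. (\<integral>w. \<phi> w * cos (t * X w) \<partial>M) = (\<integral>w. \<phi> w * cos (t * X w) \<partial>N)"
    and sin_eq: "\<And>t. (\<integral>w. \<phi> w * sin (t * X w) \<partial>M) = (\<integral>w. \<phi> w * sin (t * X w) \<partial>N)"
    and A [measurable]: "A \<in> sets borel"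
  shows "(\<integral>w. \<phi> w * indicator A (X w) \<partial>M) = (\<integral>w. \<phi> w * indicator A (X w) \<partial>N)"
proof -
  interpret M: finite_measure M by (rule M)
  interpret N: finite_measure N by (rule N)
  have [measurable]: "X \<in> borel_measurable N" "\<phi> \<in> borel_measurable N"
    using X \<phi> measurable_cong_sets[OF sets refl] by blast+
  define c where "c = (\<integral>w. \<phi> w \<partial>M)"
  have cN: "c = (\<integral>w. \<phi> w \<partial>N)" using cos_eq[of 0] by (simp add: c_def)
  have bnd: "\<bar>\<phi> w\<bar> \<le> C" for w using \<phi>_bound[of w] by simp
  have intM: "integrable M \<phi>" and intN: "integrable N \<phi>"
    using bnd by (auto intro!: M.integrable_const_bound[where B=C] N.integrable_const_bound[where B=C])
  have c0: "0 \<le> c" unfolding c_def using \<phi>_bound by (intro Bochner_Integration.integral_nonneg) auto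
  show ?thesis
  proof (cases "c = 0")
    case True
    have "AE w in M. \<phi> w = 0"
      using integral_nonneg_eq_0_iff_AE[OF intM] \<phi>_bound True c_def by auto
    then have 1: "(\<integral>w. \<phi> w * indicator A (X w) \<partial>M) = 0" by (intro integral_eq_zero_AE) auto
    have "AE w in N. \<phi> w = 0"
      using integral_nonneg_eq_0_iff_AE[OF intN] \<phi>_bound True cN by auto
    then have "(\<integral>w. \<phi> w * indicator A (X w) \<partial>N) = 0" by (intro integral_eq_zero_AE) auto
    with 1 show ?thesis by simp
  next
    case False
    with c0 have c: "0 < c" by simp
    define law where "law R = distr (density R (\<lambda>w. ennreal (\<phi> w / c))) borel X" for R
    have prob: "real_distribution (law R)"
      if R: "finite_measure R" "sets R = sets M" "(\<integral>w. \<phi> w \<partial>R) = c" "integrable R \<phi>" for R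
    proof -
      have [measurable]: "X \<in> borel_measurable R" "\<phi> \<in> borel_measurable R"
        using X \<phi> measurable_cong_sets[OF R(2) refl] by blast+
      have "prob_space (density R (\<lambda>w. ennreal (\<phi> w / c)))"
      proof (rule prob_spaceI)
        have "emeasure (density R (\<lambda>w. ennreal (\<phi> w / c))) (space R) = (\<integral>\<^sup>+w. ennreal (\<phi> w / c) \<partial>R)"
          by (subst emeasure_density) (auto intro!: nn_integral_cong)
        also have "\<dots> = ennreal (\<integral>w. \<phi> w / c \<partial>R)"
          using R(4) c \<phi>_bound by (intro nn_integral_eq_integral) auto
        also have "\<dots> = 1" using R(3) c by simp
        finally show "emeasure (density R (\<lambda>w. ennreal (\<phi> w / c))) (space (density R (\<lambda>w. ennreal (\<phi> w / c)))) = 1"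
          by simp
      qed
      then show ?thesis unfolding law_def by (intro prob_space.real_distribution_distr) measurable
    qed
    have integral_law: "(\<integral>x. g x \<partial>law R) = (\<integral>w. (\<phi> w / c) *\<^sub>R g (X w) \<partial>R)"
      if "sets R = sets M" "g \<in> borel_measurable borel" for R and g :: "real \<Rightarrow> 'e::{banach, second_countable_topology}"
    proof -
      have [measurable]: "X \<in> borel_measurable R" "\<phi> \<in> borel_measurable R"
        using X \<phi> measurable_cong_sets[OF that(1) refl] by blast+
      show ?thesis unfolding law_def using that(2) \<phi>_bound c
        by (subst integral_distr, simp, simp, subst integral_density) auto
    qed
    have char_law: "char (law R) t = complex_of_real ((\<integral>w. \<phi> w * cos (t * X w) \<partial>R) / c)
        + \<i> * complex_of_real ((\<integral>w. \<phi> w * sin (t * X w) \<partial>R) / c)"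
      if R: "finite_measure R" "sets R = sets M" "integrable R \<phi>" for R t
    proof -
      have [measurable]: "X \<in> borel_measurable R" "\<phi> \<in> borel_measurable R"
        using X \<phi> measurable_cong_sets[OF R(2) refl] by blast+
      have int: "integrable R (\<lambda>w. (\<phi> w / c) *\<^sub>R iexp (t * X w))"
      proof (rule Bochner_Integration.integrable_bound[where f="\<lambda>w. \<phi> w / c"])
        show "integrable R (\<lambda>w. \<phi> w / c)" using R(3) by (rule integrable_divide_zero)
        show "(\<lambda>w. (\<phi> w / c) *\<^sub>R iexp (t * X w)) \<in> borel_measurable R" by measurable
        show "AE w in R. norm ((\<phi> w / c) *\<^sub>R iexp (t * X w)) \<le> norm (\<phi> w / c)"
          unfolding norm_scaleR norm_exp_i_times by simp
      qed
      have "char (law R) t = (\<integral>w. (\<phi> w / c) *\<^sub>R iexp (t * X w) \<partial>R)"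
        unfolding char_def by (rule integral_law[OF R(2)]) simp
      also have "\<dots> = complex_of_real ((\<integral>w. \<phi> w * cos (t * X w) \<partial>R) / c)
        + \<i> * complex_of_real ((\<integral>w. \<phi> w * sin (t * X w) \<partial>R) / c)"
      proof (rule complex_eqI)
        have "Re (\<integral>w. (\<phi> w / c) *\<^sub>R iexp (t * X w) \<partial>R) = (\<integral>w. Re ((\<phi> w / c) *\<^sub>R iexp (t * X w)) \<partial>R)"
          by (rule integral_Re[OF int, symmetric])
        also have "\<dots> = (\<integral>w. \<phi> w * cos (t * X w) / c \<partial>R)" by (simp add: Re_exp)
        finally show "Re (\<integral>w. (\<phi> w / c) *\<^sub>R iexp (t * X w) \<partial>R) = Re (complex_of_real ((\<integral>w. \<phi> w * cos (t * X w) \<partial>R) / c)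
          + \<i> * complex_of_real ((\<integral>w. \<phi> w * sin (t * X w) \<partial>R) / c))" by simp
        have "Im (\<integral>w. (\<phi> w / c) *\<^sub>R iexp (t * X w) \<partial>R) = (\<integral>w. Im ((\<phi> w / c) *\<^sub>R iexp (t * X w)) \<partial>R)"
          by (rule integral_Im[OF int, symmetric])
        also have "\<dots> = (\<integral>w. \<phi> w * sin (t * X w) / c \<partial>R)" by (simp add: Im_exp)
        finally show "Im (\<integral>w. (\<phi> w / c) *\<^sub>R iexp (t * X w) \<partial>R) = Im (complex_of_real ((\<integral>w. \<phi> w * cos (t * X w) \<partial>R) / c)
          + \<i> * complex_of_real ((\<integral>w. \<phi> w * sin (t * X w) \<partial>R) / c))" by simp
      qed
      finally show ?thesis .
    qed
    have "law M = law N"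
    proof (rule Levy_uniqueness)
      show "real_distribution (law M)" using M intM by (intro prob) (auto simp: c_def)
      show "real_distribution (law N)" using N intN sets by (intro prob) (auto simp: cN)
      show "char (law M) = char (law N)"
        using char_law[OF M refl intM] char_law[OF N sets[symmetric] intN] cos_eq sin_eq by auto
    qed
    then have "(\<integral>x. indicat_real A x \<partial>law M) = (\<integral>x. indicat_real A x \<partial>law N)" by simp
    then show ?thesis using integral_law[OF refl, of "indicat_real A"] integral_law[OF sets[symmetric], of "indicat_real A"] c
      by simp
  qed
qed

text \<open>The induction step that leads from one dimension to many: equality of the trigonometric moments
  with weight \<open>\<psi>\<close> is inherited by the weight \<open>\<psi>\<close> times the indicator of \<open>f \<in> A\<close>. The one-dimensional
  result requires nonnegative weights, so it is applied to the weights \<open>\<psi>\<close>, \<open>\<psi> (1 + cos g)\<close> and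
  \<open>\<psi> (1 + sin g)\<close>, and the results are subtracted. Its hypotheses hold because products such as
  \<open>cos (t f) cos g\<close> are combinations of \<open>cos (t f + g)\<close> and \<open>cos (t f - g)\<close>, where \<open>t f + g\<close> and \<open>t f - g\<close> are
  again in the linear space \<open>F\<close>.\<close>
lemma weighted_trig_moments_indicator:
  fixes M N :: "'w measure" and F :: "('w \<Rightarrow> real) set"
  assumes M: "finite_measure M" and N: "finite_measure N" and sets: "sets M = sets N"
    and F: "\<And>X. X \<in> F \<Longrightarrow> X \<in> borel_measurable M"
    and lin: "\<And>X Y a b. X \<in> F \<Longrightarrow> Y \<in> F \<Longrightarrow> (\<lambda>w. a * X w + b * Y w) \<in> F"
    and \<psi> [measurable]: "\<psi> \<in> borel_measurable M" and \<psi>_bound: "\<And>w. 0 \<le> \<psi> w" "\<And>w. \<psi> w \<le> 1"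
    and eq: "\<And>g. g \<in> F \<Longrightarrow> (\<integral>w. \<psi> w * cos (g w) \<partial>M) = (\<integral>w. \<psi> w * cos (g w) \<partial>N)"
       "\<And>g. g \<in> F \<Longrightarrow> (\<integral>w. \<psi> w * sin (g w) \<partial>M) = (\<integral>w. \<psi> w * sin (g w) \<partial>N)"
    and f: "f \<in> F" and g: "g \<in> F" and A [measurable]: "A \<in> sets borel"
  shows "(\<integral>w. \<psi> w * indicator A (f w) * cos (g w) \<partial>M) = (\<integral>w. \<psi> w * indicator A (f w) * cos (g w) \<partial>N)" (is ?C)
    and "(\<integral>w. \<psi> w * indicator A (f w) * sin (g w) \<partial>M) = (\<integral>w. \<psi> w * indicator A (f w) * sin (g w) \<partial>N)" (is ?S)
proof -
  interpret M: finite_measure M by (rule M)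
  interpret N: finite_measure N by (rule N)
  have MN: "h \<in> borel_measurable N" if "h \<in> borel_measurable M" for h :: "'w \<Rightarrow> real"
    using that measurable_cong_sets[OF sets refl] by blast
  note [measurable] = F[OF f] F[OF g] MN[OF F[OF f]] MN[OF F[OF g]] MN[OF \<psi>]
  have \<psi>1: "\<bar>\<psi> w * a\<bar> \<le> 1" if "\<bar>a\<bar> \<le> 1" for w a
    using that \<psi>_bound[of w] mult_le_one[of "\<psi> w" "\<bar>a\<bar>"] by (simp add: abs_mult)
  have bM: "integrable M (\<lambda>w. \<psi> w * u w)" "integrable N (\<lambda>w. \<psi> w * u w)"
    if "u \<in> borel_measurable M" "\<And>w. \<bar>u w\<bar> \<le> 1" for u
    using that MN[OF that(1)] \<psi>1 by (auto intro!: M.integrable_const_bound[where B=1] N.integrable_const_bound[where B=1])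
  have tf: "(\<lambda>w. t * f w) \<in> F" for t using lin[OF f f, of t 0] by simp
  have plus: "(\<lambda>w. t * f w + g w) \<in> F" and minus: "(\<lambda>w. t * f w - g w) \<in> F" for t
    using lin[OF f g, of t 1] lin[OF f g, of t "-1"] by simp_all
  have half: "(\<integral>w. \<psi> w * ((u w + s * v w) / 2) \<partial>M) = (\<integral>w. \<psi> w * ((u w + s * v w) / 2) \<partial>N)"
    if "u \<in> borel_measurable M" "v \<in> borel_measurable M" "\<And>w. \<bar>u w\<bar> \<le> 1" "\<And>w. \<bar>v w\<bar> \<le> 1"
      "(\<integral>w. \<psi> w * u w \<partial>M) = (\<integral>w. \<psi> w * u w \<partial>N)" "(\<integral>w. \<psi> w * v w \<partial>M) = (\<integral>w. \<psi> w * v w \<partial>N)"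
    for u v and s :: real
  proof -
    have 1: "\<psi> w * ((u w + s * v w) / 2) = (\<psi> w * u w) / 2 + s / 2 * (\<psi> w * v w)" for w
      by (simp add: field_simps)
    show ?thesis unfolding 1 using bM[of u] bM[of v] that by simp
  qed
  have pc: "(\<integral>w. \<psi> w * (cos (t * f w) * cos (g w)) \<partial>M) = (\<integral>w. \<psi> w * (cos (t * f w) * cos (g w)) \<partial>N)" for t
    using half[of "\<lambda>w. cos (t * f w + g w)" "\<lambda>w. cos (t * f w - g w)" 1] eq(1)[OF plus[of t]] eq(1)[OF minus[of t]]
    by (simp add: cos_times_cos add.commute)
  have ps: "(\<integral>w. \<psi> w * (sin (t * f w) * cos (g w)) \<partial>M) = (\<integral>w. \<psi> w * (sin (t * f w) * cos (g w)) \<partial>N)" for t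
    using half[of "\<lambda>w. sin (t * f w + g w)" "\<lambda>w. sin (t * f w - g w)" 1] eq(2)[OF plus[of t]] eq(2)[OF minus[of t]]
    by (simp add: sin_times_cos)
  have qc: "(\<integral>w. \<psi> w * (cos (t * f w) * sin (g w)) \<partial>M) = (\<integral>w. \<psi> w * (cos (t * f w) * sin (g w)) \<partial>N)" for t
    using half[of "\<lambda>w. sin (t * f w + g w)" "\<lambda>w. sin (t * f w - g w)" "-1"] eq(2)[OF plus[of t]] eq(2)[OF minus[of t]]
    by (simp add: cos_times_sin)
  have qs: "(\<integral>w. \<psi> w * (sin (t * f w) * sin (g w)) \<partial>M) = (\<integral>w. \<psi> w * (sin (t * f w) * sin (g w)) \<partial>N)" for t
    using half[of "\<lambda>w. cos (t * f w - g w)" "\<lambda>w. cos (t * f w + g w)" "-1"] eq(1)[OF plus[of t]] eq(1)[OF minus[of t]]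
    by (simp add: sin_times_sin)
  have base: "(\<integral>w. \<psi> w * indicator A (f w) \<partial>M) = (\<integral>w. \<psi> w * indicator A (f w) \<partial>N)"
    using \<psi>_bound eq[OF tf] by (intro indicator_law_from_trig_moments[OF M N sets _ _ _ _ _ _ A, where C=1]) auto
  have shift: "(\<integral>w. \<psi> w * indicator A (f w) * u w \<partial>M) = (\<integral>w. \<psi> w * indicator A (f w) * u w \<partial>N)"
    if u [measurable]: "u \<in> borel_measurable M" and u1: "\<And>w. \<bar>u w\<bar> \<le> 1"
      and c: "\<And>t. (\<integral>w. \<psi> w * (cos (t * f w) * u w) \<partial>M) = (\<integral>w. \<psi> w * (cos (t * f w) * u w) \<partial>N)"
      and s: "\<And>t. (\<integral>w. \<psi> w * (sin (t * f w) * u w) \<partial>M) = (\<integral>w. \<psi> w * (sin (t * f w) * u w) \<partial>N)"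
    for u
  proof -
    note [measurable] = MN[OF u]
    have u2: "0 \<le> 1 + u w" "1 + u w \<le> 2" for w using u1[of w] by (auto simp: abs_le_iff)
    have cu: "\<bar>cos a * u w\<bar> \<le> 1" "\<bar>sin a * u w\<bar> \<le> 1" "\<bar>indicator A (f w) * u w\<bar> \<le> 1" for a w
      using u1[of w] by (auto simp: abs_mult indicator_def intro!: mult_le_one)
    have "(\<integral>w. \<psi> w * (1 + u w) * indicator A (f w) \<partial>M) = (\<integral>w. \<psi> w * (1 + u w) * indicator A (f w) \<partial>N)"
    proof (rule indicator_law_from_trig_moments[OF M N sets _ _ _ _ _ _ A, where C=2])
      show "0 \<le> \<psi> w * (1 + u w)" for w using \<psi>_bound u2 by simp
      show "\<psi> w * (1 + u w) \<le> 2" for w using \<psi>_bound[of w] u2[of w] mult_mono[of "\<psi> w" 1 "1 + u w" 2] by simp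
      have e: "\<psi> w * (1 + u w) * v = \<psi> w * v + \<psi> w * (v * u w)" for w v by (simp add: algebra_simps)
      show "(\<integral>w. \<psi> w * (1 + u w) * cos (t * f w) \<partial>M) = (\<integral>w. \<psi> w * (1 + u w) * cos (t * f w) \<partial>N)" for t
        unfolding e using bM[of "\<lambda>w. cos (t * f w)"] bM[of "\<lambda>w. cos (t * f w) * u w"] cu eq(1)[OF tf[of t]] c[of t] by simp
      show "(\<integral>w. \<psi> w * (1 + u w) * sin (t * f w) \<partial>M) = (\<integral>w. \<psi> w * (1 + u w) * sin (t * f w) \<partial>N)" for t
        unfolding e using bM[of "\<lambda>w. sin (t * f w)"] bM[of "\<lambda>w. sin (t * f w) * u w"] cu eq(2)[OF tf[of t]] s[of t] by simp
    qed measurable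
    also have e: "\<psi> w * (1 + u w) * indicator A (f w) = \<psi> w * indicator A (f w) + \<psi> w * (indicator A (f w) * u w)" for w
      by (simp add: algebra_simps)
    ultimately have "(\<integral>w. \<psi> w * indicator A (f w) \<partial>M) + (\<integral>w. \<psi> w * (indicator A (f w) * u w) \<partial>M)
      = (\<integral>w. \<psi> w * indicator A (f w) \<partial>N) + (\<integral>w. \<psi> w * (indicator A (f w) * u w) \<partial>N)"
      unfolding e using bM[of "\<lambda>w. indicator A (f w)"] bM[of "\<lambda>w. indicator A (f w) * u w"] cu
      by (simp add: indicator_def)
    then show ?thesis using base by (simp add: mult.assoc)
  qed
  show ?C by (rule shift[OF _ _ pc ps]) auto
  show ?S by (rule shift[OF _ _ qc qs]) auto
qed

text \<open>Adding the conditions \<open>X \<in> A\<close> one at a time shows that both measures agree on all finite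
  intersections of such events, and these form a generator that is stable under intersection.\<close>
theorem prob_eq_if_char_eq:
  fixes M N :: "'w measure" and F :: "('w \<Rightarrow> real) set"
  assumes M: "prob_space M" and N: "prob_space N"
    and setsM: "sets M = sigma_sets \<Omega> {{w \<in> \<Omega>. X w \<in> A} | X A. X \<in> F \<and> A \<in> sets borel}"
    and setsN: "sets N = sets M"
    and F0: "(\<lambda>_. 0) \<in> F"
    and lin: "\<And>X Y a b. X \<in> F \<Longrightarrow> Y \<in> F \<Longrightarrow> (\<lambda>w. a * X w + b * Y w) \<in> F"
    and char: "\<And>X. X \<in> F \<Longrightarrow> (\<integral>w. iexp (X w) \<partial>M) = (\<integral>w. iexp (X w) \<partial>N)"
  shows "M = N"
proof -
  interpret M: prob_space M by (rule M)
  interpret N: prob_space N by (rule N)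
  let ?G = "{{w \<in> \<Omega>. X w \<in> A} | X A. X \<in> F \<and> A \<in> sets borel}"
  have "sets M = sets (sigma \<Omega> ?G)" unfolding setsM by (rule sets_measure_of[symmetric]) auto
  then have space: "space M = \<Omega>" by (simp add: sets_eq_imp_space_eq space_measure_of_conv)
  have spaceN: "space N = \<Omega>" using sets_eq_imp_space_eq[OF setsN] space by simp
  have FM: "X \<in> borel_measurable M" if "X \<in> F" for X
  proof (rule measurableI)
    fix A :: "real set" assume "A \<in> sets borel"
    then have "{w \<in> \<Omega>. X w \<in> A} \<in> sets M" unfolding setsM using that by (intro sigma_sets.Basic) blast
    then show "X -` A \<inter> space M \<in> sets M" by (simp add: space vimage_def Int_def conj_commute)
  qed simp
  have FN: "X \<in> borel_measurable N" if "X \<in> F" for X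
    using FM[OF that] measurable_cong_sets[OF setsN refl] by blast
  define \<psi> :: "(('w \<Rightarrow> real) \<times> real set) set \<Rightarrow> 'w \<Rightarrow> real"
    where "\<psi> P w = (\<Prod>p\<in>P. indicator (snd p) (fst p w))" for P w
  have \<psi>01: "0 \<le> \<psi> P w" "\<psi> P w \<le> 1" for P w
    unfolding \<psi>_def by (auto intro!: prod_nonneg prod_le_1 simp: indicator_def)
  have \<psi>_meas: "\<psi> P \<in> borel_measurable M" if "P \<subseteq> F \<times> sets borel" for P
    unfolding \<psi>_def
  proof (intro borel_measurable_prod)
    fix p assume "p \<in> P"
    with that have [measurable]: "fst p \<in> borel_measurable M" "snd p \<in> sets borel" using FM by auto
    show "(\<lambda>w. indicat_real (snd p) (fst p w)) \<in> borel_measurable M" by measurable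
  qed
  \<comment> \<open>The trigonometric moments agree under every weight that imposes finitely many conditions.\<close>
  have *: "finite P \<Longrightarrow> P \<subseteq> F \<times> sets borel \<Longrightarrow> \<forall>g\<in>F. (\<integral>w. \<psi> P w * cos (g w) \<partial>M) = (\<integral>w. \<psi> P w * cos (g w) \<partial>N)
      \<and> (\<integral>w. \<psi> P w * sin (g w) \<partial>M) = (\<integral>w. \<psi> P w * sin (g w) \<partial>N)" for P
  proof (induction P rule: finite_induct)
    case empty
    show ?case
    proof (intro ballI conjI)
      fix g assume g: "g \<in> F"
      note [measurable] = FM[OF g] FN[OF g]
      have iM: "integrable M (\<lambda>w. iexp (g w))" by (intro M.integrable_const_bound[where B=1]) auto
      have iN: "integrable N (\<lambda>w. iexp (g w))" by (intro N.integrable_const_bound[where B=1]) auto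
      have "(\<integral>w. Re (iexp (g w)) \<partial>M) = (\<integral>w. Re (iexp (g w)) \<partial>N)"
        unfolding integral_Re[OF iM] integral_Re[OF iN] char[OF g] ..
      then show "(\<integral>w. \<psi> {} w * cos (g w) \<partial>M) = (\<integral>w. \<psi> {} w * cos (g w) \<partial>N)" by (simp add: \<psi>_def Re_exp)
      have "(\<integral>w. Im (iexp (g w)) \<partial>M) = (\<integral>w. Im (iexp (g w)) \<partial>N)"
        unfolding integral_Im[OF iM] integral_Im[OF iN] char[OF g] ..
      then show "(\<integral>w. \<psi> {} w * sin (g w) \<partial>M) = (\<integral>w. \<psi> {} w * sin (g w) \<partial>N)" by (simp add: \<psi>_def Im_exp)
    qed
  next
    case (insert p P)
    have p: "fst p \<in> F" "snd p \<in> sets borel" and P: "P \<subseteq> F \<times> sets borel" using insert.prems by auto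
    have ins: "\<psi> (insert p P) w = \<psi> P w * indicator (snd p) (fst p w)" for w
      using insert.hyps by (simp add: \<psi>_def mult.commute)
    note IH = insert.IH[OF P]
    show ?case unfolding ins
      by (intro ballI conjI weighted_trig_moments_indicator[where F=F] M.finite_measure_axioms N.finite_measure_axioms setsN[symmetric]
            FM lin \<psi>_meas[OF P] \<psi>01 p) (use IH in auto)
  qed
  define E where "E = {{w\<in>\<Omega>. \<forall>p\<in>P. fst p w \<in> snd p} | P. finite P \<and> P \<subseteq> F \<times> sets borel}"
  have ind: "\<psi> P w = indicator {w\<in>\<Omega>. \<forall>p\<in>P. fst p w \<in> snd p} w" if "w \<in> \<Omega>" "finite P" for P w
    using that by (auto simp: \<psi>_def indicator_def prod_zero_iff) 
  have EM: "{w\<in>\<Omega>. \<forall>p\<in>P. fst p w \<in> snd p} \<in> sets M" if P: "finite P" "P \<subseteq> F \<times> sets borel" for P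
  proof -
    have "{w \<in> space M. \<forall>p\<in>P. fst p w \<in> snd p} \<in> sets M"
    proof (rule sets.sets_Collect_finite_All[OF _ P(1)])
      fix p assume "p \<in> P"
      with P(2) have [measurable]: "fst p \<in> borel_measurable M" "snd p \<in> sets borel" using FM by auto
      show "{w \<in> space M. fst p w \<in> snd p} \<in> sets M" by measurable
    qed
    then show ?thesis by (simp add: space)
  qed
  have sE: "sigma_sets \<Omega> E = sets M"
  proof
    show "sigma_sets \<Omega> E \<subseteq> sets M"
      using sets.sigma_sets_subset[of E M] EM by (auto simp: E_def space)
    have "?G \<subseteq> E"
    proof clarify
      fix X A assume "X \<in> F" "A \<in> sets (borel :: real measure)"
      then show "{w \<in> \<Omega>. X w \<in> A} \<in> E" unfolding E_def by (intro CollectI exI[of _ "{(X, A)}"]) auto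
    qed
    then show "sets M \<subseteq> sigma_sets \<Omega> E" unfolding setsM by (rule sigma_sets_mono')
  qed
  show "M = N"
  proof (rule measure_eqI_generator_eq[where E=E and \<Omega>=\<Omega> and A="\<lambda>_. \<Omega>"])
    show "Int_stable E"
    proof (rule Int_stableI)
      fix a b assume "a \<in> E" "b \<in> E"
      then obtain P Q where P: "a = {w\<in>\<Omega>. \<forall>p\<in>P. fst p w \<in> snd p}" "finite P" "P \<subseteq> F \<times> sets borel"
        and Q: "b = {w\<in>\<Omega>. \<forall>p\<in>Q. fst p w \<in> snd p}" "finite Q" "Q \<subseteq> F \<times> sets borel"
        unfolding E_def by blast
      have "a \<inter> b = {w\<in>\<Omega>. \<forall>p\<in>P \<union> Q. fst p w \<in> snd p}" unfolding P(1) Q(1) by blast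
      then show "a \<inter> b \<in> E" unfolding E_def using P Q by (intro CollectI exI[of _ "P \<union> Q"]) auto
    qed
    show "E \<subseteq> Pow \<Omega>" by (auto simp: E_def)
    show "sets M = sigma_sets \<Omega> E" "sets N = sigma_sets \<Omega> E" using sE setsN by auto
    show "range (\<lambda>_::nat. \<Omega>) \<subseteq> E" unfolding E_def by (auto intro!: exI[of _ "{}"])
    show "(\<Union>i::nat. \<Omega>) = \<Omega>" by simp
    show "emeasure M \<Omega> \<noteq> \<infinity>" by simp
    fix a assume "a \<in> E"
    then obtain P where P: "a = {w\<in>\<Omega>. \<forall>p\<in>P. fst p w \<in> snd p}" "finite P" "P \<subseteq> F \<times> sets borel"
      unfolding E_def by blast
    have a: "a \<in> sets M" unfolding P(1) by (rule EM[OF P(2,3)])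
    have aN: "a \<in> sets N" using a setsN by simp
    have asub: "a \<subseteq> \<Omega>" by (auto simp: P(1))
    have "measure M a = (\<integral>w. indicator a w \<partial>M)" using asub by (simp add: space Int_absorb2)
    also have "\<dots> = (\<integral>w. \<psi> P w * cos 0 \<partial>M)" using ind[OF _ P(2)] by (intro Bochner_Integration.integral_cong) (auto simp: space P(1))
    also have "\<dots> = (\<integral>w. \<psi> P w * cos 0 \<partial>N)" using *[OF P(2,3), THEN bspec, OF F0] by blast
    also have "\<dots> = (\<integral>w. indicator a w \<partial>N)" using ind[OF _ P(2)] by (intro Bochner_Integration.integral_cong) (auto simp: spaceN P(1))
    also have "\<dots> = measure N a" using asub by (simp add: spaceN Int_absorb2)
    finally show "emeasure M a = emeasure N a" by (simp add: M.emeasure_eq_measure N.emeasure_eq_measure)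
  qed
qed

lemma sets_discrete_radon_space:
  "sets (discrete_radon_space :: 'a::euclidean_space measure measure) = sigma_sets discrete_radon_measures
    {{\<eta> \<in> discrete_radon_measures. (\<integral>x. f x \<partial>\<eta>) \<in> A} | f A. compactly_supported_continuous f \<and> A \<in> sets borel}"
  (is "_ = sigma_sets _ ?G")
proof
  show "sigma_sets discrete_radon_measures ?G \<subseteq> sets discrete_radon_space"
  proof -
    have "?G \<subseteq> sets discrete_radon_space"
    proof clarify
      fix A :: "real set" and f :: "'a \<Rightarrow> real" assume A: "A \<in> sets borel" and f: "compactly_supported_continuous f"
      show "{\<eta> \<in> discrete_radon_measures. (\<integral>x. f x \<partial>\<eta>) \<in> A} \<in> sets discrete_radon_space"
        using measurable_sets[OF integral_measurable_discrete[OF f] A]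
        by (simp add: space_discrete_radon_space vimage_def Int_def conj_commute)
    qed
    then show ?thesis using sets.sigma_sets_subset[of ?G discrete_radon_space] by (simp add: space_discrete_radon_space)
  qed
  show "sets discrete_radon_space \<subseteq> sigma_sets discrete_radon_measures ?G"
  proof
    fix B :: "'a measure set" assume B: "B \<in> sets discrete_radon_space"
    let ?S = "sigma discrete_radon_measures ?G"
    have S: "sets ?S = sigma_sets discrete_radon_measures ?G" "space ?S = discrete_radon_measures"
      by (auto intro!: sets_measure_of space_measure_of)
    have "(\<lambda>\<eta>. \<eta>) \<in> measurable ?S (discrete_radon_space :: 'a measure measure)"
    proof (rule measurable_discrete_radon_spaceI)
      fix f :: "'a \<Rightarrow> real" assume f: "compactly_supported_continuous f"
      show "(\<lambda>\<eta>. \<integral>x. f x \<partial>\<eta>) \<in> borel_measurable ?S"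
      proof (rule measurableI)
        fix A :: "real set" assume "A \<in> sets borel"
        then have "{\<eta> \<in> discrete_radon_measures. (\<integral>x. f x \<partial>\<eta>) \<in> A} \<in> sets ?S" unfolding S using f
          by (intro sigma_sets.Basic CollectI exI[of _ f] exI[of _ A] conjI refl)
        moreover have "(\<lambda>\<eta>. \<integral>x. f x \<partial>\<eta>) -` A \<inter> space ?S = {\<eta> \<in> discrete_radon_measures. (\<integral>x. f x \<partial>\<eta>) \<in> A}"
          unfolding S(2) by blast
        ultimately show "(\<lambda>\<eta>. \<integral>x. f x \<partial>\<eta>) -` A \<inter> space ?S \<in> sets ?S" by (simp only:)
      qed simp
    qed (simp add: S)
    from measurable_sets[OF this B] have "B \<inter> space ?S \<in> sets ?S" by simp
    moreover have "B \<subseteq> discrete_radon_measures" using sets.sets_into_space[OF B] by (simp add: space_discrete_radon_space)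
    ultimately show "B \<in> sigma_sets discrete_radon_measures ?G" unfolding S by (simp add: Int_absorb2)
  qed
qed

lemma csc_lincomb:
  assumes f: "compactly_supported_continuous f" and g: "compactly_supported_continuous g"
  shows "compactly_supported_continuous (\<lambda>x. a * f x + b * g x)"
proof -
  obtain n where n: "\<And>x. real n \<le> norm x \<Longrightarrow> f x = 0" using csc_bounded_support[OF f] by metis
  obtain k where k: "\<And>x. real k \<le> norm x \<Longrightarrow> g x = 0" using csc_bounded_support[OF g] by metis
  show ?thesis
  proof (rule csc_intro[where r="max (real n) (real k)"])
    show "continuous_on UNIV (\<lambda>x. a * f x + b * g x)"
      using f g by (auto simp: compactly_supported_continuous_def intro!: continuous_intros)
  qed (use n k in auto)
qed

text \<open>Evaluations form a linear space only on measures for which all the integrals exist. The map \<open>r\<close> makes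
  them total by sending everything else to the zero measure.\<close>
theorem discrete_law_eqI:
  fixes M N :: "'a::euclidean_space measure measure"
  assumes M: "prob_space M" "sets M = sets discrete_radon_space"
    and N: "prob_space N" "sets N = sets discrete_radon_space"
    and char: "\<And>f. compactly_supported_continuous f \<Longrightarrow>
        (\<integral>\<eta>. iexp (\<integral>x. f x \<partial>\<eta>) \<partial>M) = (\<integral>\<eta>. iexp (\<integral>x. f x \<partial>\<eta>) \<partial>N)"
  shows "M = N"
proof -
  define r where "r \<eta> = (if \<eta> \<in> discrete_radon_measures then \<eta> else null_measure borel)" for \<eta> :: "'a measure"
  define F where "F = {\<lambda>\<eta>. \<integral>x. f x \<partial>r \<eta> | f :: 'a \<Rightarrow> real. compactly_supported_continuous f}"
  have space: "space M = discrete_radon_measures" "space N = discrete_radon_measures"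
    using sets_eq_imp_space_eq[OF M(2)] sets_eq_imp_space_eq[OF N(2)] by (simp_all add: space_discrete_radon_space)
  have r_radon: "r \<eta> \<in> radon_measures" for \<eta> by (auto simp: r_def discrete_imp_radon) (simp add: radon_measures_def)
  show ?thesis
  proof (rule prob_eq_if_char_eq[OF M(1) N(1), where F=F and \<Omega>=discrete_radon_measures])
    show "sets N = sets M" using M N by simp
    have r_eq: "{\<eta> \<in> discrete_radon_measures. (\<integral>x. f x \<partial>r \<eta>) \<in> A} = {\<eta> \<in> discrete_radon_measures. (\<integral>x. f x \<partial>\<eta>) \<in> A}"
      for f :: "'a \<Rightarrow> real" and A by (rule Collect_cong) (simp add: r_def cong: conj_cong)
    have "{{\<eta> \<in> discrete_radon_measures. (\<integral>x. f x \<partial>\<eta>) \<in> A} | f A. compactly_supported_continuous (f :: 'a \<Rightarrow> real) \<and> A \<in> sets borel}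
      = {{\<eta> \<in> discrete_radon_measures. X \<eta> \<in> A} | X A. X \<in> F \<and> A \<in> sets borel}" (is "?L = ?R")
    proof (intro equalityI subsetI)
      fix S assume "S \<in> ?L"
      then obtain f A where "S = {\<eta> \<in> discrete_radon_measures. (\<integral>x. f x \<partial>r \<eta>) \<in> A}" "compactly_supported_continuous f" "A \<in> sets borel"
        unfolding r_eq by blast
      then show "S \<in> ?R"
        by (intro CollectI exI[of _ "\<lambda>\<eta>. \<integral>x. f x \<partial>r \<eta>"] exI[of _ A]) (auto simp: F_def)
    next
      fix S assume "S \<in> ?R"
      then obtain X A where "S = {\<eta> \<in> discrete_radon_measures. X \<eta> \<in> A}" "X \<in> F" "A \<in> sets borel" by blast
      moreover from this obtain f where "X = (\<lambda>\<eta>. \<integral>x. f x \<partial>r \<eta>)" "compactly_supported_continuous f" unfolding F_def by blast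
      ultimately show "S \<in> ?L" using r_eq[of f A] by (intro CollectI exI[of _ f] exI[of _ A]) simp
    qed
    then show "sets M = sigma_sets discrete_radon_measures {{\<eta> \<in> discrete_radon_measures. X \<eta> \<in> A} | X A. X \<in> F \<and> A \<in> sets borel}"
      unfolding M(2) sets_discrete_radon_space by simp
    show "(\<lambda>_. 0) \<in> F" unfolding F_def
      by (intro CollectI exI[of _ "\<lambda>_. 0"]) (auto simp: compactly_supported_continuous_def)
    fix X Y a b assume "X \<in> F" "Y \<in> F"
    then obtain f g where f: "compactly_supported_continuous f" "X = (\<lambda>\<eta>. \<integral>x. f x \<partial>r \<eta>)"
      and g: "compactly_supported_continuous g" "Y = (\<lambda>\<eta>. \<integral>x. g x \<partial>r \<eta>)" unfolding F_def by blast
    have "(\<lambda>w. a * X w + b * Y w) = (\<lambda>\<eta>. \<integral>x. a * f x + b * g x \<partial>r \<eta>)"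
      using integrable_csc[OF r_radon f(1)] integrable_csc[OF r_radon g(1)] by (simp add: f(2) g(2))
    then show "(\<lambda>w. a * X w + b * Y w) \<in> F" unfolding F_def using csc_lincomb[OF f(1) g(1)] by blast
  next
    fix X assume "X \<in> F"
    then obtain f where f: "compactly_supported_continuous f" "X = (\<lambda>\<eta>. \<integral>x. f x \<partial>r \<eta>)" unfolding F_def by blast
    have "(\<integral>\<eta>. iexp (X \<eta>) \<partial>R) = (\<integral>\<eta>. iexp (\<integral>x. f x \<partial>\<eta>) \<partial>R)"
      if "space R = discrete_radon_measures" for R
      by (intro Bochner_Integration.integral_cong) (auto simp: f(2) r_def that)
    then show "(\<integral>w. iexp (X w) \<partial>M) = (\<integral>w. iexp (X w) \<partial>N)"
      using char[OF f(1)] space by simp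
  qed
qed

section \<open>Discrete measures and their atoms\<close>

lemma discrete_atoms:
  fixes \<eta> :: "'a::euclidean_space measure"
  assumes \<eta>: "\<eta> \<in> discrete_radon_measures"
  shows "countable (atoms \<eta>)" "emeasure \<eta> (- atoms \<eta>) = 0"
proof -
  obtain A s where A: "countable A" "\<And>x. x \<in> A \<Longrightarrow> 0 < s x"
    "\<And>B. B \<in> sets borel \<Longrightarrow> emeasure \<eta> B = (\<Sum>\<^sub>\<infinity>x\<in>A. ennreal (s x) * indicator B x)"
    using \<eta> unfolding discrete_radon_measures_def by blast
  have zero: "emeasure \<eta> B = 0" if "B \<in> sets borel" "B \<inter> A = {}" for B
    unfolding A(3)[OF that(1)] using that(2) by (intro infsum_0) (auto simp: indicator_def)
  have one: "emeasure \<eta> {x} = ennreal (s x)" if "x \<in> A" for x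
  proof -
    have "emeasure \<eta> {x} = (\<Sum>\<^sub>\<infinity>y\<in>{x}. ennreal (s y) * indicator {x} y)"
      unfolding A(3)[OF borel_singleton[OF sets.empty_sets]]
      by (rule infsum_cong_neutral) (use that in auto)
    then show ?thesis by simp
  qed
  have "atoms \<eta> = A"
  proof (rule set_eqI)
    fix x show "x \<in> atoms \<eta> \<longleftrightarrow> x \<in> A"
      using one[of x] A(2)[of x] zero[of "{x}"] by (cases "x \<in> A") (auto simp: atoms_def)
  qed
  moreover have "A \<in> sets borel" using A(1) by (rule sets.countable[rotated]) simp
  ultimately show "countable (atoms \<eta>)" "emeasure \<eta> (- atoms \<eta>) = 0"
    using A(1) zero[of "- A"] by (auto simp: borel_comp)
qed

text \<open>Together with \<open>discrete_atoms\<close> this characterizes discreteness by concentration on a countable set,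
  a property that is easily checked for images and for random sums. Points of \<open>A\<close> without mass are
  removed first, as the weights in the definition are positive; the unordered sum is then the
  supremum over finite subsets.\<close>
lemma discrete_radon_measuresI:
  fixes \<eta> :: "'a::euclidean_space measure"
  assumes \<eta>: "\<eta> \<in> radon_measures" and A: "countable A" and null: "emeasure \<eta> (- A) = 0"
  shows "\<eta> \<in> discrete_radon_measures"
proof -
  define A' where "A' = A \<inter> atoms \<eta>"
  \<comment> \<open>Positions in \<open>A\<close> that carry no mass form a countable null set.\<close>
  have cA': "countable A'" using A by (auto simp: A'_def)
  have bA: "C \<in> sets borel" if "countable C" for C :: "'a set"
    using that by (rule sets.countable[rotated]) simp
  have sing: "emeasure \<eta> {x} < \<infinity>" for x using radon_finite[OF \<eta>, of "{x}"] by simp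
  have pos: "0 < measure \<eta> {x}" if "x \<in> A'" for x
    using that sing[of x] by (auto simp: A'_def atoms_def measure_def enn2real_positive_iff less_top)
  have "emeasure \<eta> (A - A') = (\<integral>\<^sup>+x. emeasure \<eta> {x} \<partial>count_space (A - A'))"
    using A by (intro emeasure_countable_singleton) (auto simp: radon_sets[OF \<eta>])
  also have "\<dots> = 0" by (subst nn_integral_0_iff_AE) (auto simp: A'_def atoms_def AE_count_space)
  finally have small: "emeasure \<eta> (A - A') = 0" .
  have sets: "- A \<in> sets \<eta>" "A - A' \<in> sets \<eta>"
    using bA[OF A] bA[OF cA'] by (auto simp: radon_sets[OF \<eta>] borel_comp)
  have "emeasure \<eta> (- A') \<le> emeasure \<eta> (- A \<union> (A - A'))"
    using sets by (intro emeasure_mono sets.Un) auto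
  also have "\<dots> \<le> emeasure \<eta> (- A) + emeasure \<eta> (A - A')" using sets by (rule emeasure_subadditive)
  finally have nullA: "emeasure \<eta> (- A') = 0" using null small by simp
  have "emeasure \<eta> B = (\<Sum>\<^sub>\<infinity>x\<in>A'. ennreal (measure \<eta> {x}) * indicator B x)" if B: "B \<in> sets borel" for B
  proof (rule antisym)
    have SUP: "(\<Sum>\<^sub>\<infinity>x\<in>A'. ennreal (measure \<eta> {x}) * indicator B x)
        = (SUP F\<in>{F. finite F \<and> F \<subseteq> A'}. \<Sum>x\<in>F. ennreal (measure \<eta> {x}) * indicator B x)"
      by (intro nonneg_infsum_complete) simp
    have fin: "(\<Sum>x\<in>F. ennreal (measure \<eta> {x}) * indicator B x) = emeasure \<eta> (F \<inter> B)" if "finite F" for F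
    proof -
      have "emeasure \<eta> (F \<inter> B) = (\<Sum>x\<in>F \<inter> B. emeasure \<eta> {x})"
        using that by (intro emeasure_eq_sum_singleton) (auto simp: radon_sets[OF \<eta>])
      also have "\<dots> = (\<Sum>x\<in>F. ennreal (measure \<eta> {x}) * indicator B x)"
        using that sing by (intro sum.mono_neutral_cong_left)
          (auto simp: indicator_def emeasure_eq_ennreal_measure less_top)
      finally show ?thesis ..
    qed
    show "(\<Sum>\<^sub>\<infinity>x\<in>A'. ennreal (measure \<eta> {x}) * indicator B x) \<le> emeasure \<eta> B"
      unfolding SUP
    proof (rule SUP_least)
      fix F assume "F \<in> {F. finite F \<and> F \<subseteq> A'}"
      then have F: "finite F" by simp
      show "(\<Sum>x\<in>F. ennreal (measure \<eta> {x}) * indicator B x) \<le> emeasure \<eta> B"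
        unfolding fin[OF F] using B by (intro emeasure_mono) (auto simp: radon_sets[OF \<eta>])
    qed
    have "emeasure \<eta> B = emeasure \<eta> (A' \<inter> B)"
    proof -
      have "emeasure \<eta> B = emeasure \<eta> (B - - A')"
        using B bA[OF cA'] nullA by (intro emeasure_Diff_null_set[symmetric]) (auto simp: null_sets_def radon_sets[OF \<eta>] borel_comp)
      also have "B - - A' = A' \<inter> B" by auto
      finally show ?thesis .
    qed
    also have "\<dots> = (SUP n. emeasure \<eta> ((A' \<inter> B) \<inter> {x. to_nat_on A' x < n}))"
    proof -
      have "(SUP n. emeasure \<eta> ((A' \<inter> B) \<inter> {x. to_nat_on A' x < n})) = emeasure \<eta> (\<Union>n. (A' \<inter> B) \<inter> {x. to_nat_on A' x < n})"
        using cA' by (intro SUP_emeasure_incseq) (auto simp: radon_sets[OF \<eta>] incseq_def intro!: bA intro: countable_subset)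
      also have "(\<Union>n. (A' \<inter> B) \<inter> {x. to_nat_on A' x < n}) = A' \<inter> B" by auto
      finally show ?thesis ..
    qed
    also have "\<dots> \<le> (\<Sum>\<^sub>\<infinity>x\<in>A'. ennreal (measure \<eta> {x}) * indicator B x)"
    proof (rule SUP_least)
      fix n
      let ?F = "A' \<inter> {x. to_nat_on A' x < n}"
      have "inj_on (to_nat_on A') ?F" using inj_on_to_nat_on[OF cA'] by (rule inj_on_subset) auto
      moreover have "finite (to_nat_on A' ` ?F)" by (rule finite_subset[of _ "{..<n}"]) auto
      ultimately have F: "finite ?F" using finite_imageD by blast
      have "(A' \<inter> B) \<inter> {x. to_nat_on A' x < n} = ?F \<inter> B" by auto
      then show "emeasure \<eta> ((A' \<inter> B) \<inter> {x. to_nat_on A' x < n}) \<le> (\<Sum>\<^sub>\<infinity>x\<in>A'. ennreal (measure \<eta> {x}) * indicator B x)"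
        unfolding SUP using F by (simp only: fin[OF F, symmetric]) (intro SUP_upper, auto)
    qed
    finally show "emeasure \<eta> B \<le> (\<Sum>\<^sub>\<infinity>x\<in>A'. ennreal (measure \<eta> {x}) * indicator B x)" .
  qed
  then show ?thesis unfolding discrete_radon_measures_def
    using \<eta> cA' pos by (intro CollectI conjI exI[of _ A'] exI[of _ "\<lambda>x. measure \<eta> {x}"]) auto
qed

lemma atoms_measure_pos:
  assumes "\<eta> \<in> radon_measures" "x \<in> atoms \<eta>"
  shows "0 < measure \<eta> {x}"
  using assms radon_finite[OF assms(1), of "{x}"]
  by (auto simp: atoms_def measure_def enn2real_positive_iff less_top)

lemma measure_discrete_finite_atoms:
  assumes \<eta>: "\<eta> \<in> discrete_radon_measures" and B: "B \<in> sets borel" and fin: "finite (atoms \<eta> \<inter> B)"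
  shows "measure \<eta> B = (\<Sum>x\<in>atoms \<eta> \<inter> B. measure \<eta> {x})"
proof -
  note r = discrete_imp_radon[OF \<eta>]
  have "atoms \<eta> \<in> sets borel" using discrete_atoms(1)[OF \<eta>] by (rule sets.countable[rotated]) simp
  then have "measure \<eta> B = measure \<eta> (B - - atoms \<eta>)"
    using B discrete_atoms(2)[OF \<eta>]
    by (intro measure_Diff_null_set[symmetric]) (auto simp: null_sets_def radon_sets[OF r] borel_comp)
  also have "B - - atoms \<eta> = atoms \<eta> \<inter> B" by auto
  also have "measure \<eta> (atoms \<eta> \<inter> B) = (\<Sum>x\<in>atoms \<eta> \<inter> B. measure \<eta> {x})"
    using fin radon_finite_subset[OF r, of "{x}" for x]
    by (intro measure_eq_sum_singleton) (auto simp: radon_sets[OF r])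
  finally show ?thesis .
qed

section \<open>Measurability of products over atoms\<close>

lemma eventually_inj_on_grid_point:
  assumes "finite (S :: 'a::euclidean_space set)"
  shows "eventually (\<lambda>k. inj_on (grid_point k) S) sequentially"
proof -
  have "eventually (\<lambda>k. grid_point k x = grid_point k y \<longrightarrow> x = y) sequentially" for x y :: 'a
  proof (cases "x = y")
    case False
    then have "eventually (\<lambda>k. \<forall>z::'a. dist (grid_point k z) z < dist x y / 2) sequentially"
      by (intro grid_point_fine) simp
    then show ?thesis
    proof (rule eventually_mono, intro impI)
      fix k assume k: "\<forall>z::'a. dist (grid_point k z) z < dist x y / 2" and eq: "grid_point k x = grid_point k y"
      have "dist x y \<le> dist (grid_point k x) x + dist (grid_point k x) y" by (rule dist_triangle3)
      with k[rule_format, of x] k[rule_format, of y] eq show "x = y" by simp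
    qed
  qed simp
  then show ?thesis unfolding inj_on_def
    by (intro eventually_ball_finite assms ballI)
qed

lemma cell_measure_zero:
  assumes \<eta>: "\<eta> \<in> discrete_radon_measures" and B: "B \<in> sets borel" and "atoms \<eta> \<inter> B = {}"
  shows "measure \<eta> B = 0"
  using measure_discrete_finite_atoms[OF \<eta> B] assms(3) by simp

definition finitely_many_atoms_in :: "'a::euclidean_space set \<Rightarrow> 'a measure set" where
  "finitely_many_atoms_in K = {\<eta> \<in> discrete_radon_measures. finite (atoms \<eta> \<inter> K)}"

text \<open>Once the grid separates the atoms in \<open>K\<close>, the mass of a cell is either 0 or the mass of one atom, so
  counting cells with mass in \<open>B\<close> counts atoms with mass in \<open>B\<close>. The left-hand side does not mention
  atoms and is visibly measurable in \<open>\<eta>\<close>. Intersecting with \<open>{0<..}\<close> discards the empty cells in case \<open>0 \<in> B\<close>.\<close>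
lemma cell_count_eq:
  fixes \<eta> :: "'a::euclidean_space measure"
  assumes \<eta>: "\<eta> \<in> discrete_radon_measures" and K: "K \<in> sets borel" "bounded K"
    and fin: "finite (atoms \<eta> \<inter> K)" and inj: "inj_on (grid_point k) (atoms \<eta> \<inter> K)"
    and A: "A \<in> sets borel"
  shows "(\<Sum>z\<in>grid_point k ` K. indicator (B \<inter> {0<..}) (measure \<eta> (A \<inter> K \<inter> grid_point k -` {z})))
    = (\<Sum>x\<in>atoms \<eta> \<inter> K. indicator (A \<times> B) (x, measure \<eta> {x}) :: real)"
proof -
  let ?g = "grid_point k :: 'a \<Rightarrow> 'a" and ?P = "atoms \<eta> \<inter> K"
  let ?t = "\<lambda>z. indicator (B \<inter> {0<..}) (measure \<eta> (A \<inter> K \<inter> ?g -` {z})) :: real"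
  have cell: "A \<inter> K \<inter> ?g -` {z} \<in> sets borel" for z using K A grid_cell_borel by blast
  have "(\<Sum>z\<in>?g ` K. ?t z) = (\<Sum>z\<in>?g ` ?P. ?t z)"
  proof (rule sum.mono_neutral_right)
    show "finite (?g ` K)" by (rule finite_grid_image[OF K(2)])
    show "\<forall>z\<in>?g ` K - ?g ` ?P. ?t z = 0"
    proof
      fix z assume "z \<in> ?g ` K - ?g ` ?P"
      then have "z \<notin> ?g ` ?P" by simp
      then have "atoms \<eta> \<inter> (A \<inter> K \<inter> ?g -` {z}) = {}" by blast
      from cell_measure_zero[OF \<eta> cell this] show "?t z = 0" by simp
    qed
  qed auto
  also have "\<dots> = (\<Sum>x\<in>?P. ?t (?g x))" by (rule sum.reindex_cong[OF inj]) auto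
  also have "\<dots> = (\<Sum>x\<in>?P. indicator (A \<times> B) (x, measure \<eta> {x}))"
  proof (rule sum.cong[OF refl])
    fix x assume x: "x \<in> ?P"
    have "atoms \<eta> \<inter> (A \<inter> K \<inter> ?g -` {?g x}) = (if x \<in> A then {x} else {})"
      using x inj unfolding inj_on_def by auto
    then have "measure \<eta> (A \<inter> K \<inter> ?g -` {?g x}) = (if x \<in> A then measure \<eta> {x} else 0)"
      using measure_discrete_finite_atoms[OF \<eta> cell, of "?g x"] by simp
    moreover have "0 < measure \<eta> {x}" using atoms_measure_pos[OF discrete_imp_radon[OF \<eta>]] x by blast
    ultimately show "?t (?g x) = indicator (A \<times> B) (x, measure \<eta> {x})" by (simp add: indicator_def)
  qed
  finally show ?thesis .
qed

lemma borel_measurable_cell_count: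
  fixes K :: "'a::euclidean_space set"
  assumes [measurable]: "K \<in> sets borel" "A \<in> sets borel" "B \<in> sets borel"
  shows "(\<lambda>\<eta>. \<Sum>z\<in>grid_point k ` K. indicator (B \<inter> {0<..}) (measure \<eta> (A \<inter> K \<inter> grid_point k -` {z})) :: real)
    \<in> borel_measurable discrete_radon_space"
proof (intro borel_measurable_sum)
  fix z :: 'a
  have "A \<inter> K \<inter> grid_point k -` {z} \<in> sets borel" using assms grid_cell_borel by blast
  from measure_measurable_discrete[OF this] show
    "(\<lambda>\<eta>. indicator (B \<inter> {0<..}) (measure \<eta> (A \<inter> K \<inter> grid_point k -` {z})) :: real) \<in> borel_measurable discrete_radon_space"
    by measurable
qed

text \<open>The number of cells with positive mass never exceeds the number of atoms in \<open>K\<close>, and it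
  eventually reaches the size of any finite set of atoms. So there are finitely many atoms iff these
  numbers are bounded in \<open>k\<close>.\<close>
lemma sets_finitely_many_atoms_in:
  fixes K :: "'a::euclidean_space set"
  assumes K: "K \<in> sets borel" "bounded K"
  shows "finitely_many_atoms_in K \<in> sets discrete_radon_space"
proof -
  define H where "H k \<eta> = (\<Sum>z\<in>grid_point k ` K. indicator (UNIV \<inter> {0<..}) (measure \<eta> (UNIV \<inter> K \<inter> grid_point k -` {z})) :: real)"
    for k and \<eta> :: "'a measure"
  have [measurable]: "H k \<in> borel_measurable discrete_radon_space" for k
    unfolding H_def using K by (intro borel_measurable_cell_count) auto
  have "{\<eta> \<in> space discrete_radon_space. \<exists>M::nat. \<forall>k. H k \<eta> \<le> real M} \<in> sets discrete_radon_space" by measurable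
  also have "{\<eta> \<in> space discrete_radon_space. \<exists>M::nat. \<forall>k. H k \<eta> \<le> real M} = finitely_many_atoms_in K"
    unfolding finitely_many_atoms_in_def space_discrete_radon_space
  proof (rule Collect_cong, rule conj_cong[OF refl], rule iffI)
    fix \<eta> :: "'a measure" assume \<eta>: "\<eta> \<in> discrete_radon_measures"
    let ?P = "atoms \<eta> \<inter> K" and ?c = "\<lambda>k z. UNIV \<inter> K \<inter> grid_point k -` {z}"
    let ?t = "\<lambda>k z. indicator (UNIV \<inter> {0<..}) (measure \<eta> (?c k z)) :: real"
    have cell: "?c k z \<in> sets borel" for z :: 'a and k
      by (intro sets.Int K grid_cell_borel) simp
    {
      assume "\<exists>M::nat. \<forall>k. H k \<eta> \<le> real M"
      then obtain M :: nat where M: "\<And>k. H k \<eta> \<le> real M" by blast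
      show "finite ?P"
      proof (rule ccontr)
        assume "infinite ?P"
        then obtain S where S: "S \<subseteq> ?P" "finite S" "card S = Suc M" using infinite_arbitrarily_large by blast
        obtain k where k: "inj_on (grid_point k) S"
          using eventually_happens'[OF sequentially_bot eventually_inj_on_grid_point[OF S(2)]] by blast
        have "real (Suc M) = (\<Sum>z\<in>grid_point k ` S. 1)" using S(3) card_image[OF k] by simp
        also have "\<dots> = (\<Sum>z\<in>grid_point k ` S. ?t k z)"
        proof (rule sum.cong[OF refl])
          fix z assume "z \<in> grid_point k ` S"
          then obtain x where x: "x \<in> S" "z = grid_point k x" by blast
          have "0 < measure \<eta> {x}" using atoms_measure_pos[OF discrete_imp_radon[OF \<eta>]] x(1) S(1) by blast
          also have "\<dots> \<le> measure \<eta> (?c k z)"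
          proof (rule measure_mono_fmeasurable)
            show "{x} \<subseteq> ?c k z" using x S(1) by auto
            show "{x} \<in> sets \<eta>" by (simp add: radon_sets[OF discrete_imp_radon[OF \<eta>]])
            show "?c k z \<in> fmeasurable \<eta>"
              using cell radon_finite[OF discrete_imp_radon[OF \<eta>], of "?c k z"] K(2)
              by (intro fmeasurableI) (auto simp: radon_sets[OF discrete_imp_radon[OF \<eta>]] bounded_Int)
          qed
          finally show "1 = ?t k z"
            by simp
        qed
        also have "\<dots> \<le> H k \<eta>" unfolding H_def
          using S(1) by (intro sum_mono2 finite_grid_image[OF K(2)]) auto
        also have "\<dots> \<le> real M" by (rule M)
        finally show False by simp
      qed
    next
      assume fin: "finite ?P"
      have "H k \<eta> \<le> real (card ?P)" for k
      proof -
        have "H k \<eta> = (\<Sum>z\<in>grid_point k ` ?P. ?t k z)"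
          unfolding H_def
        proof (rule sum.mono_neutral_right)
          show "\<forall>z\<in>grid_point k ` K - grid_point k ` ?P. ?t k z = 0"
          proof
            fix z assume "z \<in> grid_point k ` K - grid_point k ` ?P"
            then have "z \<notin> grid_point k ` ?P" by simp
            then have "atoms \<eta> \<inter> (?c k z) = {}" by blast
            from cell_measure_zero[OF \<eta> cell this] show "?t k z = 0" by simp
          qed
        qed (use finite_grid_image[OF K(2)] in auto)
        also have "\<dots> \<le> (\<Sum>z\<in>grid_point k ` ?P. 1)" by (intro sum_mono) (simp add: indicator_def)
        also have "\<dots> \<le> real (card ?P)" using card_image_le[OF fin] by simp
        finally show ?thesis .
      qed
      then show "\<exists>M::nat. \<forall>k. H k \<eta> \<le> real M" by blast
    }
  qed
  finally show ?thesis .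
qed

definition mark_count :: "'a::euclidean_space set \<Rightarrow> ('a \<times> real) set \<Rightarrow> 'a measure \<Rightarrow> real" where
  "mark_count K C \<eta> = (\<Sum>x\<in>atoms \<eta> \<inter> K. indicator C (x, measure \<eta> {x}))"

text \<open>For rectangles the count is a limit of cell counts; the general case is a Dynkin argument, for which
  the counts must be finite.\<close>
lemma mark_count_measurable:
  fixes K :: "'a::euclidean_space set"
  assumes K: "K \<in> sets borel" "bounded K" and C: "C \<in> sets (borel \<Otimes>\<^sub>M borel)"
  shows "mark_count K C \<in> borel_measurable (restrict_space discrete_radon_space (finitely_many_atoms_in K))" (is "_ \<in> borel_measurable ?R")
proof -
  have spR: "space ?R = finitely_many_atoms_in K"
    by (auto simp: space_restrict_space space_discrete_radon_space finitely_many_atoms_in_def)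
  have rect: "mark_count K (A \<times> B) \<in> borel_measurable ?R" if A: "A \<in> sets borel" and B: "B \<in> sets borel" for A B
  proof (rule borel_measurable_LIMSEQ_real)
    show "(\<lambda>\<eta>. \<Sum>z\<in>grid_point k ` K. indicator (B \<inter> {0<..}) (measure \<eta> (A \<inter> K \<inter> grid_point k -` {z})) :: real) \<in> borel_measurable ?R" for k
      by (intro measurable_restrict_space1 borel_measurable_cell_count K A B)
    fix \<eta> assume "\<eta> \<in> space ?R"
    then have "\<eta> \<in> finitely_many_atoms_in K" by (simp only: spR)
    then have \<eta>: "\<eta> \<in> discrete_radon_measures" and fin: "finite (atoms \<eta> \<inter> K)" by (auto simp: finitely_many_atoms_in_def)
    show "(\<lambda>k. \<Sum>z\<in>grid_point k ` K. indicator (B \<inter> {0<..}) (measure \<eta> (A \<inter> K \<inter> grid_point k -` {z})) :: real) \<longlonglongrightarrow> mark_count K (A \<times> B) \<eta>"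
      unfolding mark_count_def
      using eventually_inj_on_grid_point[OF fin]
      by (intro tendsto_eventually) (elim eventually_mono, intro cell_count_eq[OF \<eta> K fin _ A])
  qed
  have C': "C \<in> sigma_sets (space borel \<times> space borel) {a \<times> b | a b. a \<in> sets borel \<and> b \<in> sets borel}"
    using C by (simp add: sets_pair_measure)
  from Int_stable_pair_measure_generator[of borel borel] pair_measure_closed[of borel borel] C'
  show ?thesis
  proof (induction rule: sigma_sets_induct_disjoint)
    case (basic D)
    then show ?case using rect by blast
  next
    case empty
    have "mark_count K {} = (\<lambda>_. 0)" by (auto simp: mark_count_def)
    then show ?case by simp
  next
    case (compl D)
    have "mark_count K (space borel \<times> space borel - D) = (\<lambda>\<eta>. mark_count K (UNIV \<times> UNIV) \<eta> - mark_count K D \<eta>)"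
      unfolding mark_count_def sum_subtractf[symmetric] by (intro ext sum.cong) (auto simp: indicator_def)
    then show ?case using compl(2) rect[of UNIV UNIV] by simp
  next
    case (union D)
    have "(\<lambda>\<eta>. \<Sum>i. mark_count K (D i) \<eta>) \<in> borel_measurable ?R" using union(3) by measurable
    then show ?case
    proof (rule measurable_cong[THEN iffD1, rotated])
      fix \<eta> assume "\<eta> \<in> space ?R"
      have "(\<lambda>i. mark_count K (D i) \<eta>) sums mark_count K (\<Union>(range D)) \<eta>"
        unfolding mark_count_def using union(1) by (intro sums_sum indicator_sums) (auto simp: disjoint_family_on_def)
      then show "(\<Sum>i. mark_count K (D i) \<eta>) = mark_count K (\<Union>(range D)) \<eta>" by (rule sums_unique[symmetric])
    qed
  qed
qed

definition mark_product :: "('a::euclidean_space \<times> real \<Rightarrow> real) \<Rightarrow> 'a set \<Rightarrow> 'a measure \<Rightarrow> real" where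
  "mark_product \<rho> K \<eta> = (\<Prod>x\<in>atoms \<eta> \<inter> K. \<rho> (x, measure \<eta> {x}))"

text \<open>For a simple function the product is \<open>\<Prod>v. v\<^sup>n\<close>, where \<open>n\<close> is the number of atoms at which the value \<open>v\<close> is
  taken. On a finite product pointwise approximation by simple functions is enough. If there are
  infinitely many atoms, the product has the default value 1.\<close>
lemma mark_product_measurable:
  fixes K :: "'a::euclidean_space set"
  assumes K: "K \<in> sets borel" "bounded K" and \<rho>: "\<rho> \<in> borel_measurable (borel \<Otimes>\<^sub>M borel)"
  shows "mark_product \<rho> K \<in> borel_measurable discrete_radon_space"
proof -
  let ?R = "restrict_space discrete_radon_space (finitely_many_atoms_in K)"
  have spR: "space ?R = finitely_many_atoms_in K"
    by (auto simp: space_restrict_space space_discrete_radon_space finitely_many_atoms_in_def)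
  obtain F where F: "\<And>i. simple_function (borel \<Otimes>\<^sub>M borel) (F i)" "\<And>x. (\<lambda>i. F i x) \<longlonglongrightarrow> \<rho> x"
    using borel_measurable_implies_sequence_metric[OF \<rho>, of 0] by (auto simp: space_pair_measure)
  \<comment> \<open>Counts are real-valued here, so the exponent is recovered by rounding.\<close>
  have simple: "mark_product \<sigma> K \<in> borel_measurable ?R" if \<sigma>: "simple_function (borel \<Otimes>\<^sub>M borel) \<sigma>" for \<sigma> :: "'a \<times> real \<Rightarrow> real"
  proof -
    have fin: "finite (range \<sigma>)" using simple_functionD(1)[OF \<sigma>] by (simp add: space_pair_measure)
    have [measurable]: "\<sigma> -` {v} \<in> sets (borel \<Otimes>\<^sub>M borel)" for v
      using simple_functionD(2)[OF \<sigma>, of "{v}"] by (simp add: space_pair_measure)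
    have [measurable]: "mark_count K (\<sigma> -` {v}) \<in> borel_measurable ?R" for v
      by (rule mark_count_measurable[OF K]) measurable
    have [measurable]: "(\<lambda>\<eta>. v ^ nat \<lfloor>mark_count K (\<sigma> -` {v}) \<eta>\<rfloor>) \<in> borel_measurable ?R" for v
      by (rule measurable_compose[of "\<lambda>\<eta>. \<lfloor>mark_count K (\<sigma> -` {v}) \<eta>\<rfloor>" _ "count_space UNIV" "\<lambda>n. v ^ nat n"]) measurable
    have "(\<lambda>\<eta>. \<Prod>v\<in>range \<sigma>. v ^ nat \<lfloor>mark_count K (\<sigma> -` {v}) \<eta>\<rfloor>) \<in> borel_measurable ?R" by measurable
    then show ?thesis
    proof (rule measurable_cong[THEN iffD1, rotated])
      fix \<eta> assume "\<eta> \<in> space ?R"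
      then have "\<eta> \<in> finitely_many_atoms_in K" by (simp only: spR)
      then have P: "finite (atoms \<eta> \<inter> K)" by (auto simp: finitely_many_atoms_in_def)
      have "mark_product \<sigma> K \<eta> = (\<Prod>v\<in>range \<sigma>. \<Prod>x\<in>{x\<in>atoms \<eta> \<inter> K. \<sigma> (x, measure \<eta> {x}) = v}. \<sigma> (x, measure \<eta> {x}))"
        unfolding mark_product_def by (rule prod.group[symmetric, OF P fin]) auto
      also have "\<dots> = (\<Prod>v\<in>range \<sigma>. v ^ nat \<lfloor>mark_count K (\<sigma> -` {v}) \<eta>\<rfloor>)"
      proof (rule prod.cong[OF refl])
        fix v
        have "mark_count K (\<sigma> -` {v}) \<eta> = real (card {x\<in>atoms \<eta> \<inter> K. \<sigma> (x, measure \<eta> {x}) = v})"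
          unfolding mark_count_def using P by (simp add: indicator_def sum.If_cases Int_def conj_ac)
        then show "(\<Prod>x\<in>{x\<in>atoms \<eta> \<inter> K. \<sigma> (x, measure \<eta> {x}) = v}. \<sigma> (x, measure \<eta> {x})) = v ^ nat \<lfloor>mark_count K (\<sigma> -` {v}) \<eta>\<rfloor>"
          by simp
      qed
      finally show "(\<Prod>v\<in>range \<sigma>. v ^ nat \<lfloor>mark_count K (\<sigma> -` {v}) \<eta>\<rfloor>) = mark_product \<sigma> K \<eta>" ..
    qed
  qed
  have R: "mark_product \<rho> K \<in> borel_measurable ?R"
  proof (rule borel_measurable_LIMSEQ_real)
    show "(\<lambda>i. mark_product (F i) K \<eta>) \<longlonglongrightarrow> mark_product \<rho> K \<eta>" for \<eta>
      unfolding mark_product_def by (intro tendsto_prod F(2))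
    show "mark_product (F i) K \<in> borel_measurable ?R" for i by (rule simple[OF F(1)])
  qed
  have "(\<lambda>\<eta>. if \<eta> \<in> finitely_many_atoms_in K then mark_product \<rho> K \<eta> else 1) \<in> borel_measurable discrete_radon_space"
  proof (subst measurable_If_restrict_space_iff)
    have "finitely_many_atoms_in K \<inter> space discrete_radon_space \<in> sets discrete_radon_space"
      using sets_finitely_many_atoms_in[OF K] by (rule sets.Int) simp
    then show "{\<eta> \<in> space discrete_radon_space. \<eta> \<in> finitely_many_atoms_in K} \<in> sets discrete_radon_space"
      by (simp add: Int_def conj_commute)
  qed (use R in simp)
  then show ?thesis
    by (rule measurable_cong[THEN iffD1, rotated])
      (auto simp: space_discrete_radon_space finitely_many_atoms_in_def mark_product_def)
qed

section \<open>Poisson clouds of finite intensity\<close>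

lemma integral_PiM_finite_prod:
  fixes f :: "'i \<Rightarrow> 'b \<Rightarrow> 'c::{real_normed_field,banach,second_countable_topology}"
  assumes M: "\<And>i. prob_space (M i)" and J: "finite J" and f: "\<And>i. i \<in> J \<Longrightarrow> integrable (M i) (f i)"
  shows "integrable (PiM UNIV M) (\<lambda>\<omega>. \<Prod>i\<in>J. f i (\<omega> i))"
    and "(\<integral>\<omega>. (\<Prod>i\<in>J. f i (\<omega> i)) \<partial>PiM UNIV M) = (\<Prod>i\<in>J. \<integral>x. f i x \<partial>M i)"
proof -
  interpret prob_space "M i" for i by (rule M)
  interpret product_prob_space M UNIV ..
  have r: "(\<lambda>\<omega>. restrict \<omega> J) \<in> measurable (PiM UNIV M) (PiM J M)" by (rule measurable_restrict_subset) auto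
  have d: "PiM J M = distr (PiM UNIV M) (PiM J M) (\<lambda>\<omega>. restrict \<omega> J)"
    using distr_PiM_restrict_finite[OF J] by simp
  have int: "integrable (PiM J M) (\<lambda>\<omega>. \<Prod>i\<in>J. f i (\<omega> i))"
    by (rule product_integrable_prod[OF J f])
  have "integrable (PiM UNIV M) (\<lambda>\<omega>. \<Prod>i\<in>J. f i (restrict \<omega> J i))"
    using int by (subst (asm) d, subst (asm) integrable_distr_eq[OF r]) (auto intro: borel_measurable_integrable[OF int])
  then show "integrable (PiM UNIV M) (\<lambda>\<omega>. \<Prod>i\<in>J. f i (\<omega> i))" by simp
  have "(\<integral>\<omega>. (\<Prod>i\<in>J. f i (\<omega> i)) \<partial>PiM J M) = (\<integral>\<omega>. (\<Prod>i\<in>J. f i (restrict \<omega> J i)) \<partial>PiM UNIV M)"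
    by (subst d, rule integral_distr[OF r borel_measurable_integrable[OF int]])
  then show "(\<integral>\<omega>. (\<Prod>i\<in>J. f i (\<omega> i)) \<partial>PiM UNIV M) = (\<Prod>i\<in>J. \<integral>x. f i x \<partial>M i)"
    using product_integral_prod[OF J f] by simp
qed

definition normalized :: "'z measure \<Rightarrow> 'z measure" where
  "normalized M = density M (\<lambda>_. ennreal (1 / measure M (space M)))"

text \<open>A Poisson process with finite intensity \<open>M\<close>: a Poisson number \<open>N\<close> of points with mean the total mass of
  \<open>M\<close>, and independent points with law proportional to \<open>M\<close>. An infinite sequence of points is drawn, of which
  only the first \<open>N\<close> count; so \<open>N\<close> and the points live in a plain product space.\<close>
definition poisson_cloud :: "'z measure \<Rightarrow> (nat \<times> (nat \<Rightarrow> 'z)) measure" where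
  "poisson_cloud M = measure_pmf (poisson_pmf (measure M (space M))) \<Otimes>\<^sub>M (\<Pi>\<^sub>M k\<in>UNIV. normalized M)"

lemma sets_normalized [measurable_cong]: "sets (normalized M) = sets M"
  by (simp add: normalized_def)

lemma space_normalized: "space (normalized M) = space M"
  by (simp add: normalized_def)

lemma space_poisson_cloud: "space (poisson_cloud M) = UNIV \<times> (UNIV \<rightarrow>\<^sub>E space M)"
  by (simp add: poisson_cloud_def space_pair_measure space_PiM space_normalized)

lemma prob_space_normalized:
  assumes "finite_measure M" "0 < measure M (space M)"
  shows "prob_space (normalized M)"
proof (rule prob_spaceI)
  interpret finite_measure M by fact
  have "emeasure (normalized M) (space (normalized M)) = ennreal (1 / measure M (space M)) * emeasure M (space M)"
    unfolding normalized_def by (simp add: emeasure_density_const)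
  also have "\<dots> = 1" using assms(2) by (simp add: emeasure_eq_measure ennreal_mult[symmetric])
  finally show "emeasure (normalized M) (space (normalized M)) = 1" .
qed

lemma prob_space_poisson_cloud:
  assumes "finite_measure M" "0 < measure M (space M)"
  shows "prob_space (poisson_cloud M)"
proof -
  interpret \<nu>: prob_space "normalized M" by (rule prob_space_normalized[OF assms])
  interpret Q: prob_space "\<Pi>\<^sub>M k\<in>(UNIV::nat set). normalized M"
    by (rule prob_space_PiM) (rule \<nu>.prob_space_axioms)
  interpret PP: pair_prob_space "measure_pmf (poisson_pmf (measure M (space M)))" "\<Pi>\<^sub>M k\<in>(UNIV::nat set). normalized M" ..
  show ?thesis unfolding poisson_cloud_def by (rule PP.P.prob_space_axioms)
qed

lemma measurable_poisson_cloud: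
  assumes "\<And>N. (\<lambda>z. f (N, z)) \<in> measurable (\<Pi>\<^sub>M k\<in>UNIV. M) K"
  shows "f \<in> measurable (poisson_cloud M) K"
proof -
  have "(\<lambda>z. f (N, z)) \<in> measurable (\<Pi>\<^sub>M k\<in>UNIV. normalized M) K" for N
    using assms[of N] measurable_cong_sets[OF sets_PiM_cong[OF refl sets_normalized] refl, of UNIV "\<lambda>_. M" K] by blast
  then have "f \<in> measurable (count_space UNIV \<Otimes>\<^sub>M (\<Pi>\<^sub>M k\<in>UNIV. normalized M)) K"
    by (intro measurable_pair_measure_countable1) auto
  then show ?thesis unfolding poisson_cloud_def
    by (subst measurable_cong_sets[OF sets_pair_measure_cong[OF sets_measure_pmf_count_space refl] refl])
qed

text \<open>Given \<open>N\<close> points the expectation is \<open>(a / L) ^ N\<close>, where \<open>a = \<integral>h dM\<close> and \<open>L\<close> is the total mass. Summing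
  over the Poisson distribution gives \<open>exp (a - L)\<close>. Absolute integrability follows from the same
  computation for \<open>|h|\<close>.\<close>
lemma poisson_cloud_prod_expectation:
  fixes h :: "'z \<Rightarrow> complex"
  assumes M: "finite_measure M" and pos: "0 < measure M (space M)" and h: "integrable M h"
  shows "integrable (poisson_cloud M) (\<lambda>p. \<Prod>k<fst p. h (snd p k))"
    and "(\<integral>p. (\<Prod>k<fst p. h (snd p k)) \<partial>poisson_cloud M) = exp (\<integral>z. (h z - 1) \<partial>M)"
proof -
  let ?Q = "\<Pi>\<^sub>M k\<in>(UNIV::nat set). normalized M"
  interpret M: finite_measure M by fact
  define L where "L = measure M (space M)"
  have L: "0 < L" using pos by (simp add: L_def)
  interpret \<nu>: prob_space "normalized M" by (rule prob_space_normalized[OF M pos])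
  interpret P: prob_space ?Q
    by (rule prob_space_PiM) (rule \<nu>.prob_space_axioms)
  interpret PP: pair_prob_space "measure_pmf (poisson_pmf L)" ?Q ..
  have int_norm: "integrable (normalized M) g \<and> (\<integral>z. g z \<partial>normalized M) = (\<integral>z. g z \<partial>M) / complex_of_real L"
    if g: "integrable M g" for g :: "'z \<Rightarrow> complex"
  proof -
    have gm: "g \<in> borel_measurable M" using g by simp
    have "integrable M (\<lambda>z. (1 / L) *\<^sub>R g z)" using g by simp
    then have 1: "integrable (normalized M) g" unfolding normalized_def L_def[symmetric] using L gm
      by (subst integrable_density) auto
    have "(\<integral>z. g z \<partial>normalized M) = (\<integral>z. (1 / L) *\<^sub>R g z \<partial>M)" unfolding normalized_def L_def[symmetric] using L gm
      by (subst integral_density) auto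
    also have "\<dots> = (\<integral>z. g z \<partial>M) / complex_of_real L" by (simp add: scaleR_conv_of_real)
    finally show ?thesis using 1 by simp
  qed
  have pow: "integrable ?Q (\<lambda>z. \<Prod>k<N. g (z k)) \<and>
      (\<integral>z. (\<Prod>k<N. g (z k)) \<partial>?Q) = ((\<integral>z. g z \<partial>M) / complex_of_real L) ^ N"
    if g: "integrable M g" for g :: "'z \<Rightarrow> complex" and N :: nat
    using integral_PiM_finite_prod[of "\<lambda>_. normalized M" "{..<N}" "\<lambda>_. g"] int_norm[OF g] \<nu>.prob_space_axioms by simp
  let ?F = "\<lambda>p. \<Prod>k<fst p. h (snd p k)"
  have meas: "?F \<in> borel_measurable (poisson_cloud M)"
    using h by (intro measurable_poisson_cloud) simp
  have pmf: "pmf (poisson_pmf L) N = L ^ N / fact N * exp (- L)" for N using L by simp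
  have sums: "(\<lambda>N. pmf (poisson_pmf L) N *\<^sub>R (a / complex_of_real L) ^ N) sums exp (a - complex_of_real L)"
    and summable: "summable (\<lambda>N. norm (pmf (poisson_pmf L) N *\<^sub>R (a / complex_of_real L) ^ N))" for a
  proof -
    have eq: "pmf (poisson_pmf L) N *\<^sub>R (a / complex_of_real L) ^ N = exp (- complex_of_real L) * (a ^ N /\<^sub>R fact N)" for N
      using L by (simp add: pmf scaleR_conv_of_real power_divide field_simps flip: exp_of_real)
    show "(\<lambda>N. pmf (poisson_pmf L) N *\<^sub>R (a / complex_of_real L) ^ N) sums exp (a - complex_of_real L)"
      unfolding eq using sums_mult[OF exp_converges[of a], of "exp (- complex_of_real L)"]
      by (simp add: exp_diff exp_minus field_simps)
    show "summable (\<lambda>N. norm (pmf (poisson_pmf L) N *\<^sub>R (a / complex_of_real L) ^ N))"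
      unfolding eq norm_mult by (intro summable_mult summable_norm_exp)
  qed
  have count: "integrable (measure_pmf (poisson_pmf L)) (\<lambda>N. (a / complex_of_real L) ^ N) \<and>
      (\<integral>N. (a / complex_of_real L) ^ N \<partial>measure_pmf (poisson_pmf L)) = exp (a - complex_of_real L)" for a
  proof -
    have i: "integrable (count_space UNIV) (\<lambda>N. pmf (poisson_pmf L) N *\<^sub>R (a / complex_of_real L) ^ N)"
      unfolding integrable_count_space_nat_iff by (rule summable)
    have "(\<integral>N. (a / complex_of_real L) ^ N \<partial>measure_pmf (poisson_pmf L))
      = (\<integral>N. pmf (poisson_pmf L) N *\<^sub>R (a / complex_of_real L) ^ N \<partial>count_space UNIV)"
      unfolding measure_pmf_eq_density by (subst integral_density) auto
    also have "\<dots> = exp (a - complex_of_real L)"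
      using sums_unique2[OF sums_integral_count_space_nat[OF i] sums[of a]] .
    finally show ?thesis using i unfolding measure_pmf_eq_density by (subst integrable_density) auto
  qed
  have "integrable (measure_pmf (poisson_pmf L) \<Otimes>\<^sub>M ?Q) ?F"
  proof (rule PP.Fubini_integrable)
    show "?F \<in> borel_measurable (measure_pmf (poisson_pmf L) \<Otimes>\<^sub>M ?Q)"
      using meas unfolding poisson_cloud_def L_def .
    show "AE N in measure_pmf (poisson_pmf L). integrable ?Q (\<lambda>z. ?F (N, z))"
      using pow[OF h] by simp
    define c where "c = (\<integral>z. norm (h z) \<partial>M)"
    have ic: "integrable M (\<lambda>z. complex_of_real (norm (h z)))" using h by (intro integrable_of_real integrable_norm)
    have "(\<integral>z. norm (?F (N, z)) \<partial>?Q) = (c / L) ^ N" for N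
    proof -
      have "complex_of_real (\<integral>z. norm (?F (N, z)) \<partial>?Q)
        = (\<integral>z. complex_of_real (norm (?F (N, z))) \<partial>?Q)"
        by (rule integral_complex_of_real[symmetric])
      also have "\<dots> = (\<integral>z. (\<Prod>k<N. complex_of_real (norm (h (z k)))) \<partial>?Q)"
        by (rule Bochner_Integration.integral_cong[OF refl]) (simp add: prod_norm[symmetric])
      also have "\<dots> = complex_of_real ((c / L) ^ N)" using pow[OF ic, of N] by (simp add: c_def)
      finally show ?thesis using of_real_eq_iff by blast
    qed
    moreover have "integrable (measure_pmf (poisson_pmf L)) (\<lambda>N. Re ((complex_of_real c / complex_of_real L) ^ N))"
      using count[of "complex_of_real c"] by (intro integrable_Re) blast
    moreover have "Re ((complex_of_real c / complex_of_real L) ^ N) = (c / L) ^ N" for N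
      by (simp flip: of_real_divide of_real_power)
    ultimately show "integrable (measure_pmf (poisson_pmf L)) (\<lambda>N. \<integral>z. norm (?F (N, z)) \<partial>?Q)" by simp
  qed
  then show int: "integrable (poisson_cloud M) ?F" unfolding poisson_cloud_def L_def .
  have "(\<integral>p. ?F p \<partial>poisson_cloud M) = (\<integral>N. (\<integral>z. ?F (N, z) \<partial>?Q) \<partial>measure_pmf (poisson_pmf L))"
    using int unfolding poisson_cloud_def L_def[symmetric] by (rule PP.integral_fst'[symmetric])
  also have "\<dots> = (\<integral>N. ((\<integral>z. h z \<partial>M) / complex_of_real L) ^ N \<partial>measure_pmf (poisson_pmf L))"
    using pow[OF h] by simp
  also have "\<dots> = exp ((\<integral>z. h z \<partial>M) - complex_of_real L)" using count by blast
  also have "(\<integral>z. h z \<partial>M) - complex_of_real L = (\<integral>z. (h z - 1) \<partial>M)"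
    using h by (simp add: L_def scaleR_conv_of_real)
  finally show "(\<integral>p. ?F p \<partial>poisson_cloud M) = exp (\<integral>z. (h z - 1) \<partial>M)" .
qed

text \<open>Two independent points coincide under \<open>g\<close> with probability zero by Fubini, since a fixed value of \<open>g\<close> is
  taken with probability zero.\<close>
lemma poisson_cloud_AE_distinct:
  fixes g :: "'z \<Rightarrow> 'a::euclidean_space"
  assumes M: "finite_measure M" and pos: "0 < measure M (space M)"
    and g [measurable]: "g \<in> borel_measurable M" and diffuse: "\<And>x. emeasure M {z \<in> space M. g z = x} = 0"
  shows "AE p in poisson_cloud M. \<forall>j k. j \<noteq> k \<longrightarrow> g (snd p j) \<noteq> g (snd p k)"
proof -
  let ?Q = "\<Pi>\<^sub>M k\<in>(UNIV::nat set). normalized M"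
  interpret \<nu>: prob_space "normalized M" by (rule prob_space_normalized[OF M pos])
  interpret prod: product_prob_space "\<lambda>_. normalized M" "UNIV :: nat set" ..
  have *: "AE z in ?Q. g (z j) \<noteq> g (z k)" if jk: "j \<noteq> k" for j k :: nat
  proof -
    let ?E = "\<lambda>a b. indicator {0} (dist (g a) (g b)) :: ennreal"
    have [measurable]: "case_prod ?E \<in> borel_measurable (normalized M \<Otimes>\<^sub>M normalized M)" by measurable
    have "(\<integral>\<^sup>+z. ?E (z j) (z k) \<partial>?Q)
      = (\<integral>\<^sup>+z. ?E (z j) (z k) \<partial>distr ?Q (\<Pi>\<^sub>M k\<in>{j,k}. normalized M) (\<lambda>\<omega>. restrict \<omega> {j,k}))"
      by (subst nn_integral_distr) (auto intro!: measurable_restrict_subset)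
    also have "\<dots> = (\<integral>\<^sup>+z. ?E (z j) (z k) \<partial>(\<Pi>\<^sub>M k\<in>{j,k}. normalized M))"
      using prod.distr_PiM_restrict_finite[of "{j,k}"] by simp
    also have "\<dots> = (\<integral>\<^sup>+p. ?E (fst p) (snd p) \<partial>(normalized M \<Otimes>\<^sub>M normalized M))"
      by (rule prod.product_nn_integral_pair[OF _ jk]) measurable
    also have "\<dots> = (\<integral>\<^sup>+a. (\<integral>\<^sup>+b. ?E a b \<partial>normalized M) \<partial>normalized M)"
      by (subst \<nu>.nn_integral_fst[symmetric]) auto
    also have "\<dots> = (\<integral>\<^sup>+a. 0 \<partial>normalized M)"
    proof (rule nn_integral_cong)
      fix a
      have [measurable]: "(\<lambda>b. ?E a b) \<in> borel_measurable M" by measurable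
      have "(\<integral>\<^sup>+b. ?E a b \<partial>normalized M) = ennreal (1 / measure M (space M)) * (\<integral>\<^sup>+b. ?E a b \<partial>M)"
        unfolding normalized_def by (subst nn_integral_density) (auto simp: nn_integral_cmult)
      also have "(\<integral>\<^sup>+b. ?E a b \<partial>M) = (\<integral>\<^sup>+b. indicator {z \<in> space M. g z = g a} b \<partial>M)"
        by (rule nn_integral_cong) (auto simp: indicator_def)
      also have "\<dots> = 0"
      proof (subst nn_integral_indicator)
        have "g -` {g a} \<inter> space M \<in> sets M" by (rule measurable_sets[OF g]) simp
        then show "{z \<in> space M. g z = g a} \<in> sets M" by (simp add: vimage_def Int_def conj_commute)
      qed (rule diffuse)
      finally show "(\<integral>\<^sup>+b. ?E a b \<partial>normalized M) = 0" by simp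
    qed
    finally have "(\<integral>\<^sup>+z. ?E (z j) (z k) \<partial>?Q) = 0" by simp
    then have "AE z in ?Q. ?E (z j) (z k) = 0"
      by (subst (asm) nn_integral_0_iff_AE) auto
    then show ?thesis by eventually_elim (auto simp: indicator_def split: if_splits)
  qed
  have AE: "AE z in ?Q. \<forall>(j::nat) k. j \<noteq> k \<longrightarrow> g (z j) \<noteq> g (z k)"
  proof (intro AE_all_countable[THEN iffD2] allI)
    show "AE z in ?Q. j \<noteq> k \<longrightarrow> g (z j) \<noteq> g (z k)" for j k :: nat
      using *[of j k] by (cases "j = k") auto
  qed
  then obtain N where N: "{z \<in> space ?Q. \<not> (\<forall>j k. j \<noteq> k \<longrightarrow> g (z j) \<noteq> g (z k))} \<subseteq> N"
    "emeasure ?Q N = 0" "N \<in> sets ?Q"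
    by (rule AE_E)
  show ?thesis unfolding poisson_cloud_def
  proof (rule AE_I)
    let ?P = "measure_pmf (poisson_pmf (measure M (space M))) \<Otimes>\<^sub>M ?Q"
    show "emeasure ?P (UNIV \<times> N) = 0" using N(2,3) by (subst prod.P.emeasure_pair_measure_Times) auto
    show "UNIV \<times> N \<in> sets ?P" using N(3) by (intro pair_measureI) auto
    show "{p \<in> space ?P. \<not> (\<forall>j k. j \<noteq> k \<longrightarrow> g (snd p j) \<noteq> g (snd p k))} \<subseteq> UNIV \<times> N"
    proof (rule subsetI)
      fix p assume "p \<in> {p \<in> space ?P. \<not> (\<forall>j k. j \<noteq> k \<longrightarrow> g (snd p j) \<noteq> g (snd p k))}"
      then have "snd p \<in> {z \<in> space ?Q. \<not> (\<forall>j k. j \<noteq> k \<longrightarrow> g (z j) \<noteq> g (z k))}"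
        by (simp add: space_pair_measure mem_Times_iff)
      with N(1) have "snd p \<in> N" by (rule subsetD)
      then show "p \<in> UNIV \<times> N" by (simp add: mem_Times_iff)
    qed
  qed
qed

section \<open>The Poisson random measure of a locally finite intensity\<close>

definition shell :: "nat \<Rightarrow> 'a::euclidean_space set" where
  "shell n = {x. real n \<le> norm x \<and> norm x < real n + 1}"

lemma shell_borel [measurable]: "shell n \<in> sets borel"
  unfolding shell_def by measurable

lemma bounded_shell: "bounded (shell n)"
  by (rule bounded_subset[OF bounded_ball[of 0 "real n + 1"]]) (auto simp: shell_def)

lemma shell_unique: "x \<in> shell n \<Longrightarrow> x \<in> shell k \<Longrightarrow> n = k"
  by (auto simp: shell_def)

lemma sum_indicator_shell:
  "(\<Sum>n<n0. indicator (shell n \<times> S) (x, s)) = (if norm x < real n0 \<and> s \<in> S then 1 else 0 :: real)"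
proof -
  define j where "j = nat \<lfloor>norm x\<rfloor>"
  have j: "x \<in> shell n \<longleftrightarrow> n = j" for n
    unfolding shell_def j_def by (auto simp: nat_eq_iff floor_eq_iff) linarith+
  have "norm x < real n0 \<longleftrightarrow> j < n0" unfolding j_def by (auto simp: nat_less_iff floor_less_iff)
  moreover have "(\<Sum>n<n0. indicator (shell n \<times> S) (x, s) :: real) = (\<Sum>n<n0. if n = j then indicator S s else 0)"
    by (intro sum.cong) (auto simp: indicator_def j)
  ultimately show ?thesis by (simp add: indicator_def)
qed

text \<open>Here \<open>m\<close> is finite over bounded sets of positions, so it is the sum of its restrictions to the cylinders
  over the shells, each of which carries a Poisson cloud. A cloud needs positive mass, hence
  \<open>shell_charged\<close>; \<open>diffuse\<close> ensures that the points have distinct positions.\<close>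
locale locally_finite_intensity =
  fixes m :: "('a::euclidean_space \<times> real) measure"
  assumes sets_m: "sets m = sets (borel \<Otimes>\<^sub>M restrict_space borel {0<..})"
    and finite_bounded: "\<And>A. A \<in> sets borel \<Longrightarrow> bounded A \<Longrightarrow> emeasure m (A \<times> {0<..}) < \<infinity>"
    and shell_charged: "\<And>n. 0 < emeasure m (shell n \<times> {0<..})"
    and diffuse: "\<And>x. emeasure m ({x} \<times> {0<..}) = 0"
begin

lemma space_m: "space m = UNIV \<times> {0<..}"
  using sets_eq_imp_space_eq[OF sets_m] by (simp add: space_pair_measure space_restrict_space)

lemma cylinder_sets: "A \<in> sets borel \<Longrightarrow> A \<times> {0<..} \<in> sets m"
  unfolding sets_m by (intro pair_measureI) (auto simp: sets_restrict_space)

definition shell_part :: "nat \<Rightarrow> ('a \<times> real) measure" where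
  "shell_part n = restrict_space m (shell n \<times> {0<..})"

lemma space_part: "space (shell_part n) = shell n \<times> {0<..}"
  by (auto simp: shell_part_def space_restrict_space space_m)

lemma shell_cylinder: "shell n \<times> {0<..} \<inter> space m \<in> sets m"
  using cylinder_sets[OF shell_borel] by (simp add: space_m Int_absorb2 Sigma_mono)

lemma emeasure_part: "emeasure (shell_part n) (space (shell_part n)) = emeasure m (shell n \<times> {0<..})"
  unfolding shell_part_def by (subst emeasure_restrict_space[OF shell_cylinder]) (auto simp: space_restrict_space space_m Int_absorb2 Sigma_mono)

lemma finite_part: "finite_measure (shell_part n)"
  by (rule finite_measureI) (use finite_bounded[OF shell_borel bounded_shell, of n] in \<open>simp add: emeasure_part\<close>)

lemma part_pos: "0 < measure (shell_part n) (space (shell_part n))"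
  using shell_charged[of n] finite_bounded[OF shell_borel bounded_shell, of n]
  by (simp add: measure_def emeasure_part enn2real_positive_iff)

lemma part_measurable: "f \<in> measurable m K \<Longrightarrow> f \<in> measurable (shell_part n) K"
  unfolding shell_part_def by (rule measurable_restrict_space1)

lemma fst_measurable: "fst \<in> borel_measurable m"
  using measurable_fst[of borel "restrict_space borel {0<..} :: real measure"] measurable_cong_sets[OF sets_m refl] by blast

lemma snd_measurable: "snd \<in> borel_measurable m"
proof -
  have "(\<lambda>z. snd z) \<in> borel_measurable (borel \<Otimes>\<^sub>M (restrict_space borel {0<..} :: real measure))"
    by (rule measurable_compose[OF measurable_snd]) (simp add: measurable_restrict_space1)
  then show ?thesis using measurable_cong_sets[OF sets_m refl] by blast
qed

definition clouds :: "(nat \<Rightarrow> nat \<times> (nat \<Rightarrow> 'a \<times> real)) measure" where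
  "clouds = (\<Pi>\<^sub>M n\<in>UNIV. poisson_cloud (shell_part n))"

lemma prob_cloud: "prob_space (poisson_cloud (shell_part n))"
  by (rule prob_space_poisson_cloud[OF finite_part part_pos])

lemma prob_clouds: "prob_space clouds"
  unfolding clouds_def by (rule prob_space_PiM[OF prob_cloud])

definition point :: "(nat \<Rightarrow> nat \<times> (nat \<Rightarrow> 'a \<times> real)) \<Rightarrow> nat \<times> nat \<Rightarrow> 'a \<times> real" where
  "point \<omega> i = snd (\<omega> (fst i)) (snd i)"

definition indices :: "(nat \<Rightarrow> nat \<times> (nat \<Rightarrow> 'a \<times> real)) \<Rightarrow> (nat \<times> nat) set" where
  "indices \<omega> = (SIGMA n:UNIV. {..<fst (\<omega> n)})"

text \<open>The sum of the point masses \<open>s \<delta>\<^sub>x\<close> over all points \<open>(x, s)\<close> of the clouds, written as an image of a weighted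
  counting measure. Coinciding positions do no harm, their masses add up.\<close>
definition random_measure :: "(nat \<Rightarrow> nat \<times> (nat \<Rightarrow> 'a \<times> real)) \<Rightarrow> 'a measure" where
  "random_measure \<omega> = distr (density (count_space (indices \<omega>)) (\<lambda>i. ennreal (snd (point \<omega> i)))) borel (\<lambda>i. fst (point \<omega> i))"

abbreviation cloud_prod :: "nat \<Rightarrow> ('a \<times> real \<Rightarrow> 'c) \<Rightarrow> (nat \<Rightarrow> nat \<times> (nat \<Rightarrow> 'a \<times> real)) \<Rightarrow> 'c::comm_monoid_mult"
  where "cloud_prod n0 h \<omega> \<equiv> (\<Prod>n<n0. \<Prod>k<fst (\<omega> n). h (snd (\<omega> n) k))"

lemma point_in_shell:
  assumes "\<omega> \<in> space clouds"
  shows "fst (point \<omega> (n, k)) \<in> shell n" "0 < snd (point \<omega> (n, k))"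
proof -
  have "\<omega> n \<in> UNIV \<times> (UNIV \<rightarrow>\<^sub>E shell n \<times> {0<..})"
    using assms by (auto simp: clouds_def space_PiM space_poisson_cloud space_part)
  then have "snd (\<omega> n) k \<in> shell n \<times> {0<..}" by (auto simp: PiE_iff)
  then show "fst (point \<omega> (n, k)) \<in> shell n" "0 < snd (point \<omega> (n, k))" by (auto simp: point_def)
qed

lemma sets_random_measure [simp]: "sets (random_measure \<omega>) = sets borel"
  by (simp add: random_measure_def)

lemma emeasure_random_measure:
  assumes "B \<in> sets borel"
  shows "emeasure (random_measure \<omega>) B = (\<integral>\<^sup>+i. ennreal (snd (point \<omega> i)) * indicator B (fst (point \<omega> i)) \<partial>count_space (indices \<omega>))"
proof -
  have "emeasure (random_measure \<omega>) B = emeasure (density (count_space (indices \<omega>)) (\<lambda>i. ennreal (snd (point \<omega> i)))) ((\<lambda>i. fst (point \<omega> i)) -` B \<inter> indices \<omega>)"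
    unfolding random_measure_def using assms by (subst emeasure_distr) auto
  also have "\<dots> = (\<integral>\<^sup>+i. ennreal (snd (point \<omega> i)) * indicator ((\<lambda>i. fst (point \<omega> i)) -` B \<inter> indices \<omega>) i \<partial>count_space (indices \<omega>))"
    by (subst emeasure_density) auto
  also have "\<dots> = (\<integral>\<^sup>+i. ennreal (snd (point \<omega> i)) * indicator B (fst (point \<omega> i)) \<partial>count_space (indices \<omega>))"
    by (rule nn_integral_cong) (auto simp: indicator_def)
  finally show ?thesis .
qed

text \<open>The indices of the points with \<open>norm x < n0\<close>: finitely many, and all that matter for a function or a
  set supported in the ball of radius \<open>n0\<close>.\<close>
definition indices_below :: "nat \<Rightarrow> (nat \<Rightarrow> nat \<times> (nat \<Rightarrow> 'a \<times> real)) \<Rightarrow> (nat \<times> nat) set" where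
  "indices_below n0 \<omega> = (SIGMA n:{..<n0}. {..<fst (\<omega> n)})"

lemma finite_indices_below: "finite (indices_below n0 \<omega>)" by (simp add: indices_below_def)

lemma indices_below_subset: "indices_below n0 \<omega> \<subseteq> indices \<omega>" by (auto simp: indices_below_def indices_def)

lemma norm_less_indices_below:
  assumes "\<omega> \<in> space clouds" "i \<in> indices \<omega>" "norm (fst (point \<omega> i)) < real n0"
  shows "i \<in> indices_below n0 \<omega>"
  using point_in_shell(1)[OF assms(1), of "fst i" "snd i"] assms(2,3)
  by (auto simp: indices_def indices_below_def shell_def)

lemma emeasure_random_measure_bounded:
  assumes \<omega>: "\<omega> \<in> space clouds" and B: "B \<in> sets borel" "\<And>x. x \<in> B \<Longrightarrow> norm x < real n0"
  shows "emeasure (random_measure \<omega>) B = (\<Sum>i\<in>indices_below n0 \<omega>. ennreal (snd (point \<omega> i)) * indicator B (fst (point \<omega> i)))"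
  unfolding emeasure_random_measure[OF B(1)]
proof (rule nn_integral_count_space'[OF finite_indices_below _ indices_below_subset])
  fix i assume "i \<in> indices \<omega>" "i \<notin> indices_below n0 \<omega>"
  then have "fst (point \<omega> i) \<notin> B" using norm_less_indices_below[OF \<omega>] B(2) by blast
  then show "ennreal (snd (point \<omega> i)) * indicator B (fst (point \<omega> i)) = 0" by simp
qed

lemma random_measure_radon:
  assumes \<omega>: "\<omega> \<in> space clouds"
  shows "random_measure \<omega> \<in> radon_measures"
  unfolding radon_measures_def
proof (intro CollectI conjI allI impI)
  fix K :: "'a set" assume K: "compact K"
  obtain r where r: "\<And>x. x \<in> K \<Longrightarrow> norm x \<le> r" using compact_imp_bounded[OF K] unfolding bounded_iff by blast
  obtain n0 :: nat where "r < real n0" using reals_Archimedean2 by blast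
  then have "emeasure (random_measure \<omega>) K = (\<Sum>i\<in>indices_below n0 \<omega>. ennreal (snd (point \<omega> i)) * indicator K (fst (point \<omega> i)))"
    using K r by (intro emeasure_random_measure_bounded[OF \<omega>] borel_compact) force+
  also have "\<dots> < \<infinity>"
    by (auto simp: finite_indices_below indicator_def)
  finally show "emeasure (random_measure \<omega>) K < \<infinity>" .
qed simp

lemma random_measure_discrete:
  assumes \<omega>: "\<omega> \<in> space clouds"
  shows "random_measure \<omega> \<in> discrete_radon_measures"
proof (rule discrete_radon_measuresI[OF random_measure_radon[OF \<omega>]])
  let ?A = "(\<lambda>i. fst (point \<omega> i)) ` indices \<omega>"
  show "countable ?A" by simp
  then have "?A \<in> sets borel" by (rule sets.countable[rotated]) simp
  then have "emeasure (random_measure \<omega>) (- ?A) = (\<integral>\<^sup>+i. ennreal (snd (point \<omega> i)) * indicator (- ?A) (fst (point \<omega> i)) \<partial>count_space (indices \<omega>))"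
    by (intro emeasure_random_measure) (simp add: borel_comp)
  also have "\<dots> = (\<integral>\<^sup>+i. 0 \<partial>count_space (indices \<omega>))"
    by (rule nn_integral_cong) simp
  finally show "emeasure (random_measure \<omega>) (- ?A) = 0" by simp
qed

lemma integral_random_measure:
  assumes \<omega>: "\<omega> \<in> space clouds" and f: "f \<in> borel_measurable borel" "\<And>x. real n0 \<le> norm x \<Longrightarrow> f x = (0::real)"
  shows "(\<integral>x. f x \<partial>random_measure \<omega>) = (\<Sum>n<n0. \<Sum>k<fst (\<omega> n). snd (snd (\<omega> n) k) * f (fst (snd (\<omega> n) k)))"
proof -
  have pos: "AE i in count_space (indices \<omega>). 0 \<le> snd (point \<omega> i)"
    using point_in_shell(2)[OF \<omega>, of "fst i" "snd i" for i] by (auto simp: AE_count_space less_imp_le)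
  have "(\<integral>x. f x \<partial>random_measure \<omega>) = (\<integral>i. f (fst (point \<omega> i)) \<partial>density (count_space (indices \<omega>)) (\<lambda>i. ennreal (snd (point \<omega> i))))"
    unfolding random_measure_def using f(1) by (subst integral_distr) auto
  also have "\<dots> = (\<integral>i. snd (point \<omega> i) *\<^sub>R f (fst (point \<omega> i)) \<partial>count_space (indices \<omega>))"
    using pos by (subst integral_density) auto
  also have "\<dots> = (\<Sum>i\<in>indices_below n0 \<omega>. snd (point \<omega> i) *\<^sub>R f (fst (point \<omega> i)))"
  proof -
    have sub: "{i \<in> indices \<omega>. snd (point \<omega> i) *\<^sub>R f (fst (point \<omega> i)) \<noteq> 0} \<subseteq> indices_below n0 \<omega>"
    proof clarify
      fix a b assume "(a, b) \<in> indices \<omega>" "snd (point \<omega> (a, b)) *\<^sub>R f (fst (point \<omega> (a, b))) \<noteq> 0"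
      then show "(a, b) \<in> indices_below n0 \<omega>"
        using norm_less_indices_below[OF \<omega>, of "(a, b)" n0] f(2)[of "fst (point \<omega> (a, b))"] by (cases "real n0 \<le> norm (fst (point \<omega> (a, b)))") auto
    qed
    have "(\<integral>i. snd (point \<omega> i) *\<^sub>R f (fst (point \<omega> i)) \<partial>count_space (indices \<omega>))
      = (\<Sum>i | i \<in> indices \<omega> \<and> snd (point \<omega> i) *\<^sub>R f (fst (point \<omega> i)) \<noteq> 0. snd (point \<omega> i) *\<^sub>R f (fst (point \<omega> i)))"
      using finite_subset[OF sub finite_indices_below] by (intro lebesgue_integral_count_space_finite_support) simp
    also have "\<dots> = (\<Sum>i\<in>indices_below n0 \<omega>. snd (point \<omega> i) *\<^sub>R f (fst (point \<omega> i)))"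
      using sub indices_below_subset by (intro sum.mono_neutral_left finite_indices_below) auto
    finally show ?thesis .
  qed
  also have "\<dots> = (\<Sum>n<n0. \<Sum>k<fst (\<omega> n). snd (snd (\<omega> n) k) * f (fst (snd (\<omega> n) k)))"
    unfolding indices_below_def point_def by (subst sum.Sigma) (auto simp: case_prod_beta)
  finally show ?thesis .
qed

lemma cloud_component_measurable:
  assumes "f \<in> measurable (poisson_cloud (shell_part n)) K"
  shows "(\<lambda>\<omega>. f (\<omega> n)) \<in> measurable clouds K"
  unfolding clouds_def
  by (rule measurable_compose[of "\<lambda>\<omega>. \<omega> n" _ "poisson_cloud (shell_part n)" f K, OF _ assms]) (rule measurable_component_singleton, simp)

lemma random_measure_measurable: "random_measure \<in> measurable clouds discrete_radon_space"
proof (rule measurable_discrete_radon_spaceI[OF random_measure_discrete])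
  fix f :: "'a \<Rightarrow> real" assume f: "compactly_supported_continuous f"
  obtain n0 where n0: "\<And>x. real n0 \<le> norm x \<Longrightarrow> f x = 0" using csc_bounded_support[OF f] by metis
  have "(\<lambda>p. \<Sum>k<fst p. snd (snd p k) * f (fst (snd p k))) \<in> borel_measurable (poisson_cloud (shell_part n))" for n
  proof (rule measurable_poisson_cloud)
    fix N :: nat
    note [measurable] = part_measurable[OF fst_measurable, of n] part_measurable[OF snd_measurable, of n] csc_borel_measurable[OF f]
    show "(\<lambda>z. \<Sum>k<fst (N, z). snd (snd (N, z) k) * f (fst (snd (N, z) k))) \<in> borel_measurable (\<Pi>\<^sub>M k\<in>UNIV. shell_part n)"
      by simp
  qed
  then have "(\<lambda>\<omega>. \<Sum>n<n0. \<Sum>k<fst (\<omega> n). snd (snd (\<omega> n) k) * f (fst (snd (\<omega> n) k))) \<in> borel_measurable clouds"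
    by (intro borel_measurable_sum cloud_component_measurable[where f="\<lambda>p. \<Sum>k<fst p. snd (snd p k) * f (fst (snd p k))"])
  then show "(\<lambda>\<omega>. \<integral>x. f x \<partial>random_measure \<omega>) \<in> borel_measurable clouds"
    by (rule measurable_cong[THEN iffD1, rotated])
      (rule integral_random_measure[OF _ csc_borel_measurable[OF f] n0, symmetric])
qed

text \<open>By independence the expectation is a product over the shells, which turns the exponents into a sum;
  only finitely many shells meet the region where \<open>h\<close> differs from 1.\<close>
lemma clouds_prod_expectation:
  fixes h :: "'a \<times> real \<Rightarrow> complex"
  assumes h: "integrable m (\<lambda>z. h z - 1)" and one: "\<And>x s. real n0 \<le> norm x \<Longrightarrow> h (x, s) = 1"
  shows "integrable clouds (cloud_prod n0 h)"
    and "(\<integral>\<omega>. cloud_prod n0 h \<omega> \<partial>clouds) = exp (\<integral>z. (h z - 1) \<partial>m)"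
proof -
  have hp1: "integrable (shell_part n) (\<lambda>z. h z - 1)" for n
    unfolding shell_part_def integrable_restrict_space[OF shell_cylinder]
    using h cylinder_sets[OF shell_borel] by (intro integrable_mult_indicator)
  have hp: "integrable (shell_part n) h" for n
  proof -
    interpret finite_measure "shell_part n" by (rule finite_part)
    have "integrable (shell_part n) (\<lambda>z. (h z - 1) + 1)" by (intro Bochner_Integration.integrable_add hp1) simp
    then show ?thesis by simp
  qed
  have h1: "h \<in> borel_measurable m"
  proof -
    have "(\<lambda>z. (h z - 1) + 1) \<in> borel_measurable m" using h by (intro borel_measurable_add) auto
    then show ?thesis by simp
  qed
  note cloud = poisson_cloud_prod_expectation[OF finite_part part_pos hp]
  note prod = integral_PiM_finite_prod[where J="{..<n0}" and f="\<lambda>_ p. \<Prod>k<fst p. h (snd p k)", OF prob_cloud finite_lessThan cloud(1)]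
  show "integrable clouds (cloud_prod n0 h)"
    using prod(1) unfolding clouds_def .
  have "(\<integral>\<omega>. cloud_prod n0 h \<omega> \<partial>clouds) = (\<Prod>n<n0. exp (\<integral>z. (h z - 1) \<partial>shell_part n))"
    using prod(2) unfolding clouds_def cloud(2) .
  also have "\<dots> = exp (\<Sum>n<n0. \<integral>z. (h z - 1) \<partial>shell_part n)" by (simp add: exp_sum)
  also have "(\<Sum>n<n0. \<integral>z. (h z - 1) \<partial>shell_part n) = (\<Sum>n<n0. \<integral>z. indicator (shell n \<times> {0<..}) z *\<^sub>R (h z - 1) \<partial>m)"
    unfolding shell_part_def integral_restrict_space[OF shell_cylinder] ..
  also have "\<dots> = (\<integral>z. (\<Sum>n<n0. indicator (shell n \<times> {0<..}) z *\<^sub>R (h z - 1)) \<partial>m)"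
    using h cylinder_sets[OF shell_borel] by (intro Bochner_Integration.integral_sum[symmetric] integrable_mult_indicator)
  also have "\<dots> = (\<integral>z. (h z - 1) \<partial>m)"
  proof (rule Bochner_Integration.integral_cong[OF refl])
    fix z assume z: "z \<in> space m"
    obtain x s where xs: "z = (x, s)" by (cases z)
    have "(\<Sum>n<n0. indicator (shell n \<times> {0<..}) z *\<^sub>R (h z - 1)) = (\<Sum>n<n0. indicator (shell n \<times> {0<..}) (x, s)) *\<^sub>R (h z - 1)"
      unfolding xs by (rule scaleR_sum_left[symmetric])
    also have "\<dots> = h z - 1"
      unfolding sum_indicator_shell using z one[of x s] by (auto simp: xs space_m not_less)
    finally show "(\<Sum>n<n0. indicator (shell n \<times> {0<..}) z *\<^sub>R (h z - 1)) = h z - 1" .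
  qed
  finally show "(\<integral>\<omega>. cloud_prod n0 h \<omega> \<partial>clouds) = exp (\<integral>z. (h z - 1) \<partial>m)" .
qed

lemma AE_positions_distinct:
  "AE \<omega> in clouds. inj_on (\<lambda>i. fst (point \<omega> i)) (indices \<omega>)"
proof -
  have "AE p in poisson_cloud (shell_part n). \<forall>j k. j \<noteq> k \<longrightarrow> fst (snd p j) \<noteq> fst (snd p k)" for n
  proof (rule poisson_cloud_AE_distinct[OF finite_part part_pos part_measurable[OF fst_measurable]])
    fix x
    have "emeasure (shell_part n) {z \<in> space (shell_part n). fst z = x} = emeasure m {z \<in> space (shell_part n). fst z = x}"
      unfolding shell_part_def by (rule emeasure_restrict_space[OF shell_cylinder]) (auto simp: space_restrict_space)
    also have "\<dots> \<le> emeasure m ({x} \<times> {0<..})"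
      by (rule emeasure_mono) (auto simp: space_part cylinder_sets)
    finally show "emeasure (shell_part n) {z \<in> space (shell_part n). fst z = x} = 0" by (simp add: diffuse)
  qed
  then have "AE \<omega> in clouds. \<forall>j k. j \<noteq> k \<longrightarrow> fst (snd (\<omega> n) j) \<noteq> fst (snd (\<omega> n) k)" for n
    unfolding clouds_def by (intro AE_PiM_component[OF prob_cloud]) simp
  then have "AE \<omega> in clouds. \<forall>n. \<forall>j k. j \<noteq> k \<longrightarrow> fst (snd (\<omega> n) j) \<noteq> fst (snd (\<omega> n) k)"
    by (rule AE_all_countable[THEN iffD2, OF allI])
  with AE_space show ?thesis
  proof eventually_elim
    fix \<omega> assume \<omega>: "\<omega> \<in> space clouds"
      and dist: "\<forall>n. \<forall>j k. j \<noteq> k \<longrightarrow> fst (snd (\<omega> n) j) \<noteq> fst (snd (\<omega> n) k)"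
    show "inj_on (\<lambda>i. fst (point \<omega> i)) (indices \<omega>)"
    proof (rule inj_onI)
      fix i j assume eq: "fst (point \<omega> i) = fst (point \<omega> j)"
      have "fst i = fst j"
        using point_in_shell(1)[OF \<omega>, of "fst i" "snd i"] point_in_shell(1)[OF \<omega>, of "fst j" "snd j"] eq
        by (intro shell_unique[of "fst (point \<omega> i)"]) auto
      with eq dist show "i = j" unfolding point_def by (metis prod.collapse)
    qed
  qed
qed

lemma measure_random_measure_singleton:
  assumes \<omega>: "\<omega> \<in> space clouds" and inj: "inj_on (\<lambda>i. fst (point \<omega> i)) (indices \<omega>)" and i: "i \<in> indices \<omega>"
  shows "emeasure (random_measure \<omega>) {fst (point \<omega> i)} = ennreal (snd (point \<omega> i))"
proof -
  have "emeasure (random_measure \<omega>) {fst (point \<omega> i)}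
    = (\<integral>\<^sup>+j. ennreal (snd (point \<omega> j)) * indicator {fst (point \<omega> i)} (fst (point \<omega> j)) \<partial>count_space (indices \<omega>))"
    by (rule emeasure_random_measure) simp
  also have "\<dots> = (\<Sum>j\<in>{i}. ennreal (snd (point \<omega> j)) * indicator {fst (point \<omega> i)} (fst (point \<omega> j)))"
    using i inj by (intro nn_integral_count_space') (auto simp: inj_on_def indicator_def)
  finally show ?thesis by simp
qed

lemma atoms_random_measure:
  assumes \<omega>: "\<omega> \<in> space clouds" and inj: "inj_on (\<lambda>i. fst (point \<omega> i)) (indices \<omega>)"
  shows "atoms (random_measure \<omega>) = (\<lambda>i. fst (point \<omega> i)) ` indices \<omega>"
proof (rule set_eqI)
  fix x
  show "x \<in> atoms (random_measure \<omega>) \<longleftrightarrow> x \<in> (\<lambda>i. fst (point \<omega> i)) ` indices \<omega>"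
  proof
    assume "x \<in> (\<lambda>i. fst (point \<omega> i)) ` indices \<omega>"
    then obtain i where i: "i \<in> indices \<omega>" "x = fst (point \<omega> i)" by blast
    then show "x \<in> atoms (random_measure \<omega>)"
      using measure_random_measure_singleton[OF \<omega> inj i(1)] point_in_shell(2)[OF \<omega>, of "fst i" "snd i"] by (simp add: atoms_def)
  next
    assume "x \<in> atoms (random_measure \<omega>)"
    show "x \<in> (\<lambda>i. fst (point \<omega> i)) ` indices \<omega>"
    proof (rule ccontr)
      assume "x \<notin> (\<lambda>i. fst (point \<omega> i)) ` indices \<omega>"
      then have "(\<integral>\<^sup>+i. ennreal (snd (point \<omega> i)) * indicator {x} (fst (point \<omega> i)) \<partial>count_space (indices \<omega>)) = (\<integral>\<^sup>+i. 0 \<partial>count_space (indices \<omega>))"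
        by (intro nn_integral_cong) (auto simp: indicator_def)
      then have "emeasure (random_measure \<omega>) {x} = 0" by (simp add: emeasure_random_measure)
      with \<open>x \<in> atoms (random_measure \<omega>)\<close> show False by (simp add: atoms_def)
    qed
  qed
qed

text \<open>When positions are distinct, the atoms of the random measure and their masses are exactly the points of
  the clouds, so a product over atoms is a product over points. Factors outside \<open>K\<close> are 1.\<close>
lemma mark_product_random_measure:
  assumes \<omega>: "\<omega> \<in> space clouds" and inj: "inj_on (\<lambda>i. fst (point \<omega> i)) (indices \<omega>)"
    and K: "\<And>x. x \<in> K \<Longrightarrow> norm x < real n0" and one: "\<And>x s. x \<notin> K \<Longrightarrow> \<rho> (x, s) = 1"
  shows "mark_product \<rho> K (random_measure \<omega>) = cloud_prod n0 \<rho> \<omega>"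
proof -
  let ?J = "{i \<in> indices_below n0 \<omega>. fst (point \<omega> i) \<in> K}" and ?x = "\<lambda>i. fst (point \<omega> i)"
  have "atoms (random_measure \<omega>) \<inter> K = ?x ` ?J"
    unfolding atoms_random_measure[OF \<omega> inj] using norm_less_indices_below[OF \<omega>] K indices_below_subset by blast
  then have "mark_product \<rho> K (random_measure \<omega>) = (\<Prod>x\<in>?x ` ?J. \<rho> (x, measure (random_measure \<omega>) {x}))"
    by (simp add: mark_product_def)
  also have "\<dots> = (\<Prod>i\<in>?J. \<rho> (?x i, measure (random_measure \<omega>) {?x i}))"
    using indices_below_subset by (intro prod.reindex_cong[OF inj_on_subset[OF inj]]) auto
  also have "\<dots> = (\<Prod>i\<in>?J. \<rho> (point \<omega> i))"
  proof (rule prod.cong[OF refl])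
    fix i assume "i \<in> ?J"
    then have "i \<in> indices \<omega>" using indices_below_subset by blast
    then have "measure (random_measure \<omega>) {?x i} = snd (point \<omega> i)"
      using measure_random_measure_singleton[OF \<omega> inj] point_in_shell(2)[OF \<omega>, of "fst i" "snd i"] by (simp add: measure_def less_imp_le)
    then show "\<rho> (?x i, measure (random_measure \<omega>) {?x i}) = \<rho> (point \<omega> i)" by simp
  qed
  also have "\<dots> = (\<Prod>i\<in>indices_below n0 \<omega>. \<rho> (point \<omega> i))"
  proof (rule prod.mono_neutral_left[OF finite_indices_below])
    show "\<forall>i\<in>indices_below n0 \<omega> - ?J. \<rho> (point \<omega> i) = 1"
    proof
      fix i assume "i \<in> indices_below n0 \<omega> - ?J"
      then have "fst (point \<omega> i) \<notin> K" by blast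
      from one[OF this, of "snd (point \<omega> i)"] show "\<rho> (point \<omega> i) = 1" by simp
    qed
  qed blast
  also have "\<dots> = cloud_prod n0 \<rho> \<omega>"
    unfolding indices_below_def point_def by (subst prod.Sigma) (auto simp: case_prod_beta)
  finally show ?thesis .
qed

definition law :: "'a measure measure" where
  "law = distr clouds discrete_radon_space random_measure"

lemma sets_law: "sets law = sets discrete_radon_space" by (simp add: law_def)

lemma prob_law: "prob_space law"
  unfolding law_def by (rule prob_space.prob_space_distr[OF prob_clouds random_measure_measurable])

text \<open>Both factors of the integrand are products over the points, of \<open>\<rho>(x, s)\<close> and of \<open>exp (i s f(x))\<close>.\<close>
theorem law_weighted_fourier:
  assumes f: "compactly_supported_continuous f"
    and K: "K \<in> sets borel" "bounded K" and \<rho>: "\<rho> \<in> borel_measurable (borel \<Otimes>\<^sub>M borel)"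
    and one: "\<And>x s. x \<notin> K \<Longrightarrow> \<rho> (x, s) = 1"
    and int: "integrable m (\<lambda>(x, s). complex_of_real (\<rho> (x, s)) * iexp (s * f x) - 1)"
  shows "integrable law (\<lambda>\<eta>. complex_of_real (mark_product \<rho> K \<eta>) * iexp (\<integral>x. f x \<partial>\<eta>))"
    and "(\<integral>\<eta>. complex_of_real (mark_product \<rho> K \<eta>) * iexp (\<integral>x. f x \<partial>\<eta>) \<partial>law)
      = exp (\<integral>(x, s). complex_of_real (\<rho> (x, s)) * iexp (s * f x) - 1 \<partial>m)"
proof -
  obtain n1 where n1: "\<And>x. real n1 \<le> norm x \<Longrightarrow> f x = 0" using csc_bounded_support[OF f] by metis
  obtain r where r: "\<And>x. x \<in> K \<Longrightarrow> norm x \<le> r" using K(2) unfolding bounded_iff by blast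
  obtain n2 :: nat where n2: "r < real n2" using reals_Archimedean2 by blast
  define n0 where "n0 = max n1 n2"
  have f0: "f x = 0" if "real n0 \<le> norm x" for x using that by (intro n1) (simp add: n0_def)
  have K0: "norm x < real n0" if "x \<in> K" for x using r[OF that] n2 by (simp add: n0_def)
  define h where "h z = complex_of_real (\<rho> z) * iexp (snd z * f (fst z))" for z
  have h_int: "integrable m (\<lambda>z. h z - 1)" using int by (simp add: h_def case_prod_beta')
  have h_one: "h (x, s) = 1" if "real n0 \<le> norm x" for x s
  proof -
    have "x \<notin> K" using K0[of x] that by auto
    then show ?thesis using f0[OF that] one by (simp add: h_def)
  qed
  let ?\<Phi> = "\<lambda>\<eta>. complex_of_real (mark_product \<rho> K \<eta>) * iexp (\<integral>x. f x \<partial>\<eta>)"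
  have meas: "?\<Phi> \<in> borel_measurable discrete_radon_space"
    using mark_product_measurable[OF K \<rho>] integral_measurable_discrete[OF f] by measurable
  have eq: "AE \<omega> in clouds. ?\<Phi> (random_measure \<omega>) = cloud_prod n0 h \<omega>"
    using AE_positions_distinct AE_space
  proof eventually_elim
    fix \<omega> assume inj: "inj_on (\<lambda>i. fst (point \<omega> i)) (indices \<omega>)" and \<omega>: "\<omega> \<in> space clouds"
    show "?\<Phi> (random_measure \<omega>) = cloud_prod n0 h \<omega>"
    proof -
      have 1: "mark_product \<rho> K (random_measure \<omega>) = cloud_prod n0 \<rho> \<omega>"
        by (rule mark_product_random_measure[OF \<omega> inj]) (erule K0, erule one)
      have 2: "(\<integral>x. f x \<partial>random_measure \<omega>) = (\<Sum>n<n0. \<Sum>k<fst (\<omega> n). snd (snd (\<omega> n) k) * f (fst (snd (\<omega> n) k)))"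
        by (rule integral_random_measure[OF \<omega> csc_borel_measurable[OF f]]) (rule f0)
      show ?thesis unfolding 1 2 by (simp add: h_def prod.distrib exp_sum sum_distrib_left)
    qed
  qed
  note E = clouds_prod_expectation[OF h_int h_one]
  have meas2: "(\<lambda>\<omega>. ?\<Phi> (random_measure \<omega>)) \<in> borel_measurable clouds"
    by (rule measurable_compose[OF random_measure_measurable meas])
  have "integrable clouds (\<lambda>\<omega>. ?\<Phi> (random_measure \<omega>))"
    using integrable_cong_AE[OF meas2 borel_measurable_integrable[OF E(1)] eq] E(1) by blast
  then show "integrable law ?\<Phi>" unfolding law_def
    by (subst integrable_distr_eq[OF random_measure_measurable meas])
  have "(\<integral>\<eta>. ?\<Phi> \<eta> \<partial>law) = (\<integral>\<omega>. ?\<Phi> (random_measure \<omega>) \<partial>clouds)"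
    unfolding law_def by (rule integral_distr[OF random_measure_measurable meas])
  also have "\<dots> = (\<integral>\<omega>. cloud_prod n0 h \<omega> \<partial>clouds)"
    by (rule integral_cong_AE[OF meas2 borel_measurable_integrable[OF E(1)] eq])
  also have "\<dots> = exp (\<integral>z. (h z - 1) \<partial>m)" by (rule E(2))
  finally show "(\<integral>\<eta>. ?\<Phi> \<eta> \<partial>law) = exp (\<integral>(x, s). complex_of_real (\<rho> (x, s)) * iexp (s * f x) - 1 \<partial>m)"
    by (simp add: h_def case_prod_beta')
qed

lemma law_finitely_many_atoms:
  assumes K: "bounded K" "K \<in> sets borel"
  shows "AE \<eta> in law. finite (atoms \<eta> \<inter> K)"
proof -
  obtain r where r: "\<And>x. x \<in> K \<Longrightarrow> norm x \<le> r" using K(1) unfolding bounded_iff by blast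
  obtain n0 :: nat where n0: "r < real n0" using reals_Archimedean2 by blast
  have "AE \<omega> in clouds. random_measure \<omega> \<in> finitely_many_atoms_in K"
    using AE_positions_distinct AE_space
  proof eventually_elim
    fix \<omega> assume inj: "inj_on (\<lambda>i. fst (point \<omega> i)) (indices \<omega>)" and \<omega>: "\<omega> \<in> space clouds"
    have "atoms (random_measure \<omega>) \<inter> K \<subseteq> (\<lambda>i. fst (point \<omega> i)) ` indices_below n0 \<omega>"
      unfolding atoms_random_measure[OF \<omega> inj] using norm_less_indices_below[OF \<omega>, of _ n0] r n0 by fastforce
    then have "finite (atoms (random_measure \<omega>) \<inter> K)" by (rule finite_subset) (simp add: finite_indices_below)
    then show "random_measure \<omega> \<in> finitely_many_atoms_in K"
      using random_measure_discrete[OF \<omega>] by (simp add: finitely_many_atoms_in_def)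
  qed
  then have "AE \<eta> in law. \<eta> \<in> finitely_many_atoms_in K"
    unfolding law_def by (subst AE_distr_iff[OF random_measure_measurable])
      (use sets_finitely_many_atoms_in[OF K(2,1)] in \<open>auto intro: sets.sets_Collect_const simp: sets.Int_space_eq1 Collect_conj_eq\<close>)
  then show ?thesis by eventually_elim (simp add: finitely_many_atoms_in_def)
qed

end

section \<open>Lebesgue measure under diffeomorphisms\<close>

text \<open>The change of variables formula for determinants refers to coordinates in a well-ordered index type. A
  finite type \<open>'n\<close> has no canonical order, so the formula is transported along a bijection of \<open>'n\<close> with
  the initial segment of the natural numbers of the same cardinality.\<close>

typedef (overloaded) ('n::finite) ordinal_index = "{..<CARD('n)}"
  by (rule exI[of _ 0]) simp

instantiation ordinal_index :: (finite) linorder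
begin
definition less_eq_ordinal_index :: "'a ordinal_index \<Rightarrow> 'a ordinal_index \<Rightarrow> bool" where
  "less_eq_ordinal_index x y \<longleftrightarrow> Rep_ordinal_index x \<le> Rep_ordinal_index y"
definition less_ordinal_index :: "'a ordinal_index \<Rightarrow> 'a ordinal_index \<Rightarrow> bool" where
  "less_ordinal_index x y \<longleftrightarrow> Rep_ordinal_index x < Rep_ordinal_index y"
instance
  by standard (auto simp: less_eq_ordinal_index_def less_ordinal_index_def Rep_ordinal_index_inject)
end

instance ordinal_index :: (finite) wellorder
proof
  fix P :: "'a ordinal_index \<Rightarrow> bool" and a
  assume step: "\<And>x. (\<And>y. y < x \<Longrightarrow> P y) \<Longrightarrow> P x"
  show "P a"
  proof (induction a rule: measure_induct_rule[of Rep_ordinal_index])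
    case (less x)
    show ?case by (rule step) (auto simp: less_ordinal_index_def intro: less)
  qed
qed

lemma ordinal_index_bij: "bij_betw (Rep_ordinal_index :: 'n::finite ordinal_index \<Rightarrow> nat) UNIV {..<CARD('n)}"
proof -
  interpret type_definition "Rep_ordinal_index :: 'n ordinal_index \<Rightarrow> nat" Abs_ordinal_index "{..<CARD('n)}"
    by (rule type_definition_ordinal_index)
  show ?thesis using Rep_range by (auto simp: bij_betw_def inj_on_def Rep_inject)
qed

instance ordinal_index :: (finite) finite
  by standard (use bij_betw_finite[OF ordinal_index_bij] in simp)

lemma obtain_ordinal_bij:
  obtains \<sigma> :: "'n::finite \<Rightarrow> 'n ordinal_index" where "bij \<sigma>"
proof -
  have "card (UNIV :: 'n set) = card (UNIV :: 'n ordinal_index set)"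
    using bij_betw_same_card[OF ordinal_index_bij[where 'n='n]] by simp
  then show thesis using finite_same_card_bij[of "UNIV :: 'n set" "UNIV :: 'n ordinal_index set"] that by auto
qed

lemma swapidseq_conjugate:
  assumes \<sigma>: "bij (\<sigma> :: 'a \<Rightarrow> 'b)" and p: "swapidseq n p"
  shows "swapidseq n (\<sigma> \<circ> p \<circ> inv \<sigma>)"
  using p
proof induction
  case id
  have eq: "\<sigma> \<circ> id \<circ> inv \<sigma> = id"
    by (rule ext) (simp add: surj_f_inv_f[OF bij_is_surj[OF \<sigma>]])
  show ?case unfolding eq by (rule swapidseq.id)
next
  case (comp_Suc n p a b)
  have eq: "\<sigma> \<circ> (Transposition.transpose a b \<circ> p) \<circ> inv \<sigma> = Transposition.transpose (\<sigma> a) (\<sigma> b) \<circ> (\<sigma> \<circ> p \<circ> inv \<sigma>)"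
    using bij_is_inj[OF \<sigma>] by (auto simp: fun_eq_iff Transposition.transpose_def inj_eq)
  have neq: "\<sigma> a \<noteq> \<sigma> b" using comp_Suc(2) bij_is_inj[OF \<sigma>] by (simp add: inj_eq)
  show ?case unfolding eq by (rule swapidseq.comp_Suc[OF comp_Suc.IH neq])
qed

lemma sign_conjugate:
  assumes \<sigma>: "bij (\<sigma> :: 'a::finite \<Rightarrow> 'b::finite)" and p: "p permutes (UNIV :: 'a set)"
  shows "sign (\<sigma> \<circ> p \<circ> inv \<sigma>) = sign p"
proof -
  have "permutation p" unfolding permutation_permutes using p by (intro exI[of _ UNIV]) simp
  then obtain n where n: "swapidseq n p" unfolding permutation_def by blast
  show ?thesis
    using evenperm_unique[OF n refl] evenperm_unique[OF swapidseq_conjugate[OF \<sigma> n] refl]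
    by (simp add: sign_def)
qed

text \<open>In the Leibniz formula, permutations of the two index types correspond by conjugation with \<open>\<sigma>\<close>, which
  preserves the sign.\<close>
lemma det_reindex:
  fixes A :: "real ^ 'n ^ 'n" and \<sigma> :: "'n::finite \<Rightarrow> 'm::finite"
  assumes \<sigma>: "bij \<sigma>"
  shows "det (\<chi> i j. A $ inv \<sigma> i $ inv \<sigma> j) = det A"
proof -
  have inv: "inv \<sigma> (\<sigma> x) = x" "\<sigma> (inv \<sigma> y) = y" for x y
    using \<sigma> by (auto simp: bij_is_inj bij_is_surj surj_f_inv_f)
  have per: "q permutes UNIV \<longleftrightarrow> bij q" for q :: "'c \<Rightarrow> 'c"
    by (simp add: permutes_univ bij_iff)
  have conj: "bij (\<sigma> \<circ> p \<circ> inv \<sigma>)" if "bij p" for p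
    using \<sigma> that by (intro bij_comp bij_imp_bij_inv)
  have conj': "bij (inv \<sigma> \<circ> q \<circ> \<sigma>)" if "bij q" for q
    using \<sigma> that by (intro bij_comp bij_imp_bij_inv)
  have "det A = (\<Sum>p | p permutes UNIV. of_int (sign p) * (\<Prod>i\<in>UNIV. A $ i $ p i))" by (simp add: det_def)
  also have "\<dots> = (\<Sum>q | q permutes UNIV. of_int (sign q) * (\<Prod>i\<in>UNIV. (\<chi> i j. A $ inv \<sigma> i $ inv \<sigma> j) $ i $ q i))"
  proof (rule sum.reindex_bij_witness[where i="\<lambda>q. inv \<sigma> \<circ> q \<circ> \<sigma>" and j="\<lambda>p. \<sigma> \<circ> p \<circ> inv \<sigma>"])
    fix p :: "'n \<Rightarrow> 'n" assume p: "p \<in> {p. p permutes UNIV}"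
    show "inv \<sigma> \<circ> (\<sigma> \<circ> p \<circ> inv \<sigma>) \<circ> \<sigma> = p" by (simp add: fun_eq_iff inv)
    show "\<sigma> \<circ> p \<circ> inv \<sigma> \<in> {q. q permutes UNIV}" using p conj by (simp add: per)
    have "(\<Prod>i\<in>UNIV. (\<chi> i j. A $ inv \<sigma> i $ inv \<sigma> j) $ i $ (\<sigma> \<circ> p \<circ> inv \<sigma>) i) = (\<Prod>i\<in>UNIV. A $ inv \<sigma> i $ p (inv \<sigma> i))"
      by (simp add: inv)
    also have "\<dots> = (\<Prod>i\<in>UNIV. A $ i $ p i)"
      by (rule prod.reindex_bij_betw[of "inv \<sigma>" UNIV UNIV "\<lambda>i. A $ i $ p i"]) (rule bij_imp_bij_inv[OF \<sigma>])
    finally show "of_int (sign (\<sigma> \<circ> p \<circ> inv \<sigma>)) * (\<Prod>i\<in>UNIV. (\<chi> i j. A $ inv \<sigma> i $ inv \<sigma> j) $ i $ (\<sigma> \<circ> p \<circ> inv \<sigma>) i)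
        = of_int (sign p) * (\<Prod>i\<in>UNIV. A $ i $ p i)"
      using sign_conjugate[OF \<sigma>, of p] p by simp
  next
    fix q :: "'m \<Rightarrow> 'm" assume q: "q \<in> {q. q permutes UNIV}"
    show "\<sigma> \<circ> (inv \<sigma> \<circ> q \<circ> \<sigma>) \<circ> inv \<sigma> = q" by (simp add: fun_eq_iff inv)
    show "inv \<sigma> \<circ> q \<circ> \<sigma> \<in> {p. p permutes UNIV}" using q conj' by (simp add: per)
  qed
  also have "\<dots> = det (\<chi> i j. A $ inv \<sigma> i $ inv \<sigma> j)" by (simp add: det_def)
  finally show ?thesis by simp
qed

text \<open>Lebesgue measure is determined by its values on boxes, so only finite volumes have to be compared.\<close>
lemma distr_density_jacobian_wellorder:
  fixes \<psi> :: "real ^ 'n::{finite,wellorder} \<Rightarrow> real ^ 'n::_"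
  assumes bij: "bij \<psi>" and der: "\<And>x. (\<psi> has_derivative \<psi>' x) (at x)"
    and J: "(\<lambda>x. \<bar>det (matrix (\<psi>' x))\<bar>) \<in> borel_measurable borel"
  shows "distr (density lborel (\<lambda>x. ennreal \<bar>det (matrix (\<psi>' x))\<bar>)) borel \<psi> = lborel"
proof (rule sym, rule lborel_eqI)
  have "continuous_on UNIV \<psi>" using der by (intro has_derivative_continuous_on) (rule has_derivative_at_withinI)
  then have [measurable]: "\<psi> \<in> borel_measurable borel" by (rule borel_measurable_continuous_onI)
  fix l u :: "real ^ 'n::_" assume le: "\<And>b. b \<in> Basis \<Longrightarrow> l \<bullet> b \<le> u \<bullet> b"
  let ?S = "\<psi> -` box l u"
  have S: "?S \<in> sets borel" using measurable_sets[OF \<open>\<psi> \<in> _\<close>, of "box l u"] by simp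
  have img: "\<psi> ` ?S = box l u" using bij by (simp add: bij_is_surj)
  have "((\<lambda>x. \<bar>det (matrix (\<psi>' x))\<bar>) has_integral measure lebesgue (box l u)) ?S"
  proof (rule has_measure_differentiable_image[where f=\<psi>, THEN iffD1])
    show "?S \<in> sets lebesgue" using S by (simp add: sets_completionI_sets)
    show "(\<psi> has_derivative \<psi>' x) (at x within ?S)" for x by (rule has_derivative_at_withinI[OF der])
    show "inj_on \<psi> ?S" using bij by (auto simp: bij_def inj_on_def)
    show "\<psi> ` ?S \<in> lmeasurable \<and> measure lebesgue (\<psi> ` ?S) = measure lebesgue (box l u)" unfolding img by simp
  qed
  from nn_integral_has_integral_lebesgue[OF _ this]
  have "(\<integral>\<^sup>+x. ennreal (indicator ?S x * \<bar>det (matrix (\<psi>' x))\<bar>) \<partial>lborel) = ennreal (measure lebesgue (box l u))" by simp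
  moreover have "emeasure (distr (density lborel (\<lambda>x. ennreal \<bar>det (matrix (\<psi>' x))\<bar>)) borel \<psi>) (box l u)
    = (\<integral>\<^sup>+x. ennreal (indicator ?S x * \<bar>det (matrix (\<psi>' x))\<bar>) \<partial>lborel)"
    using J S by (subst emeasure_distr; simp?) (subst emeasure_density; auto intro!: nn_integral_cong simp: indicator_def)
  ultimately show "emeasure (distr (density lborel (\<lambda>x. ennreal \<bar>det (matrix (\<psi>' x))\<bar>)) borel \<psi>) (box l u)
    = ennreal (\<Prod>b\<in>Basis. (u - l) \<bullet> b)"
    using le by (simp add: measure_lborel_box_eq)
qed simp

text \<open>The renaming of coordinates along \<open>\<sigma>\<close>, an isometry as soon as \<open>\<sigma>\<close> is bijective.\<close>
definition relabel :: "('n::finite \<Rightarrow> 'm::finite) \<Rightarrow> real ^ 'n \<Rightarrow> real ^ 'm" where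
  "relabel \<sigma> x = (\<chi> i. x $ inv \<sigma> i)"

lemma linear_relabel: "linear (relabel \<sigma>)"
  by (rule linearI) (simp_all add: relabel_def vec_eq_iff)

lemma relabel_inverse:
  assumes "bij \<sigma>"
  shows "relabel (inv \<sigma>) (relabel \<sigma> x) = x"
  using assms by (simp add: relabel_def vec_eq_iff inv_inv_eq bij_is_inj)

lemma relabel_inverse':
  assumes "bij \<sigma>"
  shows "relabel \<sigma> (relabel (inv \<sigma>) x) = x"
  using assms by (simp add: relabel_def vec_eq_iff inv_inv_eq bij_is_surj surj_f_inv_f)

lemma relabel_borel: "relabel \<sigma> \<in> borel_measurable borel"
  by (rule borel_measurable_continuous_onI) (rule linear_continuous_on, rule linear_conv_bounded_linear[THEN iffD1, OF linear_relabel])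

lemma bij_axis_Basis: "bij_betw (\<lambda>i. axis i 1) UNIV (Basis :: (real ^ 'n::finite) set)"
  by (auto simp: bij_betw_def inj_on_def axis_eq_axis Basis_vec_def)

lemma distr_lborel_relabel:
  fixes \<sigma> :: "'n::finite \<Rightarrow> 'm::finite"
  assumes \<sigma>: "bij \<sigma>"
  shows "distr lborel borel (relabel \<sigma>) = lborel"
proof (rule sym, rule lborel_eqI)
  fix l u :: "real ^ 'm" assume le: "\<And>b. b \<in> Basis \<Longrightarrow> l \<bullet> b \<le> u \<bullet> b"
  have inv: "inv \<sigma> (\<sigma> x) = x" "\<sigma> (inv \<sigma> y) = y" for x y
    using \<sigma> by (auto simp: bij_is_inj bij_is_surj surj_f_inv_f)
  have le': "l $ i \<le> u $ i" for i using le[of "axis i 1"] by (simp add: inner_axis axis_in_Basis_iff)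
  let ?l = "relabel (inv \<sigma>) l" and ?u = "relabel (inv \<sigma>) u"
  have comp: "?l $ i = l $ \<sigma> i" "?u $ i = u $ \<sigma> i" for i by (simp_all add: relabel_def inv_inv_eq[OF \<sigma>])
  have "relabel \<sigma> -` box l u = box ?l ?u"
  proof (rule set_eqI)
    fix x :: "real ^ 'n"
    have "(\<forall>i. l $ i < x $ inv \<sigma> i \<and> x $ inv \<sigma> i < u $ i) \<longleftrightarrow> (\<forall>i. l $ \<sigma> i < x $ i \<and> x $ i < u $ \<sigma> i)"
      using inv by metis
    then show "x \<in> relabel \<sigma> -` box l u \<longleftrightarrow> x \<in> box ?l ?u" by (simp add: mem_box_cart comp) (simp add: relabel_def)
  qed
  then have "emeasure (distr lborel borel (relabel \<sigma>)) (box l u) = emeasure lborel (box ?l ?u)"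
    using relabel_borel[of \<sigma>] by (subst emeasure_distr) auto
  also have "\<dots> = ennreal (\<Prod>b\<in>Basis. (?u - ?l) \<bullet> b)"
  proof (rule emeasure_lborel_box)
    fix b :: "real ^ 'n" assume "b \<in> Basis"
    then obtain i where "b = axis i 1" by (auto simp: Basis_vec_def)
    then show "?l \<bullet> b \<le> ?u \<bullet> b" using le' by (simp add: inner_axis comp)
  qed
  also have "(\<Prod>b\<in>Basis. (?u - ?l) \<bullet> b) = (\<Prod>i\<in>UNIV. (u - l) $ \<sigma> i)"
    by (subst prod.reindex_bij_betw[OF bij_axis_Basis, symmetric]) (simp add: inner_axis comp)
  also have "\<dots> = (\<Prod>i\<in>UNIV. (u - l) $ i)" by (rule prod.reindex_bij_betw[OF \<sigma>])
  also have "\<dots> = (\<Prod>b\<in>Basis. (u - l) \<bullet> b)"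
    by (subst prod.reindex_bij_betw[OF bij_axis_Basis, symmetric]) (simp add: inner_axis)
  finally show "emeasure (distr lborel borel (relabel \<sigma>)) (box l u) = ennreal (\<Prod>b\<in>Basis. (u - l) \<bullet> b)" .
qed simp

text \<open>The map \<open>\<psi>\<close> is conjugated by the renaming of coordinates, which preserves Lebesgue measure and leaves the
  Jacobian determinant unchanged.\<close>
theorem distr_density_jacobian:
  fixes \<psi> :: "real ^ 'n \<Rightarrow> real ^ 'n"
  assumes bij: "bij \<psi>" and der: "\<And>x. (\<psi> has_derivative \<psi>' x) (at x)"
    and J: "(\<lambda>x. \<bar>det (matrix (\<psi>' x))\<bar>) \<in> borel_measurable borel"
  shows "distr (density lborel (\<lambda>x. ennreal \<bar>det (matrix (\<psi>' x))\<bar>)) borel \<psi> = lborel"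
proof -
  obtain \<sigma> :: "'n \<Rightarrow> 'n ordinal_index" where \<sigma>: "bij \<sigma>" by (rule obtain_ordinal_bij)
  let ?D = "density lborel (\<lambda>x. ennreal \<bar>det (matrix (\<psi>' x))\<bar>)" and ?T = "relabel \<sigma>" and ?T' = "relabel (inv \<sigma>)"
  note TT = relabel_inverse[OF \<sigma>] relabel_inverse'[OF \<sigma>]
  define \<chi>' where "\<chi>' y = ?T \<circ> \<psi>' (?T' y) \<circ> ?T'" for y
  have bl: "bounded_linear ?T" "bounded_linear ?T'" using linear_relabel linear_conv_bounded_linear by blast+
  have det: "det (matrix (\<chi>' y)) = det (matrix (\<psi>' (?T' y)))" for y
  proof -
    have ax: "?T' (axis j 1) = axis (inv \<sigma> j) 1" for j
      using \<sigma> by (auto simp: relabel_def vec_eq_iff axis_def inv_inv_eq bij_is_surj surj_f_inv_f bij_is_inj)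
    have "matrix (\<chi>' y) = (\<chi> i j. matrix (\<psi>' (?T' y)) $ inv \<sigma> i $ inv \<sigma> j)"
      unfolding matrix_def \<chi>'_def by (simp add: vec_eq_iff ax) (simp add: relabel_def)
    then show ?thesis using det_reindex[OF \<sigma>] by simp
  qed
  have [measurable]: "?T \<in> borel_measurable borel" "?T' \<in> borel_measurable borel" by (rule relabel_borel)+
  have "continuous_on UNIV \<psi>" using der by (intro has_derivative_continuous_on) (rule has_derivative_at_withinI)
  then have [measurable]: "\<psi> \<in> borel_measurable borel" by (rule borel_measurable_continuous_onI)
  note [measurable] = J
  have J': "(\<lambda>y. \<bar>det (matrix (\<chi>' y))\<bar>) \<in> borel_measurable borel" unfolding det by measurable
  have "bij ?T" "bij ?T'" using TT by (auto intro!: bij_betwI[of _ _ _ ?T'] bij_betwI[of _ _ _ ?T])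
  then have bij': "bij (?T \<circ> \<psi> \<circ> ?T')" using bij by (intro bij_comp)
  have der': "((?T \<circ> \<psi> \<circ> ?T') has_derivative \<chi>' y) (at y)" for y
    unfolding \<chi>'_def using bl der
    by (intro diff_chain_at bounded_linear_imp_has_derivative) (auto simp: o_def)
  let ?Jm = "\<lambda>y. ennreal \<bar>det (matrix (\<chi>' y))\<bar>"
  have m: "distr (density lborel ?Jm) borel (?T \<circ> \<psi> \<circ> ?T') = lborel"
    by (rule distr_density_jacobian_wellorder[OF bij' der' J'])
  have "density lborel ?Jm = density (distr lborel borel ?T) ?Jm" by (simp add: distr_lborel_relabel[OF \<sigma>])
  also have "\<dots> = distr (density lborel (\<lambda>x. ?Jm (?T x))) borel ?T"
    using J' by (intro density_distr) auto
  also have "(\<lambda>x. ?Jm (?T x)) = (\<lambda>x. ennreal \<bar>det (matrix (\<psi>' x))\<bar>)" by (simp add: det TT)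
  finally have d: "density lborel ?Jm = distr ?D borel ?T" .
  have "lborel = distr lborel borel ?T'" by (rule distr_lborel_relabel[OF bij_imp_bij_inv[OF \<sigma>], symmetric])
  also have "\<dots> = distr (distr (distr ?D borel ?T) borel (?T \<circ> \<psi> \<circ> ?T')) borel ?T'"
    using m unfolding d by simp
  also have "\<dots> = distr ?D borel (?T' \<circ> ((?T \<circ> \<psi> \<circ> ?T') \<circ> ?T))"
    by (subst distr_distr, simp, simp, subst distr_distr, simp, simp, simp add: comp_assoc)
  also have "?T' \<circ> ((?T \<circ> \<psi> \<circ> ?T') \<circ> ?T) = \<psi>" by (simp add: fun_eq_iff TT)
  finally show ?thesis by simp
qed

section \<open>The characteristic functional\<close>

context locally_finite_intensity
begin

lemma integrable_characteristic:
  assumes f: "compactly_supported_continuous f"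
  shows "integrable m (\<lambda>(x, s). iexp (s * f x) - 1)"
proof -
  obtain n where n: "\<And>x. real n \<le> norm x \<Longrightarrow> f x = 0" using csc_bounded_support[OF f] by metis
  let ?A = "ball 0 (real n) \<times> {0<..} :: ('a \<times> real) set"
  note [measurable] = fst_measurable snd_measurable csc_borel_measurable[OF f]
  show ?thesis
  proof (rule integrableI_bounded_set[where A="?A" and B=2])
    show "?A \<in> sets m" by (rule cylinder_sets) simp
    show "emeasure m ?A < \<infinity>" by (rule finite_bounded) auto
    show "(\<lambda>(x, s). iexp (s * f x) - 1) \<in> borel_measurable m"
      unfolding case_prod_beta' by measurable
    show "AE z in m. z \<in> ?A \<longrightarrow> norm (case z of (x, s) \<Rightarrow> iexp (s * f x) - 1) \<le> 2"
    proof (rule AE_I2, rule impI)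
      fix z :: "'a \<times> real"
      obtain x s where z: "z = (x, s)" by (cases z)
      have "norm (iexp (s * f x) - 1) \<le> norm (iexp (s * f x)) + norm (1 :: complex)"
        by (rule norm_triangle_ineq4)
      also have "\<dots> = 2" unfolding norm_exp_i_times by simp
      finally show "norm (case z of (x, s) \<Rightarrow> iexp (s * f x) - 1) \<le> 2" by (simp add: z)
    qed
    show "AE z in m. z \<notin> ?A \<longrightarrow> (case z of (x, s) \<Rightarrow> iexp (s * f x) - 1) = 0"
    proof (rule AE_I2, rule impI)
      fix z assume z: "z \<in> space m" "z \<notin> ?A"
      obtain x s where xs: "z = (x, s)" by (cases z)
      have "f x = 0" using z by (intro n) (simp add: xs space_m not_less)
      then show "(case z of (x, s) \<Rightarrow> iexp (s * f x) - 1) = 0" by (simp add: xs)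
    qed
  qed
qed

lemma law_characteristic:
  assumes f: "compactly_supported_continuous f"
  shows "(\<integral>\<eta>. iexp (\<integral>x. f x \<partial>\<eta>) \<partial>law)
    = exp (\<integral>(x, s). iexp (s * f x) - 1 \<partial>m)"
  using law_weighted_fourier(2)[OF f, of "{}" "\<lambda>_. 1"] integrable_characteristic[OF f]
  by (simp add: mark_product_def)

text \<open>The description of the law by its Fourier transform is proper: existence is the construction above,
  uniqueness is \<open>discrete_law_eqI\<close>.\<close>
theorem random_measure_law_eq: "random_measure_law m = law"
  unfolding random_measure_law_def
proof (rule the_equality, intro conjI allI impI)
  show "prob_space law" by (rule prob_law)
  show "sets law = sets discrete_radon_space" by (rule sets_law)
  show "(\<integral>\<eta>. iexp (\<integral>x. f x \<partial>\<eta>) \<partial>law)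
    = exp (\<integral>(x, s). iexp (s * f x) - 1 \<partial>m)"
    if "compactly_supported_continuous f" for f by (rule law_characteristic[OF that])
  fix \<mu> :: "'a measure measure"
  assume \<mu>: "prob_space \<mu> \<and> sets \<mu> = sets discrete_radon_space \<and>
     (\<forall>f. compactly_supported_continuous f \<longrightarrow>
        (\<integral>\<eta>. iexp (\<integral>x. f x \<partial>\<eta>) \<partial>\<mu>) =
        exp (\<integral>(x, s). iexp (s * f x) - 1 \<partial>m))"
  show "\<mu> = law"
    using \<mu> law_characteristic by (intro discrete_law_eqI prob_law sets_law) auto
qed

end

section \<open>Transport of the law by a homeomorphism\<close>

lemma csc_compose_homeomorphism:
  fixes \<phi> :: "'a::euclidean_space \<Rightarrow> 'a"
  assumes f: "compactly_supported_continuous f" and \<phi>: "continuous_on UNIV \<phi>"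
    and K: "compact K" "\<And>x. x \<notin> K \<Longrightarrow> \<phi> x = x"
  shows "compactly_supported_continuous (\<lambda>x. f (\<phi> x))"
proof -
  obtain n where n: "\<And>x. real n \<le> norm x \<Longrightarrow> f x = 0" using csc_bounded_support[OF f] by metis
  obtain r where r: "\<And>x. x \<in> K \<Longrightarrow> norm x \<le> r" using compact_imp_bounded[OF K(1)] unfolding bounded_iff by blast
  show ?thesis
  proof (rule csc_intro[where r="max (real n) (r + 1)"])
    have "continuous_on UNIV f" using f by (simp add: compactly_supported_continuous_def)
    then show "continuous_on UNIV (\<lambda>x. f (\<phi> x))" using \<phi> by (rule continuous_on_compose2) simp
    fix x :: 'a assume x: "max (real n) (r + 1) \<le> norm x"
    then have "x \<notin> K" using r[of x] by auto
    then show "f (\<phi> x) = 0" using K(2) n x by simp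
  qed
qed

lemma pushforward_discrete:
  fixes \<phi> :: "'a::euclidean_space \<Rightarrow> 'a"
  assumes \<eta>: "\<eta> \<in> discrete_radon_measures" and bij: "bij \<phi>"
    and \<phi>: "continuous_on UNIV \<phi>" and \<phi>': "continuous_on UNIV (inv \<phi>)"
  shows "distr \<eta> borel \<phi> \<in> discrete_radon_measures"
proof (rule discrete_radon_measuresI)
  note r = discrete_imp_radon[OF \<eta>]
  have [measurable]: "\<phi> \<in> measurable \<eta> borel"
    using borel_measurable_continuous_onI[OF \<phi>] measurable_cong_sets[OF radon_sets[OF r] refl] by blast
  show "distr \<eta> borel \<phi> \<in> radon_measures" unfolding radon_measures_def
  proof (intro CollectI conjI allI impI)
    fix C :: "'a set" assume C: "compact C"
    have "\<phi> -` C = inv \<phi> ` C" by (rule bij_vimage_eq_inv_image[OF bij])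
    moreover have "compact (inv \<phi> ` C)" using \<phi>' C by (intro compact_continuous_image) (auto intro: continuous_on_subset)
    ultimately have "emeasure \<eta> (\<phi> -` C) < \<infinity>" using radon_finite[OF r] compact_imp_bounded by metis
    then show "emeasure (distr \<eta> borel \<phi>) C < \<infinity>"
      using C by (subst emeasure_distr) (auto simp: radon_space_UNIV[OF r] borel_compact)
  qed simp
  show A: "countable (\<phi> ` atoms \<eta>)" using discrete_atoms(1)[OF \<eta>] by simp
  then have "\<phi> ` atoms \<eta> \<in> sets borel" by (rule sets.countable[rotated]) simp
  then have "- \<phi> ` atoms \<eta> \<in> sets borel" by (rule borel_comp)
  moreover have "\<phi> -` (- \<phi> ` atoms \<eta>) = - atoms \<eta>" using bij by (auto simp: bij_def inj_def)
  ultimately show "emeasure (distr \<eta> borel \<phi>) (- \<phi> ` atoms \<eta>) = 0"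
    using discrete_atoms(2)[OF \<eta>] by (subst emeasure_distr) (auto simp: radon_space_UNIV[OF r])
qed

lemma integral_pushforward:
  fixes \<phi> :: "'a::euclidean_space \<Rightarrow> 'a"
  assumes \<eta>: "\<eta> \<in> radon_measures" and \<phi>: "continuous_on UNIV \<phi>" and f: "compactly_supported_continuous f"
  shows "(\<integral>x. f x \<partial>distr \<eta> borel \<phi>) = (\<integral>x. f (\<phi> x) \<partial>\<eta>)"
proof (rule integral_distr)
  show "\<phi> \<in> measurable \<eta> borel"
    using borel_measurable_continuous_onI[OF \<phi>] measurable_cong_sets[OF radon_sets[OF \<eta>] refl] by blast
qed (rule csc_borel_measurable[OF f])

lemma pushforward_measurable:
  fixes \<phi> :: "'a::euclidean_space \<Rightarrow> 'a"
  assumes bij: "bij \<phi>" and \<phi>: "continuous_on UNIV \<phi>" and \<phi>': "continuous_on UNIV (inv \<phi>)"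
    and K: "compact K" "\<And>x. x \<notin> K \<Longrightarrow> \<phi> x = x"
  shows "(\<lambda>\<eta>. distr \<eta> borel \<phi>) \<in> measurable discrete_radon_space discrete_radon_space"
proof (rule measurable_discrete_radon_spaceI)
  show "distr \<eta> borel \<phi> \<in> discrete_radon_measures" if "\<eta> \<in> space discrete_radon_space" for \<eta>
    using that pushforward_discrete[OF _ bij \<phi> \<phi>'] by (simp add: space_discrete_radon_space)
  fix f :: "'a \<Rightarrow> real" assume f: "compactly_supported_continuous f"
  from integral_measurable_discrete[OF csc_compose_homeomorphism[OF f \<phi> K]]
  show "(\<lambda>\<eta>. \<integral>x. f x \<partial>distr \<eta> borel \<phi>) \<in> borel_measurable discrete_radon_space"
  proof (rule measurable_cong[THEN iffD1, rotated])
    fix \<eta> :: "'a measure" assume "\<eta> \<in> space discrete_radon_space"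
    then have "\<eta> \<in> radon_measures" unfolding space_discrete_radon_space by (rule discrete_imp_radon)
    then show "(\<integral>x. f (\<phi> x) \<partial>\<eta>) = (\<integral>x. f x \<partial>distr \<eta> borel \<phi>)" by (rule integral_pushforward[OF _ \<phi> f, symmetric])
  qed
qed

context locally_finite_intensity
begin

text \<open>If the image \<open>m'\<close> of the intensity is \<open>\<rho> m\<close>, then the image of the law is the law weighted by the product
  of \<open>\<rho>\<close> over the atoms in \<open>K\<close>. The integral of \<open>\<rho> - 1\<close> is \<open>m'(K \<times> {0<..}) - m(K \<times> {0<..})\<close> and vanishes
  as \<open>\<phi>\<close> maps \<open>K\<close> onto itself; this is why no normalizing constant appears. Therefore the weight \<open>\<rho>\<close> in
  the Fourier exponent has the same effect as replacing \<open>f\<close> by \<open>f \<circ> \<phi>\<close> (the step \<open>twisted\<close>).\<close>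
theorem pushforward_law_density:
  assumes bij: "bij \<phi>" and \<phi>: "continuous_on UNIV \<phi>" and \<phi>': "continuous_on UNIV (inv \<phi>)"
    and K: "compact K" "\<And>x. x \<notin> K \<Longrightarrow> \<phi> x = x"
    and \<rho>: "\<rho> \<in> borel_measurable (borel \<Otimes>\<^sub>M borel)" and \<rho>_nonneg: "\<And>z. 0 \<le> \<rho> z"
    and one: "\<And>x s. x \<notin> K \<Longrightarrow> \<rho> (x, s) = 1"
    and push: "distr m m (\<lambda>z. (\<phi> (fst z), snd z)) = density m (\<lambda>z. ennreal (\<rho> z))"
  shows "pushforward_law \<phi> law = density law (\<lambda>\<eta>. ennreal (mark_product \<rho> K \<eta>))"
proof -
  interpret law: prob_space law by (rule prob_law)
  have Kb: "K \<in> sets borel" "bounded K" using K(1) by (auto simp: borel_compact compact_imp_bounded)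
  let ?\<Phi> = "\<lambda>z::'a \<times> real. (\<phi> (fst z), snd z)" and ?C = "K \<times> {0<..} :: ('a \<times> real) set"
  have [measurable]: "\<phi> \<in> borel_measurable borel" by (rule borel_measurable_continuous_onI[OF \<phi>])
  have "?\<Phi> \<in> measurable (borel \<Otimes>\<^sub>M restrict_space borel {0<..}) (borel \<Otimes>\<^sub>M restrict_space borel {0<..})" by measurable
  then have \<Phi>: "?\<Phi> \<in> measurable m m" using measurable_cong_sets[OF sets_m sets_m] by blast
  have "(\<lambda>z. (fst z, snd z)) \<in> measurable m (borel \<Otimes>\<^sub>M borel)"
    using fst_measurable snd_measurable by (rule measurable_Pair)
  from measurable_compose[OF this \<rho>] have \<rho>m: "\<rho> \<in> borel_measurable m" by simp
  have C: "?C \<in> sets m" and Cfin: "emeasure m ?C < \<infinity>"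
    using cylinder_sets finite_bounded Kb by auto
  have \<phi>K: "\<phi> x \<in> K \<longleftrightarrow> x \<in> K" for x
  proof
    assume "x \<in> K"
    show "\<phi> x \<in> K"
    proof (rule ccontr)
      assume "\<phi> x \<notin> K"
      then have "\<phi> (\<phi> x) = \<phi> x" by (rule K(2))
      then have "\<phi> x = x" using bij by (simp add: bij_def inj_eq)
      with \<open>x \<in> K\<close> \<open>\<phi> x \<notin> K\<close> show False by simp
    qed
  qed (use K(2) in force)
  have "(\<integral>\<^sup>+z. ennreal (indicator ?C z * \<rho> z) \<partial>m) = emeasure (density m (\<lambda>z. ennreal (\<rho> z))) ?C"
    using \<rho>m C by (subst emeasure_density) (auto intro!: nn_integral_cong simp: indicator_def)
  also have "\<dots> = emeasure m (?\<Phi> -` ?C \<inter> space m)"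
    unfolding push[symmetric] by (rule emeasure_distr[OF \<Phi> C])
  also have "?\<Phi> -` ?C \<inter> space m = ?C" by (auto simp: space_m \<phi>K)
  finally have nn: "(\<integral>\<^sup>+z. ennreal (indicator ?C z * \<rho> z) \<partial>m) = emeasure m ?C" .
  have intC\<rho>: "integrable m (\<lambda>z. indicator ?C z * \<rho> z)"
    using nn Cfin \<rho>m C \<rho>_nonneg by (intro integrableI_nonneg) auto
  have intC: "integrable m (indicator ?C :: _ \<Rightarrow> real)" using C Cfin by (intro integrable_real_indicator)
  have "(\<integral>z. indicator ?C z * \<rho> z \<partial>m) = measure m ?C"
    using \<rho>m C \<rho>_nonneg by (subst integral_eq_nn_integral) (auto simp: nn measure_def)
  moreover have "(\<integral>z. indicator ?C z \<partial>m) = measure m ?C"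
    using sets.sets_into_space[OF C] by (simp add: Int_absorb2)
  moreover have split: "\<rho> z - 1 = indicator ?C z * \<rho> z - indicator ?C z" if "z \<in> space m" for z
  proof (cases "fst z \<in> K")
    case True
    then have "z \<in> ?C" using that by (auto simp: space_m mem_Times_iff)
    then show ?thesis by simp
  next
    case False
    then have "z \<notin> ?C" by (auto simp: mem_Times_iff)
    then show ?thesis using one[OF False, of "snd z"] by simp
  qed
  ultimately have \<rho>1: "integrable m (\<lambda>z. \<rho> z - 1)" "(\<integral>z. (\<rho> z - 1) \<partial>m) = 0"
    using intC intC\<rho> Bochner_Integration.integrable_diff[OF intC\<rho> intC] 
    by (simp_all add: split cong: Bochner_Integration.integral_cong Bochner_Integration.integrable_cong)
  let ?e = "\<lambda>f z. iexp (snd z * f (fst z)) :: complex"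
  let ?G = "mark_product \<rho> K"
  \<comment> \<open>Decompose \<open>\<rho> e - 1 = \<rho> (e - 1) + (\<rho> - 1)\<close>; only the first part contributes, and it transforms under \<open>\<phi>\<close>.\<close>
  have twisted: "integrable m (\<lambda>(x, s). complex_of_real (\<rho> (x, s)) * iexp (s * f x) - 1) \<and>
      (\<integral>(x, s). complex_of_real (\<rho> (x, s)) * iexp (s * f x) - 1 \<partial>m)
      = (\<integral>(x, s). iexp (s * f (\<phi> x)) - 1 \<partial>m)"
    if f: "compactly_supported_continuous f" for f
  proof -
    note [measurable] = fst_measurable snd_measurable csc_borel_measurable[OF f]
    have em: "(\<lambda>z. ?e f z - 1) \<in> borel_measurable m" by measurable
    have i1: "integrable m (\<lambda>z. ?e f (?\<Phi> z) - 1)"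
      using integrable_characteristic[OF csc_compose_homeomorphism[OF f \<phi> K]] by (simp add: case_prod_beta')
    then have "integrable (distr m m ?\<Phi>) (\<lambda>z. ?e f z - 1)"
      by (subst integrable_distr_eq[OF \<Phi> em])
    then have i2: "integrable m (\<lambda>z. \<rho> z *\<^sub>R (?e f z - 1))"
      unfolding push using \<rho>m em \<rho>_nonneg by (subst (asm) integrable_density) auto
    have "(\<integral>z. ?e f (?\<Phi> z) - 1 \<partial>m) = (\<integral>z. ?e f z - 1 \<partial>distr m m ?\<Phi>)"
      by (rule integral_distr[OF \<Phi> em, symmetric])
    also have "\<dots> = (\<integral>z. \<rho> z *\<^sub>R (?e f z - 1) \<partial>m)"
      unfolding push using \<rho>m em \<rho>_nonneg by (intro integral_density) auto
    finally have eq: "(\<integral>z. \<rho> z *\<^sub>R (?e f z - 1) \<partial>m) = (\<integral>z. ?e f (?\<Phi> z) - 1 \<partial>m)" ..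
    have i3: "integrable m (\<lambda>z. complex_of_real (\<rho> z - 1))" using \<rho>1(1) by (rule integrable_of_real)
    have i30: "(\<integral>z. complex_of_real (\<rho> z - 1) \<partial>m) = 0" unfolding integral_complex_of_real \<rho>1(2) by simp
    have decomp: "complex_of_real (\<rho> z) * ?e f z - 1 = \<rho> z *\<^sub>R (?e f z - 1) + complex_of_real (\<rho> z - 1)" for z
      by (simp add: scaleR_conv_of_real algebra_simps)
    have "integrable m (\<lambda>z. complex_of_real (\<rho> z) * ?e f z - 1)"
      unfolding decomp using i2 i3 by (rule Bochner_Integration.integrable_add)
    moreover have "(\<integral>z. complex_of_real (\<rho> z) * ?e f z - 1 \<partial>m) = (\<integral>z. ?e f (?\<Phi> z) - 1 \<partial>m)"
      unfolding decomp Bochner_Integration.integral_add[OF i2 i3] i30 eq by simp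
    ultimately show ?thesis by (simp add: case_prod_beta')
  qed
  have Gm: "?G \<in> borel_measurable law"
    using mark_product_measurable[OF Kb \<rho>] measurable_cong_sets[OF sets_law refl] by blast
  have G0: "0 \<le> ?G \<eta>" for \<eta> unfolding mark_product_def using \<rho>_nonneg by (intro prod_nonneg) simp
  \<comment> \<open>With \<open>f = 0\<close> the Fourier formula says that the weight has expectation 1.\<close>
  note wf = law_weighted_fourier[OF _ Kb \<rho> one, OF _ _ conjunct1[OF twisted]]
  have zero: "compactly_supported_continuous (\<lambda>_::'a. 0)" by (simp add: compactly_supported_continuous_def)
  have "integrable law (\<lambda>\<eta>. complex_of_real (?G \<eta>))" "(\<integral>\<eta>. complex_of_real (?G \<eta>) \<partial>law) = 1"
    using wf[OF zero _ zero] conjunct2[OF twisted[OF zero]] by (simp_all add: case_prod_beta')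
  then have Gi: "integrable law ?G" "(\<integral>\<eta>. ?G \<eta> \<partial>law) = 1"
    using integrable_Re[of law "\<lambda>\<eta>. complex_of_real (?G \<eta>)"] by (simp_all only: integral_complex_of_real of_real_eq_1_iff Re_complex_of_real)
  let ?D = "density law (\<lambda>\<eta>. ennreal (?G \<eta>))"
  have Dprob: "prob_space ?D"
  proof (rule prob_spaceI)
    have "emeasure ?D (space ?D) = (\<integral>\<^sup>+\<eta>. ennreal (?G \<eta>) \<partial>law)"
      using Gm by (subst emeasure_density) (auto intro!: nn_integral_cong)
    also have "\<dots> = 1" using nn_integral_eq_integral[OF Gi(1)] G0 Gi(2) by simp
    finally show "emeasure ?D (space ?D) = 1" .
  qed
  have T: "(\<lambda>\<eta>. distr \<eta> borel \<phi>) \<in> measurable law discrete_radon_space"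
    using pushforward_measurable[OF bij \<phi> \<phi>' K] measurable_cong_sets[OF sets_law refl] by blast
  show ?thesis
  proof (rule discrete_law_eqI)
    show "prob_space (pushforward_law \<phi> law)"
      unfolding pushforward_law_def by (rule law.prob_space_distr[OF T])
    show "sets (pushforward_law \<phi> law) = sets discrete_radon_space" by (simp add: pushforward_law_def)
    show "prob_space ?D" by (rule Dprob)
    show "sets ?D = sets discrete_radon_space" by (simp add: sets_law)
    fix f :: "'a \<Rightarrow> real" assume f: "compactly_supported_continuous f"
    have ef: "(\<lambda>\<eta>. iexp (\<integral>x. f x \<partial>\<eta>)) \<in> borel_measurable discrete_radon_space"
      using integral_measurable_discrete[OF f] by measurable
    then have efl: "(\<lambda>\<eta>. iexp (\<integral>x. f x \<partial>\<eta>)) \<in> borel_measurable law"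
      using measurable_cong_sets[OF sets_law refl] by blast
    have "(\<integral>\<eta>. iexp (\<integral>x. f x \<partial>\<eta>) \<partial>pushforward_law \<phi> law)
      = (\<integral>\<eta>. iexp (\<integral>x. f x \<partial>distr \<eta> borel \<phi>) \<partial>law)"
      unfolding pushforward_law_def by (rule integral_distr[OF T ef])
    also have "\<dots> = (\<integral>\<eta>. iexp (\<integral>x. f (\<phi> x) \<partial>\<eta>) \<partial>law)"
    proof (rule Bochner_Integration.integral_cong[OF refl])
      fix \<eta> assume "\<eta> \<in> space law"
      then have "\<eta> \<in> radon_measures"
        using sets_eq_imp_space_eq[OF sets_law] by (auto simp: space_discrete_radon_space discrete_imp_radon)
      then show "iexp (\<integral>x. f x \<partial>distr \<eta> borel \<phi>) = iexp (\<integral>x. f (\<phi> x) \<partial>\<eta>)"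
        by (simp add: integral_pushforward[OF _ \<phi> f])
    qed
    also have "\<dots> = exp (\<integral>(x, s). iexp (s * f (\<phi> x)) - 1 \<partial>m)"
      by (rule law_characteristic[OF csc_compose_homeomorphism[OF f \<phi> K]])
    also have "\<dots> = (\<integral>\<eta>. complex_of_real (?G \<eta>) * iexp (\<integral>x. f x \<partial>\<eta>) \<partial>law)"
      using wf(2)[OF f _ f] conjunct2[OF twisted[OF f]] by simp
    also have "\<dots> = (\<integral>\<eta>. iexp (\<integral>x. f x \<partial>\<eta>) \<partial>?D)"
      using Gm efl G0 by (subst integral_density) (auto simp: scaleR_conv_of_real)
    finally show "(\<integral>\<eta>. iexp (\<integral>x. f x \<partial>\<eta>) \<partial>pushforward_law \<phi> law)
      = (\<integral>\<eta>. iexp (\<integral>x. f x \<partial>\<eta>) \<partial>?D)" .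
  qed
qed

lemma pushforward_law_equivalent:
  assumes "pushforward_law \<phi> law = density law (\<lambda>\<eta>. ennreal (mark_product \<rho> K \<eta>))"
    and K: "K \<in> sets borel" "bounded K" and \<rho>: "\<rho> \<in> borel_measurable (borel \<Otimes>\<^sub>M borel)" and pos: "\<And>z. 0 < \<rho> z"
  shows "absolutely_continuous law (pushforward_law \<phi> law)" "absolutely_continuous (pushforward_law \<phi> law) law"
    and "AE \<eta> in law. RN_deriv law (pushforward_law \<phi> law) \<eta> = ennreal (mark_product \<rho> K \<eta>)"
proof -
  interpret law: prob_space law by (rule prob_law)
  have Gm: "(\<lambda>\<eta>. ennreal (mark_product \<rho> K \<eta>)) \<in> borel_measurable law"
  proof -
    have "mark_product \<rho> K \<in> borel_measurable law"
      using mark_product_measurable[OF K \<rho>] measurable_cong_sets[OF sets_law refl] by blast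
    then show ?thesis by measurable
  qed
  have G0: "0 < mark_product \<rho> K \<eta>" for \<eta> unfolding mark_product_def using pos by (intro prod_pos) simp
  show "absolutely_continuous law (pushforward_law \<phi> law)"
    unfolding assms(1) by (rule absolutely_continuousI_density[OF Gm])
  show "absolutely_continuous (pushforward_law \<phi> law) law"
    unfolding assms(1) absolutely_continuous_def
  proof
    fix A assume "A \<in> null_sets (density law (\<lambda>\<eta>. ennreal (mark_product \<rho> K \<eta>)))"
    then have A: "A \<in> sets law" and ae: "AE \<eta> in law. \<eta> \<in> A \<longrightarrow> ennreal (mark_product \<rho> K \<eta>) = 0"
      unfolding null_sets_density_iff[OF Gm] by blast+
    from ae have "AE \<eta> in law. \<eta> \<notin> A"
    proof (rule eventually_mono)
      fix \<eta> assume "\<eta> \<in> A \<longrightarrow> ennreal (mark_product \<rho> K \<eta>) = 0"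
      then show "\<eta> \<notin> A" using G0[of \<eta>] by (auto simp: ennreal_eq_0_iff)
    qed
    then show "A \<in> null_sets law" using A by (simp add: AE_iff_null_sets)
  qed
  show "AE \<eta> in law. RN_deriv law (pushforward_law \<phi> law) \<eta> = ennreal (mark_product \<rho> K \<eta>)"
    using law.RN_deriv_unique[OF Gm assms(1)[symmetric]] by eventually_elim simp
qed

end

section \<open>Intensities with a positive density\<close>

lemma shell_nonnull: "0 < emeasure lborel (shell n :: 'a::euclidean_space set)"
proof -
  let ?U = "{x::'a. real n < norm x \<and> norm x < real n + 1}"
  have "open ?U" by (intro open_Collect_conj open_Collect_less continuous_intros)
  moreover obtain b :: 'a where b: "b \<in> Basis" using nonempty_Basis by blast
  then have "norm ((real n + 1 / 2) *\<^sub>R b) = real n + 1 / 2" by simp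
  then have "(real n + 1 / 2) *\<^sub>R b \<in> ?U" by (simp del: norm_scaleR)
  ultimately have "\<not> negligible ?U" using open_not_negligible by blast
  moreover have "?U \<subseteq> shell n" by (auto simp: shell_def)
  ultimately have "\<not> negligible (shell n :: 'a set)" using negligible_subset by blast
  then have "shell n \<notin> null_sets (lborel :: 'a measure)"
    unfolding negligible_iff_null_sets using null_sets_completionI by blast
  then show ?thesis by (simp add: null_sets_def zero_less_iff_neq_zero)
qed

locale levy_density =
  fixes l :: "'a::euclidean_space \<Rightarrow> real \<Rightarrow> real"
  assumes l_measurable: "(\<lambda>(x, s). l x s) \<in> borel_measurable (borel \<Otimes>\<^sub>M restrict_space borel {0<..})"
    and l_pos: "\<And>x s. 0 < s \<Longrightarrow> 0 < l x s"
    and l_finite: "\<And>\<Lambda>. \<Lambda> \<in> sets borel \<Longrightarrow> compact (closure \<Lambda>) \<Longrightarrow>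
           emeasure (intensity l) (\<Lambda> \<times> {0<..}) < \<infinity>"
begin

abbreviation base :: "('a \<times> real) measure" where
  "base \<equiv> lborel \<Otimes>\<^sub>M restrict_space lborel {0<..}"

lemma sets_base: "sets base = sets (borel \<Otimes>\<^sub>M restrict_space borel {0<..})"
  by (intro sets_pair_measure_cong sets_restrict_space_cong) auto

lemma space_base: "space base = UNIV \<times> {0<..}"
  by (simp add: space_pair_measure space_restrict_space)

lemma weight_measurable: "(\<lambda>(x, s). ennreal (l x s / s)) \<in> borel_measurable base"
proof -
  have 1: "(\<lambda>z. l (fst z) (snd z)) \<in> borel_measurable (borel \<Otimes>\<^sub>M restrict_space borel {0<..})"
    using l_measurable by (simp add: case_prod_beta')
  have 2: "(\<lambda>z. snd z) \<in> borel_measurable ((borel :: 'a measure) \<Otimes>\<^sub>M (restrict_space borel {0<..} :: real measure))"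
    by (rule measurable_compose[OF measurable_snd]) (simp add: measurable_restrict_space1)
  have "(\<lambda>z. ennreal (l (fst z) (snd z) / snd z)) \<in> borel_measurable (borel \<Otimes>\<^sub>M restrict_space borel {0<..})"
    using 1 2 by measurable
  then show ?thesis using measurable_cong_sets[OF sets_base refl] by (simp add: case_prod_beta')
qed

lemma sigma_finite_marks: "sigma_finite_measure (restrict_space lborel {0<..} :: real measure)"
  by (rule sigma_finite_measure_restrict_space) (auto intro: lborel.sigma_finite_measure_axioms)

text \<open>Since \<open>l > 0\<close>, the intensity has the same null sets as the product measure, under which a cylinder is
  null iff its base is. This yields both that shells are charged and that fibres over points are null.\<close>
lemma emeasure_intensity_cylinder_eq_0_iff:
  assumes A: "A \<in> sets borel"
  shows "emeasure (intensity l) (A \<times> {0<..}) = 0 \<longleftrightarrow> emeasure lborel A = 0"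
proof -
  interpret R: sigma_finite_measure "restrict_space lborel {0<..} :: real measure" by (rule sigma_finite_marks)
  have AR: "A \<times> {0<..} \<in> sets base" using A by (intro pair_measureI) (auto simp: sets_restrict_space)
  have "1 = emeasure lborel {0<..<1::real}" by simp
  also have "\<dots> \<le> emeasure lborel {0::real<..}" by (rule emeasure_mono) auto
  finally have "emeasure (restrict_space lborel {0::real<..}) {0<..} \<noteq> 0"
    by (subst emeasure_restrict_space) auto
  then have "emeasure base (A \<times> {0<..}) = 0 \<longleftrightarrow> emeasure lborel A = 0"
    using A by (subst R.emeasure_pair_measure_Times) (auto simp: sets_restrict_space)
  moreover have "A \<times> {0<..} \<in> null_sets (intensity l) \<longleftrightarrow> A \<times> {0<..} \<in> null_sets base"
  proof -
    have "AE z in base. (z \<in> A \<times> {0<..} \<longrightarrow> (case z of (x, s) \<Rightarrow> ennreal (l x s / s)) = 0) \<longleftrightarrow> z \<notin> A \<times> {0<..}"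
    proof (rule AE_I2)
      fix z assume "z \<in> space base"
      then obtain x s where "z = (x, s)" "0 < s" by (auto simp: space_base)
      then show "(z \<in> A \<times> {0<..} \<longrightarrow> (case z of (x, s) \<Rightarrow> ennreal (l x s / s)) = 0) \<longleftrightarrow> z \<notin> A \<times> {0<..}"
        using l_pos[of s x] by (simp add: not_le)
    qed
    then have "(AE z in base. z \<in> A \<times> {0<..} \<longrightarrow> (case z of (x, s) \<Rightarrow> ennreal (l x s / s)) = 0) \<longleftrightarrow> (AE z in base. z \<notin> A \<times> {0<..})"
      by (rule eventually_subst)
    then show ?thesis unfolding intensity_def null_sets_density_iff[OF weight_measurable]
      using AR AE_iff_null_sets[OF AR] by simp
  qed
  ultimately show ?thesis using AR by (simp add: null_sets_def intensity_def)
qed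

lemma intensity_locally_finite: "locally_finite_intensity (intensity l)"
proof
  show "sets (intensity l) = sets (borel \<Otimes>\<^sub>M restrict_space borel {0<..})"
    using sets_base by (simp add: intensity_def)
  show "emeasure (intensity l) (A \<times> {0<..}) < \<infinity>" if "A \<in> sets borel" "bounded A" for A
    using that by (intro l_finite) auto
  show "0 < emeasure (intensity l) (shell n \<times> {0<..})" for n
    using emeasure_intensity_cylinder_eq_0_iff[OF shell_borel, of n] shell_nonnull[of n, where 'a='a]
    by (auto simp: zero_less_iff_neq_zero)
  show "emeasure (intensity l) ({x} \<times> {0<..}) = 0" for x
    using emeasure_intensity_cylinder_eq_0_iff[of "{x}"] by simp
qed

sublocale locally_finite_intensity "intensity l" by (rule intensity_locally_finite)

text \<open>On each section with fixed mark \<open>s\<close> this is the substitution \<open>y = \<phi> x\<close>. The mass \<open>l(\<phi>\<^sup>-\<^sup>1 y, s) / s * J(y)\<close>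
  that arrives at \<open>y\<close> is \<open>\<rho>(y, s)\<close> times the original density \<open>l(y, s) / s\<close>.\<close>
lemma distr_intensity:
  assumes bij: "bij \<phi>" and \<phi>: "continuous_on UNIV \<phi>" and \<phi>': "continuous_on UNIV (inv \<phi>)"
    and J: "J \<in> borel_measurable borel" "\<And>x. 0 \<le> J x" "distr lborel borel \<phi> = density lborel (\<lambda>x. ennreal (J x))"
    and \<rho>: "\<rho> \<in> borel_measurable (borel \<Otimes>\<^sub>M borel)"
    and \<rho>_eq: "\<And>x s. 0 < s \<Longrightarrow> \<rho> (x, s) = l (inv \<phi> x) s / l x s * J x"
  shows "distr (intensity l) (intensity l) (\<lambda>z. (\<phi> (fst z), snd z)) = density (intensity l) (\<lambda>z. ennreal (\<rho> z))"
proof (rule measure_eqI)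
  let ?m = "intensity l" and ?\<Phi> = "\<lambda>z::'a \<times> real. (\<phi> (fst z), snd z)"
  let ?w = "\<lambda>z. ennreal (l (fst z) (snd z) / snd z)"
  interpret R: sigma_finite_measure "restrict_space lborel {0<..} :: real measure" by (rule sigma_finite_marks)
  interpret P: pair_sigma_finite "lborel :: 'a measure" "restrict_space lborel {0<..} :: real measure" ..
  have w: "?w \<in> borel_measurable base" using weight_measurable by (simp add: case_prod_beta')
  have m: "?m = density base ?w" by (simp add: intensity_def case_prod_beta')
  have [measurable]: "\<phi> \<in> borel_measurable borel" "inv \<phi> \<in> borel_measurable borel"
    using \<phi> \<phi>' by (auto intro: borel_measurable_continuous_onI)
  have shift: "(\<lambda>z. (g (fst z), snd z)) \<in> measurable base base" if [measurable]: "g \<in> borel_measurable borel" for g :: "'a \<Rightarrow> 'a"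
    by measurable
  have \<Phi>: "?\<Phi> \<in> measurable ?m ?m" using shift[of \<phi>] by (simp add: m)
  have "(\<lambda>z. (fst z, snd z)) \<in> measurable base (borel \<Otimes>\<^sub>M borel)"
    using fst_measurable snd_measurable by (intro measurable_Pair) (simp_all add: m)
  from measurable_compose[OF this \<rho>] have \<rho>m: "\<rho> \<in> borel_measurable base" by simp
  show "sets (distr ?m ?m ?\<Phi>) = sets (density ?m (\<lambda>z. ennreal (\<rho> z)))" by simp
  fix A assume "A \<in> sets (distr ?m ?m ?\<Phi>)"
  then have A: "A \<in> sets base" by (simp add: m)
  then have [measurable]: "(indicator A :: _ \<Rightarrow> ennreal) \<in> borel_measurable base" by simp
  have sec: "(\<lambda>x. F (x, s)) \<in> borel_measurable lborel" if "F \<in> borel_measurable base" "0 < s" for F :: "'a \<times> real \<Rightarrow> ennreal" and s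
    using that by (intro measurable_compose[OF _ that(1)] measurable_Pair) (auto simp: space_restrict_space)
  have "emeasure (distr ?m ?m ?\<Phi>) A = (\<integral>\<^sup>+z. indicator A z \<partial>distr ?m ?m ?\<Phi>)" using A by (simp add: m)
  also have "\<dots> = (\<integral>\<^sup>+z. indicator A (?\<Phi> z) \<partial>?m)"
    using A by (intro nn_integral_distr[OF \<Phi>]) (simp add: m)
  also have "\<dots> = (\<integral>\<^sup>+z. ?w z * indicator A (?\<Phi> z) \<partial>base)"
    unfolding m using w measurable_compose[OF shift[of \<phi>], of "indicator A"] by (intro nn_integral_density) auto
  also have "\<dots> = (\<integral>\<^sup>+s. (\<integral>\<^sup>+x. ?w (x, s) * indicator A (\<phi> x, s) \<partial>lborel) \<partial>restrict_space lborel {0<..})"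
    using w measurable_compose[OF shift[of \<phi>], of "indicator A"] by (subst P.nn_integral_snd[symmetric]) auto
  also have "\<dots> = (\<integral>\<^sup>+s. (\<integral>\<^sup>+x. ?w (x, s) * (ennreal (\<rho> (x, s)) * indicator A (x, s)) \<partial>lborel) \<partial>restrict_space lborel {0<..})"
  proof (rule nn_integral_cong)
    fix s assume "s \<in> space (restrict_space lborel {0::real<..})"
    then have s: "0 < s" by (simp add: space_restrict_space)
    let ?H = "\<lambda>y. ?w (inv \<phi> y, s) * indicator A (y, s)"
    have H: "?H \<in> borel_measurable borel"
      using sec[OF measurable_compose[OF shift[of "inv \<phi>"] w] s] sec[OF _ s, of "indicator A"] by simp
    have "(\<integral>\<^sup>+x. ?w (x, s) * indicator A (\<phi> x, s) \<partial>lborel) = (\<integral>\<^sup>+x. ?H (\<phi> x) \<partial>lborel)"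
      using bij by (simp add: bij_is_inj)
    also have "\<dots> = (\<integral>\<^sup>+y. ?H y \<partial>distr lborel borel \<phi>)" using H by (subst nn_integral_distr) auto
    also have "\<dots> = (\<integral>\<^sup>+y. ennreal (J y) * ?H y \<partial>lborel)"
      unfolding J(3) using J(1) H by (subst nn_integral_density) auto
    also have "\<dots> = (\<integral>\<^sup>+x. ?w (x, s) * (ennreal (\<rho> (x, s)) * indicator A (x, s)) \<partial>lborel)"
    proof (rule nn_integral_cong)
      fix y
      have "ennreal (J y) * ennreal (l (inv \<phi> y) s / s) = ennreal (l y s / s) * ennreal (\<rho> (y, s))"
        using s l_pos[OF s, of y] l_pos[OF s, of "inv \<phi> y"] J(2)[of y]
        by (simp add: \<rho>_eq[OF s] ennreal_mult[symmetric] field_simps)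
      then show "ennreal (J y) * ?H y = ?w (y, s) * (ennreal (\<rho> (y, s)) * indicator A (y, s))"
        by (simp add: mult.assoc[symmetric])
    qed
    finally show "(\<integral>\<^sup>+x. ?w (x, s) * indicator A (\<phi> x, s) \<partial>lborel)
      = (\<integral>\<^sup>+x. ?w (x, s) * (ennreal (\<rho> (x, s)) * indicator A (x, s)) \<partial>lborel)" .
  qed
  also have "\<dots> = (\<integral>\<^sup>+z. ?w z * (ennreal (\<rho> z) * indicator A z) \<partial>base)"
    using w \<rho>m by (subst P.nn_integral_snd[symmetric]) auto
  also have "\<dots> = (\<integral>\<^sup>+z. ennreal (\<rho> z) * indicator A z \<partial>?m)"
    unfolding m using w \<rho>m by (intro nn_integral_density[symmetric]) auto
  also have "\<dots> = emeasure (density ?m (\<lambda>z. ennreal (\<rho> z))) A"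
    using A \<rho>m by (intro emeasure_density[symmetric]) (auto simp: m)
  finally show "emeasure (distr ?m ?m ?\<Phi>) A = emeasure (density ?m (\<lambda>z. ennreal (\<rho> z))) A" .
qed

end

section \<open>Quasi-invariance under diffeomorphisms\<close>

lemma smooth_has_derivative:
  "smooth f \<Longrightarrow> (f has_derivative frechet_derivative f (at x)) (at x)"
  unfolding smooth_def by (drule spec[of _ "Suc 0"]) (simp add: frechet_derivative_works)

lemma smooth_continuous: "smooth f \<Longrightarrow> continuous_on UNIV f"
  unfolding smooth_def by (drule spec[of _ 0]) simp

lemma smooth_continuous_derivative: "smooth f \<Longrightarrow> continuous_on UNIV (\<lambda>x. frechet_derivative f (at x) v)"
  unfolding smooth_def by (drule spec[of _ "Suc 0"]) simp

lemma jacobian_density_measurable: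
  fixes \<phi> :: "real ^ 'n \<Rightarrow> real ^ 'n"
  assumes "smooth (inv \<phi>)"
  shows "jacobian_density \<phi> \<in> borel_measurable borel"
proof -
  have [measurable]: "(\<lambda>x. frechet_derivative (inv \<phi>) (at x) v $ i) \<in> borel_measurable borel" for v i
    by (rule borel_measurable_continuous_onI) (intro continuous_intros smooth_continuous_derivative[OF assms])
  show ?thesis unfolding jacobian_density_def det_def matrix_def by simp
qed

text \<open>By the chain rule the derivatives of \<open>\<phi>\<close> and of its inverse are inverse matrices.\<close>
lemma jacobian_density_pos:
  fixes \<phi> :: "real ^ 'n \<Rightarrow> real ^ 'n"
  assumes bij: "bij \<phi>" and s: "smooth \<phi>" "smooth (inv \<phi>)"
  shows "0 < jacobian_density \<phi> x"
proof -
  let ?A = "frechet_derivative \<phi> (at (inv \<phi> x))" and ?B = "frechet_derivative (inv \<phi>) (at x)"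
  have A: "(\<phi> has_derivative ?A) (at (inv \<phi> x))" and B: "(inv \<phi> has_derivative ?B) (at x)"
    using s by (auto intro: smooth_has_derivative)
  have "((\<phi> \<circ> inv \<phi>) has_derivative (?A \<circ> ?B)) (at x)" using B A by (rule diff_chain_at)
  moreover have "\<phi> \<circ> inv \<phi> = (\<lambda>x. x)" using bij by (auto simp: fun_eq_iff bij_is_surj surj_f_inv_f)
  ultimately have "?A \<circ> ?B = (\<lambda>x. x)" using has_derivative_unique[OF _ has_derivative_ident] by metis
  then have "matrix (?A \<circ> ?B) = mat 1" by (simp add: matrix_id_mat_1[unfolded id_def])
  then have "matrix ?A ** matrix ?B = mat 1"
    unfolding matrix_compose[OF has_derivative_linear[OF B] has_derivative_linear[OF A]] .
  then have "det (matrix ?A) * det (matrix ?B) = 1" by (metis det_mul det_I)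
  then show ?thesis unfolding jacobian_density_def by auto
qed

lemma jacobian_density_identity:
  fixes \<phi> :: "real ^ 'n \<Rightarrow> real ^ 'n"
  assumes bij: "bij \<phi>" and s: "smooth (inv \<phi>)" and K: "closed K" "\<And>x. x \<notin> K \<Longrightarrow> \<phi> x = x" and x: "x \<notin> K"
  shows "jacobian_density \<phi> x = 1"
proof -
  have inv: "inv \<phi> y = y" if "y \<notin> K" for y using K(2)[OF that] bij by (metis bij_inv_eq_iff)
  have "(inv \<phi> has_derivative (\<lambda>x. x)) (at x)"
    by (rule has_derivative_transform_within_open[OF has_derivative_ident, of "- K"]) (use K(1) x inv in auto)
  then have "frechet_derivative (inv \<phi>) (at x) = (\<lambda>x. x)" by (rule frechet_derivative_at[symmetric])
  then show ?thesis unfolding jacobian_density_def by (simp add: matrix_id_mat_1[unfolded id_def])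
qed

lemma distr_lborel_diffeo:
  fixes \<phi> :: "real ^ 'n \<Rightarrow> real ^ 'n"
  assumes bij: "bij \<phi>" and s: "smooth \<phi>" "smooth (inv \<phi>)"
  shows "distr lborel borel \<phi> = density lborel (\<lambda>x. ennreal (jacobian_density \<phi> x))"
proof -
  have [measurable]: "\<phi> \<in> borel_measurable borel" "inv \<phi> \<in> borel_measurable borel"
    using s by (auto intro: borel_measurable_continuous_onI smooth_continuous)
  let ?D = "density lborel (\<lambda>x. ennreal (jacobian_density \<phi> x))"
  have "distr ?D borel (inv \<phi>) = lborel"
    using distr_density_jacobian[OF bij_imp_bij_inv[OF bij] smooth_has_derivative[OF s(2)]] jacobian_density_measurable[OF s(2)]
    unfolding jacobian_density_def by blast
  then have "distr lborel borel \<phi> = distr (distr ?D borel (inv \<phi>)) borel \<phi>" by simp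
  also have "\<dots> = distr ?D borel (\<phi> \<circ> inv \<phi>)" by (rule distr_distr) auto
  also have "\<phi> \<circ> inv \<phi> = (\<lambda>x. x)" using bij by (auto simp: fun_eq_iff bij_is_surj surj_f_inv_f)
  also have "distr ?D borel (\<lambda>x. x) = ?D" by (rule distr_id2) simp
  finally show ?thesis .
qed

lemma has_unordered_prod_finite_support:
  assumes B: "B \<subseteq> A" "finite B" and one: "\<And>x. x \<in> A - B \<Longrightarrow> f x = 1"
  shows "has_unordered_prod f A (\<Prod>x\<in>B. f x)"
  unfolding has_unordered_prod_def
proof (rule tendsto_eventually)
  show "eventually (\<lambda>F. (\<Prod>x\<in>F. f x) = (\<Prod>x\<in>B. f x)) (finite_subsets_at_top A)"
    unfolding eventually_finite_subsets_at_top
    using B one by (intro exI[of _ B]) (auto intro!: prod.mono_neutral_right)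
qed

theorem corollary34:
  fixes l :: "real ^ 'n \<Rightarrow> real \<Rightarrow> real"
  assumes "(\<lambda>(x, s). l x s) \<in> borel_measurable (borel \<Otimes>\<^sub>M restrict_space borel {0<..})"
    and "\<And>x s. 0 < s \<Longrightarrow> 0 < l x s"
    and "\<And>\<Lambda>. \<Lambda> \<in> sets borel \<Longrightarrow> compact (closure \<Lambda>) \<Longrightarrow>
           emeasure (intensity l) (\<Lambda> \<times> {0<..}) < \<infinity>"
  defines "\<mu> \<equiv> random_measure_law (intensity l)"
  shows "quasi_invariant \<mu> \<and>
    (\<forall>\<phi>\<in>Diff0. AE \<eta> in \<mu>.
       has_unordered_prod
         (\<lambda>x. ennreal (l (inv \<phi> x) (measure \<eta> {x}) / l x (measure \<eta> {x}) * jacobian_density \<phi> x))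
         (atoms \<eta>)
         (RN_deriv \<mu> (pushforward_law \<phi> \<mu>) \<eta>))"
proof -
  interpret levy_density l by standard (fact assms(1-3))+
  have \<mu>: "\<mu> = law" unfolding \<mu>_def by (rule random_measure_law_eq)
  have main: "absolutely_continuous law (pushforward_law \<phi> law) \<and> absolutely_continuous (pushforward_law \<phi> law) law \<and>
     (AE \<eta> in law. has_unordered_prod
         (\<lambda>x. ennreal (l (inv \<phi> x) (measure \<eta> {x}) / l x (measure \<eta> {x}) * jacobian_density \<phi> x))
         (atoms \<eta>) (RN_deriv law (pushforward_law \<phi> law) \<eta>))"
    if diffeo: "\<phi> \<in> Diff0" for \<phi>
  proof -
    obtain K where bij: "bij \<phi>" and s: "smooth \<phi>" "smooth (inv \<phi>)"
      and K': "compact K \<and> (\<forall>x. x \<notin> K \<longrightarrow> \<phi> x = x)"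
      using diffeo unfolding Diff0_def by blast
    then have K: "compact K" "\<And>x. x \<notin> K \<Longrightarrow> \<phi> x = x" by auto
    have Kb: "K \<in> sets borel" "bounded K" using K(1) by (auto simp: borel_compact compact_imp_bounded)
    have inv: "inv \<phi> y = y" if "y \<notin> K" for y using K(2)[OF that] bij by (metis bij_inv_eq_iff)
    note cont = smooth_continuous[OF s(1)] smooth_continuous[OF s(2)]
    let ?J = "jacobian_density \<phi>"
    have Jm [measurable]: "?J \<in> borel_measurable borel" by (rule jacobian_density_measurable[OF s(2)])
    have Jpos: "0 < ?J x" for x by (rule jacobian_density_pos[OF bij s])
    have J1: "?J x = 1" if "x \<notin> K" for x by (rule jacobian_density_identity[OF bij s(2) compact_imp_closed[OF K(1)] K(2) that])
    \<comment> \<open>Marks are positive; on the rest of the line \<open>\<rho>\<close> gets the neutral value 1.\<close>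
    define \<rho> where "\<rho> z = (if 0 < snd z then l (inv \<phi> (fst z)) (snd z) / l (fst z) (snd z) * ?J (fst z) else 1)"
      for z :: "(real ^ 'n) \<times> real"
    have \<rho>m: "\<rho> \<in> borel_measurable (borel \<Otimes>\<^sub>M borel)"
    proof -
      let ?R = "restrict_space (borel \<Otimes>\<^sub>M borel) {z :: (real ^ 'n) \<times> real. 0 < snd z}"
      have [measurable]: "inv \<phi> \<in> borel_measurable borel" by (rule borel_measurable_continuous_onI[OF cont(2)])
      have f: "fst \<in> borel_measurable ?R" by (intro measurable_restrict_space1) simp
      have sn: "snd \<in> measurable ?R (restrict_space borel {0<..})"
        by (rule measurable_restrict_space2) (auto simp: space_restrict_space intro: measurable_restrict_space1)
      have "(\<lambda>z. (g (fst z), snd z)) \<in> measurable ?R (borel \<Otimes>\<^sub>M restrict_space borel {0<..})"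
        if g: "g \<in> borel_measurable borel" for g :: "real ^ 'n \<Rightarrow> real ^ 'n"
        by (rule measurable_Pair[OF measurable_compose[OF f g] sn])
      from measurable_compose[OF this assms(1)]
      have L: "(\<lambda>z. l (g (fst z)) (snd z)) \<in> borel_measurable ?R" if "g \<in> borel_measurable borel" for g :: "real ^ 'n \<Rightarrow> real ^ 'n"
        using that by simp
      have "(\<lambda>z. l (inv \<phi> (fst z)) (snd z) / l (fst z) (snd z) * ?J (fst z)) \<in> borel_measurable ?R"
        using L[of "inv \<phi>"] L[of "\<lambda>x. x"] measurable_compose[OF f Jm] by simp
      then show ?thesis unfolding \<rho>_def
        by (subst measurable_If_restrict_space_iff) auto
    qed
    have \<rho>pos: "0 < \<rho> z" for z using Jpos assms(2) by (simp add: \<rho>_def)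
    have \<rho>1: "\<rho> (x, t) = 1" if "x \<notin> K" for x t
      using J1[OF that] inv[OF that] assms(2)[of t x] by (cases "0 < t") (auto simp: \<rho>_def)
    have push: "distr (intensity l) (intensity l) (\<lambda>z. (\<phi> (fst z), snd z)) = density (intensity l) (\<lambda>z. ennreal (\<rho> z))"
      by (rule distr_intensity[OF bij cont Jm less_imp_le[OF Jpos] distr_lborel_diffeo[OF bij s] \<rho>m]) (simp add: \<rho>_def)
    have dens: "pushforward_law \<phi> law = density law (\<lambda>\<eta>. ennreal (mark_product \<rho> K \<eta>))"
      by (rule pushforward_law_density[OF bij cont K \<rho>m less_imp_le[OF \<rho>pos] \<rho>1 push])
    note equiv = pushforward_law_equivalent[OF dens Kb \<rho>m \<rho>pos]
    have "AE \<eta> in law. has_unordered_prod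
         (\<lambda>x. ennreal (l (inv \<phi> x) (measure \<eta> {x}) / l x (measure \<eta> {x}) * ?J x))
         (atoms \<eta>) (RN_deriv law (pushforward_law \<phi> law) \<eta>)"
      using equiv(3) law_finitely_many_atoms[OF Kb(2,1)] AE_space
    proof eventually_elim
      fix \<eta> assume RN: "RN_deriv law (pushforward_law \<phi> law) \<eta> = ennreal (mark_product \<rho> K \<eta>)"
        and fin: "finite (atoms \<eta> \<inter> K)" and "\<eta> \<in> space law"
      then have \<eta>: "\<eta> \<in> radon_measures"
        using sets_eq_imp_space_eq[OF sets_law] by (auto simp: space_discrete_radon_space discrete_imp_radon)
      let ?f = "\<lambda>x. ennreal (l (inv \<phi> x) (measure \<eta> {x}) / l x (measure \<eta> {x}) * ?J x)"
      have f: "?f x = ennreal (\<rho> (x, measure \<eta> {x}))" if "x \<in> atoms \<eta>" for x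
        using atoms_measure_pos[OF \<eta> that] by (simp add: \<rho>_def)
      have "has_unordered_prod ?f (atoms \<eta>) (\<Prod>x\<in>atoms \<eta> \<inter> K. ?f x)"
        using fin f \<rho>1 by (intro has_unordered_prod_finite_support) auto
      also have "(\<Prod>x\<in>atoms \<eta> \<inter> K. ?f x) = (\<Prod>x\<in>atoms \<eta> \<inter> K. ennreal (\<rho> (x, measure \<eta> {x})))"
        by (intro prod.cong refl f) simp
      also have "\<dots> = RN_deriv law (pushforward_law \<phi> law) \<eta>"
        unfolding RN mark_product_def using \<rho>pos by (intro prod_ennreal less_imp_le)
      finally show "has_unordered_prod ?f (atoms \<eta>) (RN_deriv law (pushforward_law \<phi> law) \<eta>)" .
    qed
    with equiv show ?thesis by blast
  qed
  show ?thesis unfolding \<mu> quasi_invariant_def using main by blast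
qed

end
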